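(* For every odd $n\ge5$, the group $$G_n=\langle x_1,\ldots,x_n\mid [x_1,x_2]=[x_2,x_3]=\cdots=[x_{n-1},x_n]=[x_n,x_1]=1\rangle$$ is not a diagram group.
   Context: Notation: $[a,b]=a^{-1}b^{-1}ab$. Diagram groups. A semigroup presentation $\mathcal{P}=\langle\Sigma\mid\mathcal{R}\rangle$ consists of an alphabet $\Sigma$ and a set $\mathcal{R}$ of pairs $(u,v)$ of non-empty words over $\Sigma$, written $u=v$; presentations are assumed anti-symmetric: if $(u=v)\in\mathcal{R}$ then $(v=u)\notin\mathcal{R}$. $\Sigma^+$ and $\Sigma^*$ are the free semigroup and free monoid on $\Sigma$. The graph $\Gamma(\mathcal{P})$ has vertex set $\Sigma^+$ and an edge $(p,u\to v,q)$ from $puq$ to $pvq$ for all $p,q\in\Sigma^*$ and all $u,v$ with $(u=v)\in\mathcal{R}$ or $(v=u)\in\mathcal{R}$; the inverse edge is $(p,v\to u,q)$. The Squier complex $\mathcal{K}(\mathcal{P})$ is the 2-complex obtained from $\Gamma(\mathcal{P})$ by attaching, for all $p,z,q\in\Sigma^*$ and $(\ell_1=r_1),(\ell_2=r_2)\in\mathcal{R}$, a 2-cell along the closed path $p_1p_2^{-1}$, where $p_1=(p,\ell_1\to r_1,z\ell_2q)(pr_1z,\ell_2\to r_2,q)$ and $p_2=(p\ell_1z,\ell_2\to r_2,q)(p,\ell_1\to r_1,zr_2q)$. For $w\in\Sigma^+$ the diagram group $\mathcal{D}(\mathcal{P},w)$ is (up to isomorphism, by Kilibarda's theorem; this may be taken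 as the definition) the fundamental group $\pi_1(\mathcal{K}(\mathcal{P}),w)$. A group is a diagram group if it is isomorphic to some $\mathcal{D}(\mathcal{P},w)$. *)

theory Defs
  imports "HOL-Algebra.Group"
begin

section \<open>Groups given by generators and relators\<close>

text \<open>A group word over \<open>X\<close> is a list of letters \<open>(x, b)\<close> with \<open>x \<in> X\<close>; the letter
  \<open>(x, True)\<close> stands for \<open>x\<close> and \<open>(x, False)\<close> for its inverse.\<close>

type_synonym 'g group_word = "('g \<times> bool) list"

definition group_words :: "'g set \<Rightarrow> 'g group_word set" where
  "group_words X = lists (X \<times> UNIV)"

inductive group_word_eq :: "'g set \<Rightarrow> 'g group_word set \<Rightarrow> 'g group_word \<Rightarrow> 'g group_word \<Rightarrow> bool"
  for X S where
  refl: "s \<in> group_words X \<Longrightarrow> group_word_eq X S s s"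
| sym: "group_word_eq X S s t \<Longrightarrow> group_word_eq X S t s"
| trans: "group_word_eq X S s t \<Longrightarrow> group_word_eq X S t r \<Longrightarrow> group_word_eq X S s r"
| cancel: "s \<in> group_words X \<Longrightarrow> t \<in> group_words X \<Longrightarrow> x \<in> X \<Longrightarrow>
    group_word_eq X S (s @ [(x, b), (x, \<not> b)] @ t) (s @ t)"
| relator: "s \<in> group_words X \<Longrightarrow> t \<in> group_words X \<Longrightarrow> r \<in> S \<Longrightarrow> r \<in> group_words X \<Longrightarrow>
    group_word_eq X S (s @ r @ t) (s @ t)"

definition presented_group :: "'g set \<Rightarrow> 'g group_word set \<Rightarrow> 'g group_word set monoid" where
  "presented_group X S =
    \<lparr>carrier = group_words X // {(s, t). group_word_eq X S s t},
     monoid.mult = (\<lambda>A B. {r. \<exists>s\<in>A. \<exists>t\<in>B. group_word_eq X S (s @ t) r}),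
     one = {r. group_word_eq X S [] r}\<rparr>"

definition word_commutator :: "'g \<Rightarrow> 'g \<Rightarrow> 'g group_word" where
  "word_commutator a b = [(a, False), (b, False), (a, True), (b, True)]"

definition cycle_group :: "nat \<Rightarrow> nat group_word set monoid" where
  "cycle_group n = presented_group {1..n}
     ({word_commutator i (i + 1) | i. 1 \<le> i \<and> i < n} \<union> {word_commutator n 1})"


section \<open>Combinatorial 2-complexes and their fundamental groups\<close>

text \<open>Every geometric edge occurs as two mutually inverse oriented edges; a 2-cell is
  given by the closed path along which it is attached.\<close>

record ('v, 'e) two_complex =
  vertices :: "'v set"
  edges :: "'e set"
  source :: "'e \<Rightarrow> 'v"
  target :: "'e \<Rightarrow> 'v"
  edge_inv :: "'e \<Rightarrow> 'e"
  cells :: "'e list set"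

fun is_path :: "('v, 'e) two_complex \<Rightarrow> 'v \<Rightarrow> 'e list \<Rightarrow> 'v \<Rightarrow> bool" where
  "is_path K x [] y \<longleftrightarrow> x \<in> vertices K \<and> x = y"
| "is_path K x (e # p) y \<longleftrightarrow>
     x \<in> vertices K \<and> e \<in> edges K \<and> source K e = x \<and> is_path K (target K e) p y"

inductive homotopic :: "('v, 'e) two_complex \<Rightarrow> 'v \<Rightarrow> 'v \<Rightarrow> 'e list \<Rightarrow> 'e list \<Rightarrow> bool"
  for K x y where
  refl: "is_path K x p y \<Longrightarrow> homotopic K x y p p"
| sym: "homotopic K x y p q \<Longrightarrow> homotopic K x y q p"
| trans: "homotopic K x y p q \<Longrightarrow> homotopic K x y q r \<Longrightarrow> homotopic K x y p r"
| backtrack: "is_path K x (p @ [e, edge_inv K e] @ q) y \<Longrightarrow> is_path K x (p @ q) y \<Longrightarrow>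
    homotopic K x y (p @ [e, edge_inv K e] @ q) (p @ q)"
| cell: "c \<in> cells K \<Longrightarrow> is_path K x (p @ c @ q) y \<Longrightarrow> is_path K x (p @ q) y \<Longrightarrow>
    homotopic K x y (p @ c @ q) (p @ q)"

definition fundamental_group :: "('v, 'e) two_complex \<Rightarrow> 'v \<Rightarrow> 'e list set monoid" where
  "fundamental_group K x =
    \<lparr>carrier = {p. is_path K x p x} // {(p, q). homotopic K x x p q},
     monoid.mult = (\<lambda>A B. {r. \<exists>p\<in>A. \<exists>q\<in>B. homotopic K x x (p @ q) r}),
     one = {r. homotopic K x x [] r}\<rparr>"


section \<open>Diagram groups\<close>

record 'a semigroup_presentation =
  alphabet :: "'a set"
  relations :: "('a list \<times> 'a list) set"

definition nonempty_words :: "'a set \<Rightarrow> 'a list set" where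
  "nonempty_words A = lists A - {[]}"

definition valid_presentation :: "'a semigroup_presentation \<Rightarrow> bool" where
  "valid_presentation P \<longleftrightarrow>
     relations P \<subseteq> nonempty_words (alphabet P) \<times> nonempty_words (alphabet P) \<and>
     (\<forall>u v. (u, v) \<in> relations P \<longrightarrow> (v, u) \<notin> relations P)"

text \<open>The tuple \<open>(p, u, v, q)\<close> encodes the edge \<open>(p, u \<rightarrow> v, q)\<close> from \<open>puq\<close> to \<open>pvq\<close>.\<close>

type_synonym 'a squier_edge = "'a list \<times> 'a list \<times> 'a list \<times> 'a list"

fun squier_inv :: "'a squier_edge \<Rightarrow> 'a squier_edge" where
  "squier_inv (p, u, v, q) = (p, v, u, q)"

definition squier_cells :: "'a semigroup_presentation \<Rightarrow> 'a squier_edge list set" where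
  "squier_cells P =
    {[(p, l1, r1, z @ l2 @ q), (p @ r1 @ z, l2, r2, q)] @
      map squier_inv (rev [(p @ l1 @ z, l2, r2, q), (p, l1, r1, z @ r2 @ q)])
     | p z q l1 r1 l2 r2.
       p \<in> lists (alphabet P) \<and> z \<in> lists (alphabet P) \<and> q \<in> lists (alphabet P) \<and>
       (l1, r1) \<in> relations P \<and> (l2, r2) \<in> relations P}"

definition squier_complex ::
    "'a semigroup_presentation \<Rightarrow> ('a list, 'a squier_edge) two_complex" where
  "squier_complex P =
    \<lparr>vertices = nonempty_words (alphabet P),
     edges = {(p, u, v, q). p \<in> lists (alphabet P) \<and> q \<in> lists (alphabet P) \<and>
                ((u, v) \<in> relations P \<or> (v, u) \<in> relations P)},
     source = (\<lambda>(p, u, v, q). p @ u @ q),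
     target = (\<lambda>(p, u, v, q). p @ v @ q),
     edge_inv = squier_inv,
     cells = squier_cells P\<rparr>"

definition diagram_group ::
    "'a semigroup_presentation \<Rightarrow> 'a list \<Rightarrow> 'a squier_edge list set monoid" where
  "diagram_group P w = fundamental_group (squier_complex P) w"

text \<open>The type argument carries the letters of the alphabet: HOL has no quantifier over
  types inside a formula, so a statement about all alphabets keeps \<open>'a\<close> as a free
  type variable.\<close>

definition is_diagram_group :: "'a itself \<Rightarrow> ('g, 'm) monoid_scheme \<Rightarrow> bool" where
  "is_diagram_group (TYPE('a)) G \<longleftrightarrow>
     (\<exists>(P :: 'a semigroup_presentation) w.
        valid_presentation P \<and> w \<in> nonempty_words (alphabet P) \<and> G \<cong> diagram_group P w)"

end

theory Submission
  imports Defs Complex_Main "HOL-Algebra.Elementary_Groups"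
begin

text \<open>Let \<open>\<D>\<close> be a diagram group, acting on the universal cover of the Squier complex. An oriented
  hyperplane of the cover is the class of a lifted edge \<open>(p, u \<rightarrow> v, q)\<close> under moving \<open>p\<close> and \<open>q\<close>
  independently. Its stabiliser is the product of a group acting on the left of \<open>u\<close> and a group
  acting on the right of \<open>u\<close>, and two hyperplanes dual to a common square are ordered from left to
  right. Counting crossings with signs, summed over the hyperplanes in a set invariant under a
  subgroup, gives homomorphisms from that subgroup to the integers, and every homomorphism
  \<open>\<D> \<rightarrow> \<int>\<close> is a combination of such counts.

  Suppose \<open>\<D> = G\<^sub>n\<close> with \<open>n \<ge> 5\<close>, and let \<open>x\<^sub>i\<close> have nonzero count on its orbit of a hyperplane
  \<open>K\<close>. There are finitely many such orbits, and the centraliser of \<open>x\<^sub>i\<close> permutes them; hence some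
  \<open>x\<^sub>j\<^sup>k x\<^sub>i\<^sup>-\<^sup>m\<close> with \<open>k > 0\<close> fixes \<open>K\<close>, for both \<open>j = i \<plusminus> 1\<close>. These two elements do not commute and their
  centralisers are small, so they lie in the same factor of the stabiliser of \<open>K\<close>, and the other
  factor is trivial; this makes \<open>K\<close> a left or a right hyperplane. If hyperplanes \<open>K\<close>, \<open>L\<close> of the same
  kind had linearly independent counts on \<open>\<langle>x\<^sub>i, x\<^sub>i\<^sub>+\<^sub>1\<rangle>\<close>, then \<open>K\<close> would be left of \<open>L\<close> and \<open>L\<close> left of \<open>K\<close>.
  Splitting the coordinate homomorphisms of \<open>G\<^sub>n\<close> into their left and right parts thus writes twice the
  identity matrix as \<open>L + R\<close>, where cyclically consecutive columns of \<open>L\<close> are proportional, and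
  likewise for \<open>R\<close>. Then a zero column of \<open>L\<close> forces the next column of \<open>R\<close> to vanish and conversely,
  which is absurd for odd \<open>n\<close>; and not all columns of both matrices can be nonzero.\<close>

section \<open>Cocycles over a group action\<close>

text \<open>Three facts that the overview only names carry the weight. The left-to-right order is
  antisymmetric because a path acts on the real line by an increasing piecewise linear bijection
  depending only on its homotopy class; pulled back to the base word, the left end of a hyperplane
  is one number, and the order compares these numbers. A homomorphism to the integers is a
  combination of counts because its values on edges, normalised by a spanning tree, agree on
  parallel edges; this needs a tree compatible with adding letters on the right. Centralisers in
  \<open>cycle_group\<close> are found with the same cocycle calculus: the set acted on consists of
  the cosets of the subgroup generated by the two neighbours of \<open>X a\<close>, the edges of the
  Bass-Serre tree of the splitting with stable letter \<open>X a\<close>, and the cocycle is a Fox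
  derivative. The bound on \<open>n\<close> keeps generators whose indices differ by 2 or 3
  non-adjacent; parity enters only in the final step on matrices.\<close>

lemma sum'_reindex_bij_betw:
  assumes "bij_betw f A B"
  shows "sum' (\<lambda>x. g (f x)) A = sum' g B"
proof -
  have bij: "bij_betw f {x \<in> A. g (f x) \<noteq> 0} {x \<in> B. g x \<noteq> 0}"
    using assms by (auto simp: bij_betw_def inj_on_def)
  then show ?thesis
    using bij_betw_finite[OF bij] sum.reindex_bij_betw[OF bij, of g]
    by (simp add: sum.G_def)
qed

lemma sum'_eq_sum_superset:
  assumes "finite F" "{x \<in> A. g x \<noteq> 0} \<subseteq> F" "F \<subseteq> A"
  shows "sum' g A = sum g F"
proof -
  have "sum' g A = sum' g F"
    using assms by (intro sum.mono_neutral_right') auto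
  then show ?thesis using assms by simp
qed

lemma sum'_minus:
  fixes f g :: "'h \<Rightarrow> int"
  assumes "finite {x \<in> A. f x \<noteq> 0}" "finite {x \<in> A. g x \<noteq> 0}"
  shows "sum' (\<lambda>x. f x - g x) A = sum' f A - sum' g A"
proof -
  have "sum' (\<lambda>x. f x - g x) A + sum' g A = sum' (\<lambda>x. f x - g x + g x) A"
    by (rule sum.distrib'[symmetric])
       (auto intro: finite_subset[OF _ finite_UnI[OF assms]] simp: assms)
  then show ?thesis by simp
qed

text \<open>The coefficient of a block is read off at a representative chosen from \<open>S\<close>
  and \<open>B\<close> alone, so different functions \<open>f\<close> supported in the same
  \<open>S\<close> get the same coefficients; \<open>isotropic\<close> compares such expansions term
  by term.\<close>

lemma sum'_decompose:
  fixes f :: "'h \<Rightarrow> int" and c :: "'h \<Rightarrow> int"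
  assumes block: "\<And>x. x \<in> A \<Longrightarrow> x \<in> B x" "\<And>x. x \<in> A \<Longrightarrow> B x \<subseteq> A"
      "\<And>x y. x \<in> A \<Longrightarrow> y \<in> B x \<Longrightarrow> B y = B x"
    and const: "\<And>x y. x \<in> A \<Longrightarrow> y \<in> B x \<Longrightarrow> c y = c x"
    and fin: "finite S" "{x \<in> A. f x \<noteq> 0} \<subseteq> S" "S \<subseteq> A"
  shows "sum' (\<lambda>x. c x * f x) A = (\<Sum>b\<in>B ` S. c (SOME x. x \<in> S \<and> B x = b) * sum' f b)"
proof -
  have "sum' (\<lambda>x. c x * f x) A = (\<Sum>x\<in>S. c x * f x)"
    using fin by (intro sum'_eq_sum_superset) auto
  also have "\<dots> = (\<Sum>b\<in>B ` S. \<Sum>x\<in>{x \<in> S. B x = b}. c x * f x)"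
    by (rule sum.image_gen[OF fin(1)])
  also have "\<dots> = (\<Sum>b\<in>B ` S. c (SOME x. x \<in> S \<and> B x = b) * sum' f b)"
  proof (rule sum.cong[OF HOL.refl])
    fix b assume "b \<in> B ` S"
    then have ex: "\<exists>x. x \<in> S \<and> B x = b" by auto
    define z where "z = (SOME x. x \<in> S \<and> B x = b)"
    have z: "z \<in> S" "B z = b" using someI_ex[OF ex] by (auto simp: z_def)
    have zA: "z \<in> A" using z fin by auto
    have "(\<Sum>x\<in>{x \<in> S. B x = b}. c x * f x) = (\<Sum>x\<in>{x \<in> S. B x = b}. c z * f x)"
    proof (rule sum.cong[OF HOL.refl])
      fix x assume x: "x \<in> {x \<in> S. B x = b}"
      then have "x \<in> B z" using block(1)[of x] z fin by auto
      then show "c x * f x = c z * f x" using const[OF zA] by simp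
    qed
    also have "\<dots> = c z * (\<Sum>x\<in>{x \<in> S. B x = b}. f x)" by (simp add: sum_distrib_left)
    also have "(\<Sum>x\<in>{x \<in> S. B x = b}. f x) = sum' f b"
    proof (rule sum'_eq_sum_superset[symmetric])
      show "finite {x \<in> S. B x = b}" using fin by auto
      show "{x \<in> b. f x \<noteq> 0} \<subseteq> {x \<in> S. B x = b}"
        using z zA block(2)[OF zA] block(3)[OF zA] fin(2) by auto
      show "{x \<in> S. B x = b} \<subseteq> b" using block(1) fin(3) by auto
    qed
    finally show "(\<Sum>x\<in>{x \<in> S. B x = b}. c x * f x) = c (SOME x. x \<in> S \<and> B x = b) * sum' f b"
      by (simp add: z_def)
  qed
  finally show ?thesis .
qed

lemma sum'_nonzero_block:
  fixes f :: "'h \<Rightarrow> int"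
  assumes block: "\<And>x. x \<in> A \<Longrightarrow> x \<in> B x" "\<And>x. x \<in> A \<Longrightarrow> B x \<subseteq> A"
      "\<And>x y. x \<in> A \<Longrightarrow> y \<in> B x \<Longrightarrow> B y = B x"
    and nz: "sum' f A \<noteq> 0"
  shows "\<exists>x\<in>A. sum' f (B x) \<noteq> 0"
proof -
  define S where "S = {x \<in> A. f x \<noteq> 0}"
  \<comment> \<open>\<open>sum'\<close> is 0 by convention when the support is infinite, so a
    nonzero value provides finiteness.\<close>
  have S: "finite S" using nz by (auto simp: S_def sum.G_def split: if_splits)
  have "sum' (\<lambda>x. 1 * f x) A = (\<Sum>b\<in>B ` S. 1 * sum' f b)"
    by (rule sum'_decompose[of A B "\<lambda>_. 1" S f, OF block])
       (use S in \<open>auto simp: S_def\<close>)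
  then have "(\<Sum>b\<in>B ` S. sum' f b) \<noteq> 0" using nz by simp
  then obtain b where "b \<in> B ` S" "sum' f b \<noteq> 0" by (meson sum.neutral)
  then show ?thesis by (auto simp: S_def)
qed

declare pow_nat [simp del]

lemma range_int_shift: "range (\<lambda>m. f (m + k :: int)) = range f"
proof -
  have "f m = f (m - k + k)" for m by simp
  then show ?thesis by (metis (mono_tags, lifting) UNIV_I image_iff subsetI subset_antisym)
qed

lemma (in group) int_pow_commute:
  assumes "g \<in> carrier G" "y \<in> carrier G" "g \<otimes> y = y \<otimes> g"
  shows "g \<otimes> y [^] (m::int) = y [^] m \<otimes> g"
proof -
  have nat: "g \<otimes> y [^] (k::nat) = y [^] k \<otimes> g" for k
  proof (induction k)
    case 0 then show ?case using assms by simp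
  next
    case (Suc k)
    have "g \<otimes> (y [^] k \<otimes> y) = (y [^] k \<otimes> g) \<otimes> y"
      using Suc assms by (simp flip: m_assoc)
    also have "\<dots> = y [^] k \<otimes> (y \<otimes> g)" using assms by (simp add: m_assoc)
    finally show ?case using assms by (simp add: m_assoc)
  qed
  show ?thesis
  proof (cases "m < 0")
    case False then show ?thesis using nat by (simp add: int_pow_def2)
  next
    case True
    define z where "z = y [^] nat (- m)"
    have z: "z \<in> carrier G" "g \<otimes> z = z \<otimes> g" using assms nat by (auto simp: z_def)
    have "g \<otimes> inv z = inv z \<otimes> (z \<otimes> g) \<otimes> inv z" using z assms by (simp flip: m_assoc)
    also have "\<dots> = inv z \<otimes> g" using z assms by (simp add: m_assoc flip: z(2))
    finally show ?thesis using True by (simp add: int_pow_def2 z_def)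
  qed
qed

text \<open>\<open>N\<close> is a 1-cocycle with values in the integral permutation module on
  \<open>Hs\<close>: \<open>N_finite\<close> says that \<open>N g\<close> is a finitely supported
  function, and \<open>N_mult\<close> is the cocycle rule, with \<open>g\<close> acting on functions
  by translation.\<close>

locale cocycle_action = group G for G (structure) +
  fixes Hs :: "'h set" and act :: "'a \<Rightarrow> 'h \<Rightarrow> 'h" and N :: "'a \<Rightarrow> 'h \<Rightarrow> int"
  assumes act_closed: "g \<in> carrier G \<Longrightarrow> K \<in> Hs \<Longrightarrow> act g K \<in> Hs"
    and act_one: "K \<in> Hs \<Longrightarrow> act \<one> K = K"
    and act_mult: "g \<in> carrier G \<Longrightarrow> h \<in> carrier G \<Longrightarrow> K \<in> Hs \<Longrightarrow>
      act (g \<otimes> h) K = act g (act h K)"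
    and N_mult: "g \<in> carrier G \<Longrightarrow> h \<in> carrier G \<Longrightarrow> K \<in> Hs \<Longrightarrow>
      N (g \<otimes> h) K = N g K + N h (act (inv g) K)"
    and N_finite: "g \<in> carrier G \<Longrightarrow> finite {K \<in> Hs. N g K \<noteq> 0}"
begin

lemma act_inv_cancel [simp]:
  assumes "g \<in> carrier G" "K \<in> Hs"
  shows "act g (act (inv g) K) = K" "act (inv g) (act g K) = K"
  using assms act_mult[of g "inv g" K] act_mult[of "inv g" g K] act_one by auto

lemma act_inj: "g \<in> carrier G \<Longrightarrow> inj_on (act g) Hs"
  by (metis act_inv_cancel(2) inj_onI)

definition total :: "'a \<Rightarrow> 'h set \<Rightarrow> int" where
  "total g \<omega> = sum' (N g) \<omega>"

definition stable :: "'a \<Rightarrow> 'h set \<Rightarrow> bool" where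
  "stable g \<omega> \<longleftrightarrow> g \<in> carrier G \<and> \<omega> \<subseteq> Hs \<and> act g ` \<omega> = \<omega>"

lemma N_finite_on: "g \<in> carrier G \<Longrightarrow> \<omega> \<subseteq> Hs \<Longrightarrow> finite {K \<in> \<omega>. N g K \<noteq> 0}"
  by (rule finite_subset[OF _ N_finite]) auto

lemma stable_inv: "stable g \<omega> \<Longrightarrow> stable (inv g) \<omega>"
proof -
  assume s: "stable g \<omega>"
  then have c: "g \<in> carrier G" "\<omega> \<subseteq> Hs" "act g ` \<omega> = \<omega>" by (auto simp: stable_def)
  have "act (inv g) ` act g ` \<omega> = \<omega>"
    unfolding image_image using c by (subst (2) image_ident[symmetric], intro image_cong) auto
  then show ?thesis using c by (simp add: stable_def)
qed

lemma stable_mult: "stable g \<omega> \<Longrightarrow> stable h \<omega> \<Longrightarrow> stable (g \<otimes> h) \<omega>"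
proof -
  assume s: "stable g \<omega>" "stable h \<omega>"
  then have "act (g \<otimes> h) ` \<omega> = act g ` act h ` \<omega>"
    unfolding image_image by (intro image_cong) (auto simp: stable_def act_mult subset_iff)
  then show ?thesis using s by (simp add: stable_def)
qed

lemma stable_one: "\<omega> \<subseteq> Hs \<Longrightarrow> stable \<one> \<omega>"
  by (force simp: stable_def act_one subset_iff)

lemma stable_nat_pow: "stable g \<omega> \<Longrightarrow> stable (g [^] (k::nat)) \<omega>"
proof (induction k)
  case 0 then show ?case using stable_one by (simp add: stable_def)
next
  case (Suc k) then show ?case by (simp add: stable_mult)
qed

lemma stable_int_pow: "stable g \<omega> \<Longrightarrow> stable (g [^] (k::int)) \<omega>"
  by (auto simp: int_pow_def2 stable_nat_pow stable_inv)

lemma sum'_act: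
  assumes "g \<in> carrier G" "\<omega> \<subseteq> Hs"
  shows "sum' (\<lambda>K. f (act (inv g) K)) (act g ` \<omega>) = sum' f \<omega>"
proof -
  have "bij_betw (act (inv g)) (act g ` \<omega>) \<omega>"
  proof (rule bij_betwI[where g = "act g"])
    show "act (inv g) \<in> act g ` \<omega> \<rightarrow> \<omega>" using assms by auto
    show "act g \<in> \<omega> \<rightarrow> act g ` \<omega>" by auto
  qed (use assms in \<open>auto simp: subset_iff act_closed\<close>)
  then show ?thesis by (rule sum'_reindex_bij_betw)
qed

lemma finite_shift:
  assumes g: "g \<in> carrier G" and fin: "finite {K \<in> Hs. f K \<noteq> (0::int)}"
  shows "finite {K \<in> Hs. f (act (inv g) K) \<noteq> 0}"
proof -
  have "{K \<in> Hs. f (act (inv g) K) \<noteq> 0} \<subseteq> act g ` {K \<in> Hs. f K \<noteq> 0}"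
  proof
    fix K assume "K \<in> {K \<in> Hs. f (act (inv g) K) \<noteq> 0}"
    then show "K \<in> act g ` {K \<in> Hs. f K \<noteq> 0}"
      using g act_closed by (intro image_eqI[of _ _ "act (inv g) K"]) auto
  qed
  then show ?thesis using fin finite_surj by blast
qed

lemma finite_shift_on:
  assumes "g \<in> carrier G" "\<omega> \<subseteq> Hs" "finite {K \<in> Hs. f K \<noteq> (0::int)}"
  shows "finite {K \<in> \<omega>. f (act (inv g) K) \<noteq> 0}"
  by (rule finite_subset[OF _ finite_shift[OF assms(1,3)]]) (use assms(2) in auto)

text \<open>The summand of \<open>h\<close> is merely shifted by \<open>g\<close>, which permutes
  \<open>\<omega>\<close>. On the stabiliser of \<open>\<omega>\<close> the total is therefore a
  homomorphism, the translation number along \<open>\<omega>\<close>.\<close>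

lemma total_mult:
  assumes "stable g \<omega>" "h \<in> carrier G"
  shows "total (g \<otimes> h) \<omega> = total g \<omega> + total h \<omega>"
proof -
  have g: "g \<in> carrier G" and \<omega>: "\<omega> \<subseteq> Hs" and e: "act g ` \<omega> = \<omega>"
    using assms by (auto simp: stable_def)
  have "total (g \<otimes> h) \<omega> = sum' (\<lambda>K. N g K + N h (act (inv g) K)) \<omega>"
    unfolding total_def using g \<omega> assms(2) by (intro sum.cong') (auto simp: N_mult)
  also have "\<dots> = total g \<omega> + sum' (\<lambda>K. N h (act (inv g) K)) \<omega>"
    unfolding total_def using g \<omega> assms(2)
    by (intro sum.distrib' N_finite_on finite_shift_on N_finite)
  also have "sum' (\<lambda>K. N h (act (inv g) K)) \<omega> = total h \<omega>"
    using sum'_act[OF g \<omega>, of "N h"] e by (simp add: total_def)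
  finally show ?thesis .
qed

lemma total_one: "\<omega> \<subseteq> Hs \<Longrightarrow> total \<one> \<omega> = 0"
  using total_mult[OF stable_one, of \<omega> "\<one>"] by simp

lemma total_inv: "stable g \<omega> \<Longrightarrow> total (inv g) \<omega> = - total g \<omega>"
  using total_mult[of g \<omega> "inv g"] total_one[of \<omega>] by (auto simp: stable_def)

lemma total_nat_pow: "stable g \<omega> \<Longrightarrow> total (g [^] (k::nat)) \<omega> = int k * total g \<omega>"
proof (induction k)
  case 0 then show ?case by (simp add: total_one stable_def)
next
  case (Suc k)
  then have "total (g [^] k \<otimes> g) \<omega> = total (g [^] k) \<omega> + total g \<omega>"
    by (intro total_mult stable_nat_pow) (auto simp: stable_def)
  then show ?case using Suc by (simp add: algebra_simps)
qed

lemma total_int_pow: "stable g \<omega> \<Longrightarrow> total (g [^] (k::int)) \<omega> = k * total g \<omega>"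
  by (auto simp: int_pow_def2 total_nat_pow total_inv stable_nat_pow)

text \<open>Sum the two expansions of \<open>N (g \<otimes> y) = N (y \<otimes> g)\<close> over \<open>act g ` \<omega>\<close>.\<close>

lemma total_commute:
  assumes y: "stable y \<omega>" and g: "g \<in> carrier G" and comm: "g \<otimes> y = y \<otimes> g"
  shows "stable y (act g ` \<omega>)" "total y (act g ` \<omega>) = total y \<omega>"
proof -
  have yc: "y \<in> carrier G" and \<omega>: "\<omega> \<subseteq> Hs" and e: "act y ` \<omega> = \<omega>"
    using y by (auto simp: stable_def)
  have g\<omega>: "act g ` \<omega> \<subseteq> Hs" using g \<omega> act_closed by auto
  have "act y ` act g ` \<omega> = act (y \<otimes> g) ` \<omega>"
    unfolding image_image using yc g \<omega> by (intro image_cong) (auto simp: act_mult subset_iff)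
  also have "\<dots> = act g ` act y ` \<omega>"
    unfolding image_image using yc g \<omega>
    by (intro image_cong) (auto simp: act_mult subset_iff simp flip: comm)
  finally have e': "act y ` act g ` \<omega> = act g ` \<omega>" using e by simp
  then show st: "stable y (act g ` \<omega>)" using yc g\<omega> by (simp add: stable_def)
  have "total (g \<otimes> y) (act g ` \<omega>) = sum' (\<lambda>K. N g K + N y (act (inv g) K)) (act g ` \<omega>)"
    unfolding total_def using g g\<omega> yc by (intro sum.cong') (auto simp: N_mult)
  also have "\<dots> = total g (act g ` \<omega>) + sum' (\<lambda>K. N y (act (inv g) K)) (act g ` \<omega>)"
    unfolding total_def using g g\<omega> yc
    by (intro sum.distrib' N_finite_on finite_shift_on N_finite)
  also have "sum' (\<lambda>K. N y (act (inv g) K)) (act g ` \<omega>) = total y \<omega>"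
    using sum'_act[OF g \<omega>, of "N y"] by (simp add: total_def)
  finally show "total y (act g ` \<omega>) = total y \<omega>"
    using total_mult[OF st g] comm by simp
qed

definition orb :: "'a \<Rightarrow> 'h \<Rightarrow> 'h set" where
  "orb y K = range (\<lambda>m::int. act (y [^] m) K)"

lemma orb_self: "K \<in> Hs \<Longrightarrow> K \<in> orb y K"
  unfolding orb_def by (rule range_eqI[of _ _ 0]) (simp add: act_one)

lemma orb_subset: "y \<in> carrier G \<Longrightarrow> K \<in> Hs \<Longrightarrow> orb y K \<subseteq> Hs"
  by (auto simp: orb_def act_closed)

lemma act_pow_pow:
  "y \<in> carrier G \<Longrightarrow> K \<in> Hs \<Longrightarrow> act (y [^] (m::int)) (act (y [^] (k::int)) K) = act (y [^] (m + k)) K"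
  by (simp add: int_pow_mult act_mult)

lemma orb_eq:
  assumes "y \<in> carrier G" "K \<in> Hs" "L \<in> orb y K"
  shows "orb y L = orb y K"
proof -
  obtain k :: int where L: "L = act (y [^] k) K" using assms by (auto simp: orb_def)
  have "act (y [^] m) L = act (y [^] (m + k)) K" for m :: int
    using assms by (simp add: L act_pow_pow)
  then have "orb y L = range (\<lambda>m::int. act (y [^] (m + k)) K)" by (auto simp: orb_def)
  also have "\<dots> = orb y K"
    unfolding orb_def by (rule range_int_shift)
  finally show ?thesis .
qed

lemma stable_orb:
  assumes "y \<in> carrier G" "K \<in> Hs"
  shows "stable y (orb y K)"
proof -
  have "act y (act (y [^] m) K) = act (y [^] (m + 1)) K" for m :: int
    using act_pow_pow[OF assms, of 1 m] assms by (simp add: add.commute)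
  then have "act y ` orb y K = range (\<lambda>m::int. act (y [^] (m + 1)) K)"
    by (simp add: orb_def image_image)
  also have "\<dots> = orb y K"
    unfolding orb_def by (rule range_int_shift)
  finally show ?thesis using assms orb_subset by (simp add: stable_def)
qed

lemma act_orb:
  assumes "g \<in> carrier G" "y \<in> carrier G" "g \<otimes> y = y \<otimes> g" "K \<in> Hs"
  shows "act g ` orb y K = orb y (act g K)"
proof -
  have "act g (act (y [^] m) K) = act (y [^] m) (act g K)" for m :: int
    using assms int_pow_commute[OF assms(1-3), of m] by (metis act_mult int_pow_closed)
  then show ?thesis by (auto simp: orb_def image_image)
qed

lemma total_orb_act:
  assumes "g \<in> carrier G" "y \<in> carrier G" "g \<otimes> y = y \<otimes> g" "K \<in> Hs"
  shows "total y (orb y (act g K)) = total y (orb y K)"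
  using total_commute(2)[OF stable_orb[OF assms(2,4)] assms(1,3)] act_orb[OF assms] by simp

lemma total_nonzero_witness:
  assumes "total g \<omega> \<noteq> 0"
  shows "\<exists>K\<in>\<omega>. N g K \<noteq> 0"
proof (rule ccontr)
  assume "\<not> ?thesis"
  then have "sum' (N g) \<omega> = sum' (N g) {}"
    by (intro sum.mono_neutral_right') auto
  then show False using assms by (simp add: total_def)
qed

text \<open>Pigeonhole: each \<open>g [^] s\<close> moves \<open>K\<close> to an element whose orbit
  under \<open>y\<close> has the same nonzero total, so each of these orbits meets the finite
  support of \<open>N y\<close>, and two of them meet it in the same point.\<close>

lemma power_fixes:
  assumes y: "y \<in> carrier G" and g: "g \<in> carrier G" and comm: "g \<otimes> y = y \<otimes> g"
    and K: "K \<in> Hs" and nz: "total y (orb y K) \<noteq> 0"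
  shows "\<exists>k>0. \<exists>m::int. act (g [^] (k::int) \<otimes> y [^] (- m)) K = K"
proof -
  have commk: "g [^] (s::nat) \<otimes> y = y \<otimes> g [^] s" for s
  proof -
    have "y \<otimes> g [^] int s = g [^] int s \<otimes> y" using int_pow_commute[OF y g comm[symmetric]] .
    then show ?thesis by (simp add: int_pow_int)
  qed
  have "\<exists>m::int. N y (act (y [^] m) (act (g [^] s) K)) \<noteq> 0" for s :: nat
  proof -
    have "total y (orb y (act (g [^] s) K)) \<noteq> 0"
      using total_orb_act[of "g [^] s" y K] g y K nz commk by simp
    then show ?thesis using total_nonzero_witness by (force simp: orb_def)
  qed
  then obtain m :: "nat \<Rightarrow> int" where m: "\<And>s. N y (act (y [^] m s) (act (g [^] s) K)) \<noteq> 0"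
    by metis
  define L where "L s = act (y [^] m s) (act (g [^] s) K)" for s
  have "range L \<subseteq> {K \<in> Hs. N y K \<noteq> 0}"
    using m y g K act_closed by (auto simp: L_def)
  then have "finite (range L)" using N_finite[OF y] finite_subset by blast
  then have "\<not> inj L" using finite_imageD infinite_UNIV_nat by blast
  then obtain s t where st: "s < t" "L s = L t"
    by (metis injI nat_neq_iff)
  define k where "k = t - s"
  have t: "t = s + k" "k > 0" using st by (auto simp: k_def)
  have gs: "g [^] t = g [^] s \<otimes> g [^] k" using g by (simp add: t nat_pow_mult)
  have cs: "g [^] s \<otimes> y [^] (a::int) = y [^] a \<otimes> g [^] s" for a
    using int_pow_commute[of "g [^] s" y a] commk g y by simp
  have "act (y [^] m s \<otimes> g [^] s) K = act (y [^] m t \<otimes> g [^] t) K"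
    using st g y K by (simp add: L_def act_mult)
  then have "act (g [^] s) (act (y [^] m s) K) = act (g [^] s) (act (y [^] m t \<otimes> g [^] k) K)"
    using g y K by (simp add: gs act_mult flip: cs m_assoc) (simp add: m_assoc act_mult act_closed)
  then have e: "act (y [^] m s) K = act (y [^] m t \<otimes> g [^] k) K"
    using act_inj[of "g [^] s"] g y K by (auto simp: inj_on_def act_closed)
  have "act (y [^] (m t - m s) \<otimes> g [^] k) K = act (y [^] (- m s)) (act (y [^] m t \<otimes> g [^] k) K)"
    using g y K by (simp add: act_mult act_pow_pow act_closed)
  also have "\<dots> = act (y [^] (- m s)) (act (y [^] m s) K)" using e by simp
  also have "\<dots> = K" using y K by (simp add: act_pow_pow act_one)
  finally have "act (g [^] int k \<otimes> y [^] (- (m s - m t))) K = K"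
    using int_pow_commute[of "g [^] k" y "m t - m s"] commk g y by (simp add: int_pow_int)
  then show ?thesis using t(2) by (metis of_nat_0_less_iff)
qed

end

section \<open>Orbits of the subgroup generated by two commuting elements\<close>

context cocycle_action
begin

definition plane_orb :: "'a \<Rightarrow> 'a \<Rightarrow> 'h \<Rightarrow> 'h set" where
  "plane_orb x y K = range (\<lambda>(a::int, b::int). act (x [^] a \<otimes> y [^] b) K)"

lemma mem_plane_orb:
  "L \<in> plane_orb x y K \<longleftrightarrow> (\<exists>(a::int) b::int. L = act (x [^] a \<otimes> y [^] b) K)"
  by (auto simp: plane_orb_def)

context
  fixes x y
  assumes x: "x \<in> carrier G" and y: "y \<in> carrier G" and xy: "x \<otimes> y = y \<otimes> x"
begin

lemma pow_pow_commute: "x [^] (a::int) \<otimes> y [^] (b::int) = y [^] b \<otimes> x [^] a"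
  using int_pow_commute[of "x [^] a" y b] int_pow_commute[of y x a] x y xy by simp

lemma plane_mult:
  "(x [^] (a::int) \<otimes> y [^] (b::int)) \<otimes> (x [^] (c::int) \<otimes> y [^] (d::int))
    = x [^] (a + c) \<otimes> y [^] (b + d)"
proof -
  have "(x [^] a \<otimes> y [^] b) \<otimes> (x [^] c \<otimes> y [^] d) = x [^] a \<otimes> (y [^] b \<otimes> x [^] c) \<otimes> y [^] d"
    using x y by (simp add: m_assoc)
  also have "\<dots> = x [^] a \<otimes> (x [^] c \<otimes> y [^] b) \<otimes> y [^] d" by (simp add: pow_pow_commute)
  also have "\<dots> = (x [^] a \<otimes> x [^] c) \<otimes> (y [^] b \<otimes> y [^] d)" using x y by (simp add: m_assoc)
  finally show ?thesis using x y by (simp add: int_pow_mult)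
qed

lemma plane_commute:
  "(x [^] (a::int) \<otimes> y [^] (b::int)) \<otimes> (x [^] (c::int) \<otimes> y [^] (d::int))
    = (x [^] c \<otimes> y [^] d) \<otimes> (x [^] a \<otimes> y [^] b)"
  by (simp add: plane_mult add.commute)

lemma plane_orb_self: "K \<in> Hs \<Longrightarrow> K \<in> plane_orb x y K"
  unfolding plane_orb_def by (rule range_eqI[of _ _ "(0, 0)"]) (simp add: act_one)

lemma plane_orb_subset: "K \<in> Hs \<Longrightarrow> plane_orb x y K \<subseteq> Hs"
  using x y by (auto simp: plane_orb_def act_closed)

lemma plane_orb_act_subset:
  assumes "K \<in> Hs"
  shows "plane_orb x y (act (x [^] (a::int) \<otimes> y [^] (b::int)) K) \<subseteq> plane_orb x y K"
proof -
  have "act (x [^] c \<otimes> y [^] d) (act (x [^] a \<otimes> y [^] b) K)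
      = act (x [^] (c + a) \<otimes> y [^] (d + b)) K" for c d :: int
    using assms x y by (simp add: plane_mult flip: act_mult)
  then show ?thesis unfolding mem_plane_orb subset_iff by metis
qed

lemma plane_orb_eq:
  assumes "K \<in> Hs" "L \<in> plane_orb x y K"
  shows "plane_orb x y L = plane_orb x y K"
proof
  obtain a b :: int where L: "L = act (x [^] a \<otimes> y [^] b) K"
    using assms by (auto simp: plane_orb_def)
  show "plane_orb x y L \<subseteq> plane_orb x y K" using plane_orb_act_subset assms L by simp
  have "act (x [^] (-a) \<otimes> y [^] (-b)) L = K"
    using assms x y by (simp add: L plane_mult act_one flip: act_mult)
  moreover have "L \<in> Hs" using assms plane_orb_subset by auto
  ultimately show "plane_orb x y K \<subseteq> plane_orb x y L" using plane_orb_act_subset by metis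
qed

lemma stable_plane_orb:
  assumes K: "K \<in> Hs"
  shows "stable (x [^] (a::int) \<otimes> y [^] (b::int)) (plane_orb x y K)"
proof -
  let ?g = "x [^] a \<otimes> y [^] b"
  have g: "?g \<in> carrier G" using x y by simp
  have sub: "act (x [^] c \<otimes> y [^] d) ` plane_orb x y K \<subseteq> plane_orb x y K" for c d :: int
  proof -
    have "act (x [^] c \<otimes> y [^] d) (act (x [^] a \<otimes> y [^] b) K) \<in> plane_orb x y K" for a b :: int
      using x y K by (auto simp: plane_mult mem_plane_orb simp flip: act_mult)
    then show ?thesis by (auto simp: plane_orb_def)
  qed
  have "L \<in> act ?g ` plane_orb x y K" if L: "L \<in> plane_orb x y K" for L
  proof (rule image_eqI)
    have "L \<in> Hs" using L K plane_orb_subset by auto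
    then show "L = act ?g (act (x [^] (-a) \<otimes> y [^] (-b)) L)"
      using x y by (simp add: plane_mult act_one flip: act_mult)
    show "act (x [^] (-a) \<otimes> y [^] (-b)) L \<in> plane_orb x y K" using sub L by blast
  qed
  then have "act ?g ` plane_orb x y K = plane_orb x y K" using sub by blast
  then show ?thesis using g plane_orb_subset[OF K] by (simp add: stable_def)
qed

lemma stable_plane_orb_gens:
  assumes "K \<in> Hs"
  shows "stable x (plane_orb x y K)" "stable y (plane_orb x y K)"
  using stable_plane_orb[OF assms, of 1 0] stable_plane_orb[OF assms, of 0 1] x y by simp_all

lemma total_plane_orb:
  assumes "K \<in> Hs"
  shows "total (x [^] (a::int) \<otimes> y [^] (b::int)) (plane_orb x y K)
    = a * total x (plane_orb x y K) + b * total y (plane_orb x y K)"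
  using assms y stable_plane_orb_gens
  by (simp add: total_mult stable_int_pow total_int_pow)

text \<open>The plane orbit splits into orbits of \<open>x [^] a \<otimes> y [^] b\<close>. One of
  them has nonzero total, and an element of the plane, which commutes with this one, relates it to
  the orbit of \<open>K\<close> without changing the total.\<close>

lemma total_orb_plane:
  assumes K: "K \<in> Hs"
    and nz: "a * total x (plane_orb x y K) + b * total y (plane_orb x y K) \<noteq> 0"
  shows "total (x [^] (a::int) \<otimes> y [^] (b::int)) (orb (x [^] a \<otimes> y [^] b) K) \<noteq> 0"
proof -
  let ?g = "x [^] a \<otimes> y [^] b"
  have g: "?g \<in> carrier G" using x y by simp
  have sub: "plane_orb x y K \<subseteq> Hs" using K plane_orb_subset by auto
  have "\<exists>L\<in>plane_orb x y K. sum' (N ?g) (orb ?g L) \<noteq> 0"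
  proof (rule sum'_nonzero_block)
    show "orb ?g L \<subseteq> plane_orb x y K" if "L \<in> plane_orb x y K" for L
    proof -
      have "stable (?g [^] m) (plane_orb x y K)" for m :: int
        using stable_int_pow stable_plane_orb[OF K] by blast
      then show ?thesis using that by (auto simp: orb_def stable_def)
    qed
    show "sum' (N ?g) (plane_orb x y K) \<noteq> 0"
      using nz total_plane_orb[OF K, of a b] by (simp add: total_def)
    show "orb ?g M = orb ?g L" if "L \<in> plane_orb x y K" "M \<in> orb ?g L" for L M
      using that sub g orb_eq[of ?g L M] by auto
  qed (use sub g in \<open>auto simp: orb_self\<close>)
  then obtain c d :: int where
    "total ?g (orb ?g (act (x [^] c \<otimes> y [^] d) K)) \<noteq> 0"
    by (auto simp: plane_orb_def total_def)
  then show ?thesis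
    using total_orb_act[of "x [^] c \<otimes> y [^] d" ?g K] x y K plane_commute by simp
qed

lemma total_orb_plane_gens:
  assumes "K \<in> Hs"
  shows "total x (plane_orb x y K) \<noteq> 0 \<Longrightarrow> total x (orb x K) \<noteq> 0"
    "total y (plane_orb x y K) \<noteq> 0 \<Longrightarrow> total y (orb y K) \<noteq> 0"
  using total_orb_plane[OF assms, of 1 0] total_orb_plane[OF assms, of 0 1] x y by simp_all

end

end

section \<open>Hyperplane systems\<close>

text \<open>What the universal cover of a Squier complex contributes to the argument. In
  \<open>cross\<close>, an element of a factor of the stabiliser is a loop beside \<open>K\<close>
  conjugated by a path from the base point to \<open>K\<close>; \<open>b\<close> counts the
  crossings of that path, so the path accounts for a coboundary and only the crossings of the loop
  remain. The 2 in \<open>additive_repr\<close> comes from the two orientations of a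
  hyperplane.\<close>

locale hyperplane_system = cocycle_action G Hs act N
  for G (structure) and Hs :: "'h set" and act :: "'a \<Rightarrow> 'h \<Rightarrow> 'h" and N +
  fixes lt :: "'h \<Rightarrow> 'h \<Rightarrow> bool" and DL DR :: "'h \<Rightarrow> 'a set"
  assumes lt_asym: "lt K L \<Longrightarrow> \<not> lt L K"
    and lt_act: "g \<in> carrier G \<Longrightarrow> K \<in> Hs \<Longrightarrow> L \<in> Hs \<Longrightarrow> lt K L \<Longrightarrow> lt (act g K) (act g L)"
    and DL_stab: "K \<in> Hs \<Longrightarrow> l \<in> DL K \<Longrightarrow> l \<in> carrier G \<and> act l K = K"
    and DR_stab: "K \<in> Hs \<Longrightarrow> r \<in> DR K \<Longrightarrow> r \<in> carrier G \<and> act r K = K"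
    and DL_DR_commute: "K \<in> Hs \<Longrightarrow> l \<in> DL K \<Longrightarrow> r \<in> DR K \<Longrightarrow> l \<otimes> r = r \<otimes> l"
    and stab_factor: "K \<in> Hs \<Longrightarrow> g \<in> carrier G \<Longrightarrow> act g K = K \<Longrightarrow>
      \<exists>l\<in>DL K. \<exists>r\<in>DR K. g = l \<otimes> r"
    and DL_act: "K \<in> Hs \<Longrightarrow> g \<in> carrier G \<Longrightarrow> l \<in> DL K \<Longrightarrow> g \<otimes> l \<otimes> inv g \<in> DL (act g K)"
    and cross: "K \<in> Hs \<Longrightarrow> \<exists>b. finite {L \<in> Hs. b L \<noteq> 0} \<and>
      (\<forall>l\<in>DL K. \<forall>L\<in>Hs. N l L \<noteq> b L - b (act (inv l) L) \<longrightarrow> lt L K) \<and>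
      (\<forall>r\<in>DR K. \<forall>L\<in>Hs. N r L \<noteq> b L - b (act (inv r) L) \<longrightarrow> lt K L)"
    and additive_repr: "(\<And>g h. g \<in> carrier G \<Longrightarrow> h \<in> carrier G \<Longrightarrow> \<phi> (g \<otimes> h) = \<phi> g + \<phi> h) \<Longrightarrow>
      \<exists>F. (\<forall>g\<in>carrier G. \<forall>K\<in>Hs. F (act g K) = F K) \<and>
        (\<forall>g\<in>carrier G. 2 * \<phi> g = sum' (\<lambda>K. F K * N g K) Hs)"
begin

lemma stab_N_zero:
  assumes K: "K \<in> Hs" and g: "g \<in> carrier G" and stab: "act g K = K"
  shows "N g K = 0"
proof -
  obtain l r where lr: "l \<in> DL K" "r \<in> DR K" "g = l \<otimes> r" using stab_factor[OF K g stab] by blast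
  have l: "l \<in> carrier G" "act (inv l) K = K" and r: "r \<in> carrier G" "act (inv r) K = K"
    using DL_stab[OF K lr(1)] DR_stab[OF K lr(2)] K act_inv_cancel(2)[of _ K] by metis+
  \<comment> \<open>Both factors fix \<open>K\<close>, so the coboundary of \<open>b\<close>
    vanishes at \<open>K\<close>; a nonzero value of \<open>N\<close> there would put
    \<open>K\<close> beside itself.\<close>
  have irr: "\<not> lt K K" using lt_asym by blast
  obtain b where b: "\<forall>l\<in>DL K. \<forall>L\<in>Hs. N l L \<noteq> b L - b (act (inv l) L) \<longrightarrow> lt L K"
    "\<forall>r\<in>DR K. \<forall>L\<in>Hs. N r L \<noteq> b L - b (act (inv r) L) \<longrightarrow> lt K L"
    using cross[OF K] by blast
  have "N l K = 0" "N r K = 0" using b irr lr K l r by force+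
  then show ?thesis using N_mult[of l r K] lr l r K by simp
qed

text \<open>A power fixing \<open>K\<close> fixes its whole orbit pointwise, so its cocycle vanishes
  there; but its total is \<open>e\<close> times that of \<open>x\<close>.\<close>

lemma power_not_fix:
  assumes K: "K \<in> Hs" and x: "x \<in> carrier G" and nz: "total x (orb x K) \<noteq> 0"
    and stab: "act (x [^] (e::int)) K = K"
  shows "e = 0"
proof -
  have "N (x [^] e) L = 0" if L: "L \<in> orb x K" for L
  proof -
    obtain m :: int where m: "L = act (x [^] m) K" using L by (auto simp: orb_def)
    have "act (x [^] e) L = act (x [^] m) (act (x [^] e) K)"
      using K x by (simp add: m act_pow_pow add.commute)
    then show ?thesis using stab_N_zero[of L] stab m K x act_closed by simp
  qed
  then have "total (x [^] e) (orb x K) = 0" using total_nonzero_witness by blast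
  then show ?thesis using total_int_pow[OF stable_orb[OF x K]] nz by simp
qed

text \<open>Finite support allows the sum to be split, and \<open>g\<close> permutes
  \<open>\<omega>\<close>, so the two halves cancel.\<close>

lemma coboundary_total_zero:
  assumes st: "stable g \<omega>" and fin: "finite {L \<in> Hs. b L \<noteq> 0}"
    and eq: "\<And>L. L \<in> \<omega> \<Longrightarrow> N g L = b L - b (act (inv g) L)"
  shows "total g \<omega> = 0"
proof -
  have g: "g \<in> carrier G" and \<omega>: "\<omega> \<subseteq> Hs" and im: "act g ` \<omega> = \<omega>"
    using st by (auto simp: stable_def)
  have fin': "finite {L \<in> \<omega>. b L \<noteq> 0}" by (rule finite_subset[OF _ fin]) (use \<omega> in auto)
  have "total g \<omega> = sum' (\<lambda>L. b L - b (act (inv g) L)) \<omega>"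
    unfolding total_def using eq by (intro sum.cong') auto
  also have "\<dots> = sum' b \<omega> - sum' (\<lambda>L. b (act (inv g) L)) \<omega>"
    by (intro sum'_minus fin' finite_shift_on g \<omega> fin)
  also have "\<dots> = 0" using sum'_act[OF g \<omega>, of b] im by simp
  finally show ?thesis .
qed

text \<open>If no member of \<open>\<omega>\<close> were left of \<open>K\<close>, the cocycle of
  \<open>l\<close> would be a finitely supported coboundary on all of
  \<open>\<omega>\<close>.\<close>

lemma DL_cross:
  assumes K: "K \<in> Hs" and l: "l \<in> DL K" and st: "stable l \<omega>" and nz: "total l \<omega> \<noteq> 0"
  shows "\<exists>L\<in>\<omega>. lt L K"
proof -
  obtain b where b: "finite {L \<in> Hs. b L \<noteq> 0}"
      "\<forall>L\<in>Hs. N l L \<noteq> b L - b (act (inv l) L) \<longrightarrow> lt L K"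
    using cross[OF K] l by meson
  then show ?thesis using coboundary_total_zero[OF st b(1)] nz st unfolding stable_def by blast
qed

lemma DR_cross:
  assumes K: "K \<in> Hs" and r: "r \<in> DR K" and st: "stable r \<omega>" and nz: "total r \<omega> \<noteq> 0"
  shows "\<exists>L\<in>\<omega>. lt K L"
proof -
  obtain b where b: "finite {L \<in> Hs. b L \<noteq> 0}"
      "\<forall>L\<in>Hs. N r L \<noteq> b L - b (act (inv r) L) \<longrightarrow> lt K L"
    using cross[OF K] r by meson
  then show ?thesis using coboundary_total_zero[OF st b(1)] nz st unfolding stable_def by blast
qed

text \<open>\<open>one_sided D x y L\<close>: if \<open>x\<close> translates along \<open>L\<close>, then the elements of
  \<open>\<langle>x, y\<rangle>\<close> fixing \<open>L\<close> belong to the factor \<open>D L\<close> of the stabiliser, where \<open>D\<close> is \<open>DL\<close> or \<open>DR\<close>.\<close>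

definition one_sided :: "('h \<Rightarrow> 'a set) \<Rightarrow> 'a \<Rightarrow> 'a \<Rightarrow> 'h \<Rightarrow> bool" where
  "one_sided D x y L \<longleftrightarrow> (\<forall>(k::int) m::int. 0 < k \<longrightarrow> total x (orb x L) \<noteq> 0 \<longrightarrow>
     act (y [^] k \<otimes> x [^] (- m)) L = L \<longrightarrow> y [^] k \<otimes> x [^] (- m) \<in> D L)"

text \<open>\<open>D\<close> stands for one factor of the stabilisers, and \<open>R L K\<close> says
  that \<open>L\<close> lies on the corresponding side of \<open>K\<close>. The hypotheses are met
  by \<open>DL\<close> with \<open>lt\<close> and by \<open>DR\<close> with the reversed
  order.\<close>

context
  fixes D :: "'h \<Rightarrow> 'a set" and R :: "'h \<Rightarrow> 'h \<Rightarrow> bool"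
  assumes D_cross: "\<And>K l \<omega>. K \<in> Hs \<Longrightarrow> l \<in> D K \<Longrightarrow> stable l \<omega> \<Longrightarrow> total l \<omega> \<noteq> 0 \<Longrightarrow> \<exists>L\<in>\<omega>. R L K"
    and R_asym: "\<And>K L. R K L \<Longrightarrow> \<not> R L K"
    and R_act: "\<And>g K L. g \<in> carrier G \<Longrightarrow> K \<in> Hs \<Longrightarrow> L \<in> Hs \<Longrightarrow> R K L \<Longrightarrow> R (act g K) (act g L)"
begin

text \<open>\<open>D_cross\<close> only places some translate of \<open>K'\<close> on the side of
  \<open>K\<close>; undoing the power of \<open>h\<close> brings it back to \<open>K'\<close>, keeps
  \<open>K\<close> in place and respects \<open>R\<close>.\<close>

lemma cross_orb:
  assumes K: "K \<in> Hs" "K' \<in> Hs" and h: "h \<in> carrier G" "h \<in> D K" "act h K = K"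
    and nz: "total h (orb h K') \<noteq> 0"
  shows "R K' K"
proof -
  obtain L where L: "L \<in> orb h K'" "R L K"
    using D_cross[OF K(1) h(2) stable_orb[OF h(1) K(2)] nz] by blast
  then obtain m :: int where m: "L = act (h [^] m) K'" by (auto simp: orb_def)
  have "stable h {K}" using h K by (simp add: stable_def)
  then have stab: "act (h [^] (-m)) K = K" using stable_int_pow[of h "{K}" "-m"] by (auto simp: stable_def)
  have "L \<in> Hs" using m K h act_closed by auto
  then have "R (act (h [^] (-m)) L) (act (h [^] (-m)) K)" using R_act L K h by simp
  moreover have "act (h [^] (-m)) L = K'" using m K h by (simp add: act_pow_pow act_one)
  ultimately show ?thesis using stab by simp
qed

text \<open>Otherwise each of the two hyperplanes would be on the same side of the other one.\<close>

lemma det_zero_aux: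
  assumes x: "x \<in> carrier G" and y: "y \<in> carrier G" and xy: "x \<otimes> y = y \<otimes> x"
    and K: "K \<in> Hs" "K' \<in> Hs"
    and side: "one_sided D x y K" "one_sided D y x K'"
    and nz: "total x (plane_orb x y K) \<noteq> 0" "total y (plane_orb x y K') \<noteq> 0"
  shows "total x (plane_orb x y K) * total y (plane_orb x y K')
       = total y (plane_orb x y K) * total x (plane_orb x y K')"
proof (rule ccontr)
  let ?t = "\<lambda>g L. total g (plane_orb x y L)"
  assume ne: "?t x K * ?t y K' \<noteq> ?t y K * ?t x K'"
  note comm = x y xy
  have tx: "total x (orb x K) \<noteq> 0" using total_orb_plane_gens[OF comm] K nz by blast
  have ty: "total y (orb y K') \<noteq> 0" using total_orb_plane_gens[OF comm] K nz by blast
  \<comment> \<open>An element of the plane fixing \<open>L\<close> fixes its plane orbit pointwise,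
    hence has total zero there; this is a linear relation between the totals of \<open>x\<close> and
    \<open>y\<close>.\<close>
  have zero: "a * ?t x L + b * ?t y L = 0"
    if L: "L \<in> Hs" and stab: "act (x [^] (a::int) \<otimes> y [^] (b::int)) L = L" for L a b
  proof -
    have "N (x [^] a \<otimes> y [^] b) M = 0" if M: "M \<in> plane_orb x y L" for M
    proof -
      obtain c d :: int where m: "M = act (x [^] c \<otimes> y [^] d) L"
        using M by (auto simp: plane_orb_def)
      have "act (x [^] a \<otimes> y [^] b) M = act (x [^] c \<otimes> y [^] d) (act (x [^] a \<otimes> y [^] b) L)"
        using L x y plane_commute[OF comm, of a b c d] by (simp add: m del: m_assoc flip: act_mult)
      then show ?thesis using stab_N_zero[of M] stab m L x y act_closed by simp
    qed
    then show ?thesis using total_plane_orb[OF comm L, of a b] total_nonzero_witness by metis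
  qed
  obtain k m :: int where km: "k > 0" "act (y [^] k \<otimes> x [^] (- m)) K = K"
    using power_fixes[OF x y _ K(1) tx] xy by metis
  obtain k' m' :: int where km': "k' > 0" "act (x [^] k' \<otimes> y [^] (- m')) K' = K'"
    using power_fixes[OF y x xy K(2) ty] by metis
  have h: "y [^] k \<otimes> x [^] (- m) \<in> D K" using side(1) km tx by (simp add: one_sided_def)
  have h': "x [^] k' \<otimes> y [^] (- m') \<in> D K'" using side(2) km' ty by (simp add: one_sided_def)
  have hc: "y [^] k \<otimes> x [^] (- m) = x [^] (- m) \<otimes> y [^] k"
    using pow_pow_commute[OF comm] by simp
  have e: "k * ?t y K = m * ?t x K" using zero[OF K(1), of "-m" k] km(2) hc by simp
  have e': "k' * ?t x K' = m' * ?t y K'" using zero[OF K(2), of k' "-m'"] km'(2) by simp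
  \<comment> \<open>The bracket is the total, on the plane orbit of \<open>K'\<close>, of the
    element that fixes \<open>K\<close>; the relation \<open>e\<close> identifies it with the
    determinant up to nonzero factors.\<close>
  have "?t x K * (- m * ?t x K' + k * ?t y K') = k * (?t x K * ?t y K' - ?t y K * ?t x K')"
    using e by (simp add: algebra_simps)
  then have "- m * ?t x K' + k * ?t y K' \<noteq> 0" using ne km(1) by auto
  then have "R K' K"
    using cross_orb[OF K, of "x [^] (-m) \<otimes> y [^] k"] total_orb_plane[OF comm K(2), of "-m" k]
      h hc km(2) x y by simp
  moreover have "?t y K' * (k' * ?t x K + - m' * ?t y K) = k' * (?t x K * ?t y K' - ?t y K * ?t x K')"
    using e' by (simp add: algebra_simps)
  then have "k' * ?t x K + - m' * ?t y K \<noteq> 0" using ne km'(1) by auto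
  then have "R K K'"
    using cross_orb[OF K(2,1), of "x [^] k' \<otimes> y [^] (-m')"] total_orb_plane[OF comm K(1), of k' "-m'"]
      h' km'(2) x y by simp
  ultimately show False using R_asym by blast
qed

text \<open>Either both products contain a zero factor, or \<open>det_zero_aux\<close> applies to
  the pair \<open>K\<close>, \<open>K'\<close> or to the pair \<open>K'\<close>,
  \<open>K\<close>.\<close>

lemma det_zero:
  assumes x: "x \<in> carrier G" and y: "y \<in> carrier G" and xy: "x \<otimes> y = y \<otimes> x"
    and K: "K \<in> Hs" "K' \<in> Hs"
    and side: "one_sided D x y K" "one_sided D y x K" "one_sided D x y K'" "one_sided D y x K'"
  shows "total x (plane_orb x y K) * total y (plane_orb x y K')
       = total y (plane_orb x y K) * total x (plane_orb x y K')"
  using det_zero_aux[OF x y xy K side(1,4)] det_zero_aux[OF x y xy K(2,1) side(3,2)]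
  by (metis mult.commute mult_eq_0_iff)

text \<open>Both sides expand over pairs of plane orbits, and each pair contributes equally by
  \<open>det_zero\<close>. With \<open>F\<close> and \<open>F'\<close> ranging over the weights of
  homomorphisms, all minors of the two columns for \<open>x\<close> and \<open>y\<close>
  vanish.\<close>

lemma isotropic:
  assumes x: "x \<in> carrier G" and y: "y \<in> carrier G" and xy: "x \<otimes> y = y \<otimes> x"
    and T: "T \<subseteq> Hs" "\<And>g K. g \<in> carrier G \<Longrightarrow> K \<in> T \<Longrightarrow> act g K \<in> T"
    and side: "\<And>K. K \<in> T \<Longrightarrow> one_sided D x y K" "\<And>K. K \<in> T \<Longrightarrow> one_sided D y x K"
    and F: "\<And>g K. g \<in> carrier G \<Longrightarrow> K \<in> Hs \<Longrightarrow> F (act g K) = F K"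
      "\<And>g K. g \<in> carrier G \<Longrightarrow> K \<in> Hs \<Longrightarrow> F' (act g K) = F' K"
  shows "sum' (\<lambda>K. F K * N x K) T * sum' (\<lambda>K. F' K * N y K) T
       = sum' (\<lambda>K. F K * N y K) T * sum' (\<lambda>K. F' K * N x K) T"
proof -
  note comm = x y xy
  let ?B = "plane_orb x y"
  define S where "S = {K \<in> T. N x K \<noteq> 0} \<union> {K \<in> T. N y K \<noteq> 0}"
  have S: "finite S" "S \<subseteq> T" using N_finite_on T x y by (auto simp: S_def)
  have inT: "?B K \<subseteq> T" if "K \<in> T" for K using that T x y by (auto simp: plane_orb_def)
  have cst: "F L = F K" "F' L = F' K" if "K \<in> T" "L \<in> ?B K" for K L
    using that T x y F by (auto simp: plane_orb_def)
  have dec: "sum' (\<lambda>K. E K * N g K) T = (\<Sum>b\<in>?B ` S. E (SOME K. K \<in> S \<and> ?B K = b) * total g b)"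
    if "g = x \<or> g = y" and E: "\<And>K L. K \<in> T \<Longrightarrow> L \<in> ?B K \<Longrightarrow> E L = E K" for g E
    unfolding total_def
  proof (rule sum'_decompose)
    show "K \<in> ?B K" if "K \<in> T" for K using plane_orb_self[OF comm] that T by auto
    show "?B L = ?B K" if "K \<in> T" "L \<in> ?B K" for K L
      using plane_orb_eq[OF comm] that T by auto
    show "{K \<in> T. N g K \<noteq> 0} \<subseteq> S" using that(1) by (auto simp: S_def)
  qed (use S inT E in auto)
  define c where "c b = F (SOME K. K \<in> S \<and> ?B K = b)" for b
  define c' where "c' b = F' (SOME K. K \<in> S \<and> ?B K = b)" for b
  have "(\<Sum>b\<in>?B ` S. c b * total x b) * (\<Sum>b\<in>?B ` S. c' b * total y b)
      = (\<Sum>b\<in>?B ` S. \<Sum>b'\<in>?B ` S. (c b * total x b) * (c' b' * total y b'))"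
    by (simp add: sum_product)
  also have "\<dots> = (\<Sum>b\<in>?B ` S. \<Sum>b'\<in>?B ` S. (c b * total y b) * (c' b' * total x b'))"
  proof (intro sum.cong HOL.refl)
    fix b b' assume "b \<in> ?B ` S" "b' \<in> ?B ` S"
    then obtain K K' where K: "K \<in> S" "K' \<in> S" "b = ?B K" "b' = ?B K'" by auto
    have "total x b * total y b' = total y b * total x b'"
      unfolding K by (rule det_zero[OF comm]) (use K S T side in auto)
    then show "(c b * total x b) * (c' b' * total y b') = (c b * total y b) * (c' b' * total x b')"
      by (simp add: mult.assoc mult.left_commute[of _ "c' b'"])
  qed
  also have "\<dots> = (\<Sum>b\<in>?B ` S. c b * total y b) * (\<Sum>b\<in>?B ` S. c' b * total x b)"
    by (simp add: sum_product)
  finally show ?thesis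
    using dec[of x F, OF _ cst(1)] dec[of y F, OF _ cst(1)] dec[of x F', OF _ cst(2)] dec[of y F', OF _ cst(2)]
    by (simp add: c_def c'_def)
qed

end

lemmas isotropic_left = isotropic[where D = DL and R = lt, OF DL_cross lt_asym lt_act]
lemmas isotropic_right = isotropic[where D = DR and R = "\<lambda>K L. lt L K", OF DR_cross lt_asym lt_act]

end

section \<open>Splittings with parallel columns\<close>

lemma not_dvd_small:
  assumes "0 < \<bar>d\<bar>" "\<bar>d\<bar> < int n"
  shows "\<not> int n dvd d"
  using assms by (metis abs_of_nat dvd_imp_le_int not_less zero_less_abs_iff)

text \<open>A zero column \<open>i\<close> of \<open>L\<close> makes column \<open>i\<close> of
  \<open>R\<close> twice a unit vector modulo \<open>n\<close>, so column \<open>i + 1\<close> of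
  \<open>R\<close> vanishes off the rows congruent to \<open>i\<close>. Following this through
  columns \<open>i + 1\<close> and \<open>i + 2\<close> of \<open>L\<close> produces the entry 2 of
  \<open>R\<close> at \<open>(i + 2, i + 2)\<close>, and proportionality with that column removes
  the remaining entries.\<close>

lemma parallel_columns_vanish:
  fixes L R :: "int \<Rightarrow> int \<Rightarrow> int"
  assumes n: "n \<ge> 3"
    and sum: "\<And>i j. L j i + R j i = 2 * of_bool (int n dvd i - j)"
    and L: "\<And>i j j'. L j i * L j' (i + 1) = L j (i + 1) * L j' i"
    and R: "\<And>i j j'. R j i * R j' (i + 1) = R j (i + 1) * R j' i"
    and zero: "\<And>j. L j i = 0"
  shows "R j (i + 1) = 0"
proof -
  have d: "\<not> int n dvd 1" "\<not> int n dvd -1" "\<not> int n dvd 2" "\<not> int n dvd -2"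
    using n by (intro not_dvd_small; simp)+
  have Ri: "R j i = 2 * of_bool (int n dvd i - j)" for j using sum[of j i] zero by simp
  have R1: "R j (i + 1) = 0" if "\<not> int n dvd i - j" for j
    using R[of i i j] that by (simp add: Ri)
  have L1: "L (i + 1) (i + 1) = 2" "L (i + 2) (i + 1) = 0"
    using sum[of "i + 1" "i + 1"] R1[of "i + 1"] sum[of "i + 2" "i + 1"] R1[of "i + 2"] d by simp_all
  have two: "i + 1 + 1 = i + 2" by simp
  have "L (i + 2) (i + 2) = 0" using L[of "i + 1" "i + 1" "i + 2", unfolded two] L1 by simp
  then have "R (i + 2) (i + 2) = 2" using sum[of "i + 2" "i + 2"] by simp
  then have Rii: "R i (i + 1) = 0" using R[of i "i + 1" "i + 2", unfolded two] R1[of "i + 2"] d by simp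
  show ?thesis
  proof (cases "int n dvd i - j")
    case False then show ?thesis using R1 by simp
  next
    case True
    \<comment> \<open>Rows are not known to be periodic, so a row congruent to \<open>i\<close> is
      compared with row \<open>i\<close> itself.\<close>
    then have "R j i = 2" by (simp add: Ri)
    then show ?thesis using R[of i i j] Rii Ri[of i] by simp
  qed
qed

text \<open>Vanishing alternates between \<open>L\<close> and \<open>R\<close> along the columns, so
  after \<open>n\<close> steps, an odd number, the same column would vanish in both, against the
  diagonal entry 2. Hence no column is zero, and in each matrix a row vanishes everywhere or
  nowhere.\<close>

lemma no_parallel_splitting:
  fixes L R :: "int \<Rightarrow> int \<Rightarrow> int"
  assumes n: "n \<ge> 3" "odd n"
    and sum: "\<And>i j. L j i + R j i = 2 * of_bool (int n dvd i - j)"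
    and L: "\<And>i j j'. L j i * L j' (i + 1) = L j (i + 1) * L j' i"
    and R: "\<And>i j j'. R j i * R j' (i + 1) = R j (i + 1) * R j' i"
    and per: "\<And>i j. L j (i + int n) = L j i" "\<And>i j. R j (i + int n) = R j i"
  shows False
proof -
  have stepL: "\<forall>j. R j (i + 1) = 0" if "\<forall>j. L j i = 0" for i
    using parallel_columns_vanish[of n L R i] n sum L R that by blast
  have stepR: "\<forall>j. L j (i + 1) = 0" if "\<forall>j. R j i = 0" for i
    using parallel_columns_vanish[of n R L i] n sum L R that by (simp add: add.commute)
  obtain k where k: "n = 2 * k + 1" using n by (auto elim: oddE)
  have evenL: "\<forall>j. L j (i + 2 * int m) = 0" if "\<forall>j. L j i = 0" for i m
  proof (induction m)
    case 0 then show ?case using that by simp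
  next
    case (Suc m)
    then show ?case using stepR[OF stepL[OF Suc]] by (simp add: algebra_simps)
  qed
  have evenR: "\<forall>j. R j (i + 2 * int m) = 0" if "\<forall>j. R j i = 0" for i m
  proof (induction m)
    case 0 then show ?case using that by simp
  next
    case (Suc m)
    then show ?case using stepL[OF stepR[OF Suc]] by (simp add: algebra_simps)
  qed
  have nzL: "\<exists>j. L j i \<noteq> 0" for i
  proof (rule ccontr)
    assume a: "\<not> ?thesis"
    then have "\<forall>j. R j (i + 2 * int k + 1) = 0" using evenL[of i k] stepL by blast
    then have "R i (i + int n) = 0" by (simp add: k algebra_simps)
    then show False using per sum[of i i] a by simp
  qed
  have nzR: "\<exists>j. R j i \<noteq> 0" for i
  proof (rule ccontr)
    assume a: "\<not> ?thesis"
    then have "\<forall>j. L j (i + 2 * int k + 1) = 0" using evenR[of i k] stepR by blast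
    then have "L i (i + int n) = 0" by (simp add: k algebra_simps)
    then show False using per sum[of i i] a by simp
  qed
  have patL: "L j i = 0 \<longleftrightarrow> L j (i + 1) = 0" for i j
    using nzL[of i] nzL[of "i + 1"] L by (metis mult_eq_0_iff)
  have patR: "R j i = 0 \<longleftrightarrow> R j (i + 1) = 0" for i j
    using nzR[of i] nzR[of "i + 1"] R by (metis mult_eq_0_iff)
  have d: "\<not> int n dvd 1" "\<not> int n dvd -1" "\<not> int n dvd 2" "\<not> int n dvd -2"
    using n by (intro not_dvd_small; simp)+
  have neg: "R 2 0 = - L 2 0" "R 2 1 = - L 2 1" "R 0 1 = - L 0 1"
    using sum[of 2 0] sum[of 2 1] sum[of 0 1] d by simp_all
  have "L 2 1 \<noteq> 0"
  proof
    assume z: "L 2 1 = 0"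
    then have "L 2 2 = 0" "R 2 2 = 0" using patL[of 2 1] patR[of 2 1] neg by simp_all
    then show False using sum[of 2 2] by simp
  qed
  \<comment> \<open>In row 2 the matrix \<open>R\<close> is the negative of \<open>L\<close> in
    columns 0 and 1, so the minors of rows 0 and 2 add up to a relation with the known sums as
    coefficients: \<open>2 * L 2 1 = 0\<close>.\<close>
  moreover have "(L 0 0 + R 0 0) * L 2 1 = (L 0 1 + R 0 1) * L 2 0"
    using L[of 0 0 2] R[of 0 0 2] neg by (simp add: algebra_simps)
  ultimately show False using sum[of 0 0] neg by simp
qed

section \<open>Right-angled Artin groups of cycles\<close>

text \<open>Indices run over the integers and count modulo \<open>n\<close>. \<open>E j\<close> is
  the exponent sum of \<open>X j\<close>, \<open>endo\<close> is the universal property with the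
  group itself as target, and \<open>coset_cocycle\<close> counts signed crossings of edges in the
  tree of the splitting with stable letter \<open>X a\<close>.\<close>

locale cycle_raag = group G for G (structure) +
  fixes n :: nat and X :: "int \<Rightarrow> 'a" and E :: "int \<Rightarrow> 'a \<Rightarrow> int"
  assumes n: "n \<ge> 5"
    and X_closed [simp]: "X i \<in> carrier G"
    and X_periodic: "int n dvd i - j \<Longrightarrow> X i = X j"
    and X_commute: "X i \<otimes> X (i + 1) = X (i + 1) \<otimes> X i"
    and E_mult: "g \<in> carrier G \<Longrightarrow> h \<in> carrier G \<Longrightarrow> E j (g \<otimes> h) = E j g + E j h"
    and E_X: "E j (X i) = of_bool (int n dvd i - j)"
    and endo: "(\<And>i. f i \<in> carrier G) \<Longrightarrow> (\<And>i j. int n dvd i - j \<Longrightarrow> f i = f j) \<Longrightarrow>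
      (\<And>i. f i \<otimes> f (i + 1) = f (i + 1) \<otimes> f i) \<Longrightarrow> \<exists>\<theta>\<in>hom G G. \<forall>i. \<theta> (X i) = f i"
    and coset_cocycle: "H = generate G {X (a - 1), X (a + 1)} \<Longrightarrow>
      \<exists>N. cocycle_action G ((\<lambda>g. g <# H) ` carrier G) (\<lambda>g K. g <# K) N \<and>
        (\<forall>K. N (X a) K = of_bool (K = H)) \<and> (\<forall>j K. \<not> int n dvd j - a \<longrightarrow> N (X j) K = 0)"
begin

lemma not_dvd: "0 < \<bar>d\<bar> \<Longrightarrow> \<bar>d\<bar> < 5 \<Longrightarrow> \<not> int n dvd d"
  using not_dvd_small[of d n] n by simp

lemma not_dvd_simps [simp]: "n \<noteq> Suc 0" "\<not> int n dvd 2" "\<not> int n dvd 3" "\<not> int n dvd 4"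
  using n not_dvd[of 2] not_dvd[of 3] not_dvd[of 4] by auto

lemma X_commute_adj: "j = i + 1 \<or> j = i - 1 \<Longrightarrow> X i \<otimes> X j = X j \<otimes> X i"
  using X_commute[of i] X_commute[of "i - 1"] by auto

lemma E_one: "E j \<one> = 0" using E_mult[of \<one> \<one>] by simp

lemma E_inv: "g \<in> carrier G \<Longrightarrow> E j (inv g) = - E j g"
  using E_mult[of g "inv g" j] E_one by simp

lemma E_nat_pow: "g \<in> carrier G \<Longrightarrow> E j (g [^] (k::nat)) = int k * E j g"
  by (induction k) (auto simp: E_one E_mult algebra_simps)

lemma E_int_pow: "g \<in> carrier G \<Longrightarrow> E j (g [^] (k::int)) = k * E j g"
  by (auto simp: int_pow_def2 E_nat_pow E_inv)

lemma E_generate_zero: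
  assumes "g \<in> generate G A" "A \<subseteq> carrier G" "\<And>x. x \<in> A \<Longrightarrow> E j x = 0"
  shows "E j g = 0"
  using assms
proof (induction rule: generate.induct)
  case (eng h1 h2)
  then show ?case using generate_in_carrier by (simp add: E_mult)
qed (auto simp: E_one E_inv subset_iff)

lemma generate_commute:
  assumes "g \<in> generate G A" "A \<subseteq> carrier G" "x \<in> carrier G" "\<And>y. y \<in> A \<Longrightarrow> y \<otimes> x = x \<otimes> y"
  shows "g \<otimes> x = x \<otimes> g"
  using assms
proof (induction rule: generate.induct)
  case (inv h)
  then have "h \<in> carrier G" "x \<otimes> h = h \<otimes> x" by auto
  then show ?case using int_pow_commute[of x h "-1"] inv by (simp add: int_pow_neg)
next
  case (eng h1 h2)
  then have c: "h1 \<in> carrier G" "h2 \<in> carrier G" using generate_in_carrier by auto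
  then have "h1 \<otimes> h2 \<otimes> x = h1 \<otimes> (x \<otimes> h2)" using eng by (simp add: m_assoc)
  also have "\<dots> = x \<otimes> h1 \<otimes> h2" using c eng by (simp flip: m_assoc)
  finally show ?case using c eng by (simp add: m_assoc)
qed auto

text \<open>The subgroup belonging to the closed star of the vertex \<open>a\<close> in the cycle,
  which is the centraliser of every nontrivial power of \<open>X a\<close>, in a form that displays
  the exponent of \<open>X a\<close>.\<close>

definition star :: "int \<Rightarrow> 'a set" where
  "star a = {g. \<exists>s::int. \<exists>f\<in>generate G {X (a - 1), X (a + 1)}. g = X a [^] s \<otimes> f}"

text \<open>The translates of \<open>H\<close> by powers of \<open>X a\<close> carry the whole support of \<open>N h\<close>, and \<open>h\<close>
  has nonzero total translation along them; every element of the centraliser preserves this.\<close>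

lemma centralizer_subset_star:
  assumes j: "j = a + 1 \<or> j = a - 1" and k: "k \<noteq> 0" and g: "g \<in> carrier G"
    and comm: "g \<otimes> (X a [^] (k::int) \<otimes> X j [^] (m::int)) = (X a [^] k \<otimes> X j [^] m) \<otimes> g"
  shows "g \<in> star a"
proof -
  define H where "H = generate G {X (a - 1), X (a + 1)}"
  have gens: "{X (a - 1), X (a + 1)} \<subseteq> carrier G" by simp
  have H: "subgroup H G" unfolding H_def using generate_is_subgroup[OF gens] .
  have Hc: "H \<subseteq> carrier G" using H subgroup.subset by blast
  have XH: "\<eta> \<otimes> X a = X a \<otimes> \<eta>" if "\<eta> \<in> H" for \<eta>
    using that unfolding H_def
    by (rule generate_commute) (use X_commute_adj[of a "a + 1"] X_commute_adj[of a "a - 1"] in auto)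
  have XjH: "X j \<in> H" using j by (auto simp: H_def intro: generate.incl)
  obtain N where N: "cocycle_action G ((\<lambda>g. g <# H) ` carrier G) (\<lambda>g K. g <# K) N"
    and Na: "\<And>K. N (X a) K = of_bool (K = H)"
    and Nj: "\<And>j K. \<not> int n dvd j - a \<Longrightarrow> N (X j) K = 0"
    using coset_cocycle[OF H_def] by blast
  let ?Hs = "(\<lambda>g. g <# H) ` carrier G"
  interpret C: cocycle_action G ?Hs "\<lambda>g K. g <# K" N by (rule N)
  have H1: "\<one> <# H = H" using Hc by (simp add: lcos_mult_one)
  have HHs: "H \<in> ?Hs" using H1 by (intro image_eqI[of _ _ \<one>]) auto
  have jd: "\<not> int n dvd j - a" using j not_dvd[of 1] not_dvd[of "-1"] by auto
  define l where "l = C.orb (X a) H"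
  have stX: "C.stable (X a) l" unfolding l_def by (rule C.stable_orb[OF X_closed HHs])
  have fixj: "X j <# (X a [^] s <# H) = X a [^] s <# H" for s :: int
  proof -
    have "X j <# (X a [^] s <# H) = X a [^] s <# (X j <# H)"
      using int_pow_commute[of "X j" "X a" s] X_commute_adj[OF j] Hc
      by (simp add: lcos_m_assoc)
    then show ?thesis using H XjH coset_join3 by simp
  qed
  have stj: "C.stable (X j) l"
  proof -
    have "(\<lambda>K. X j <# K) ` l = l" unfolding l_def C.orb_def image_image using fixj by simp
    then show ?thesis using stX by (simp add: C.stable_def)
  qed
  let ?h = "X a [^] k \<otimes> X j [^] m"
  have lHs: "l \<subseteq> ?Hs" using stX by (simp add: C.stable_def)
  have Hl: "H \<in> l" unfolding l_def by (rule C.orb_self[OF HHs])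
  have "C.total (X a) l = sum' (\<lambda>K. of_bool (K = H)) l" 
    unfolding C.total_def by (rule sum.cong') (simp_all add: Na)
  also have "\<dots> = sum (\<lambda>K. of_bool (K = H)) {H}"
    by (rule sum'_eq_sum_superset) (use Hl in auto)
  finally have ta: "C.total (X a) l = 1" by simp
  have tj: "C.total (X j) l = 0" using C.total_nonzero_witness[of "X j" l] Nj[OF jd] by blast
  have sth: "C.stable ?h l" by (intro C.stable_mult C.stable_int_pow stX stj)
  have th: "C.total ?h l = k"
    using stX stj by (simp add: C.total_mult C.stable_int_pow C.total_int_pow ta tj)
  \<comment> \<open>\<open>P u\<close> says that \<open>u\<close> preserves \<open>l\<close> and
    that its cocycle is supported in \<open>l\<close>; it passes from \<open>X a\<close> and
    \<open>X j\<close> to products of their powers, in particular to \<open>?h\<close>.\<close>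
  define P where "P u \<longleftrightarrow> C.stable u l \<and> (\<forall>K\<in>?Hs - l. N u K = 0)" for u
  have inv_out: "inv u <# K \<in> ?Hs - l" if "C.stable u l" "K \<in> ?Hs - l" for u K
  proof -
    have u: "u \<in> carrier G" and im: "(\<lambda>K. u <# K) ` l = l" using that by (auto simp: C.stable_def)
    have "K \<in> ?Hs" using that by blast
    then have "u <# (inv u <# K) = K" "inv u <# K \<in> ?Hs" using u C.act_inv_cancel(1) C.act_closed by auto
    moreover have "inv u <# K \<notin> l" using im calculation that by (metis DiffD2 imageI)
    ultimately show ?thesis by blast
  qed
  have P_mult: "P (u \<otimes> v)" if "P u" "P v" for u v
    using that C.stable_mult inv_out[of u] by (auto simp: P_def C.N_mult C.stable_def)
  have P_inv: "P (inv u)" if "P u" for u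
  proof -
    have u: "u \<in> carrier G" "C.stable u l" "C.stable (inv u) l"
      using that C.stable_inv by (auto simp: P_def C.stable_def)
    have "N (inv u) K = 0" if K: "K \<in> ?Hs - l" for K
    proof -
      have K': "K \<in> ?Hs" using K by blast
      have out: "u <# K \<in> ?Hs - l" using inv_out[OF u(3) K] u by simp
      have "N \<one> K = 0" using C.N_mult[of \<one> \<one> K] C.act_one[OF K'] K' by simp
      then have "N (inv u) K + N u (u <# K) = 0" using C.N_mult[of "inv u" u K] u K' by simp
      then show ?thesis using \<open>P u\<close> out by (simp add: P_def)
    qed
    then show ?thesis using u by (simp add: P_def)
  qed
  have P_one: "P \<one>"
  proof -
    have "N \<one> K = 0" if "K \<in> ?Hs" for K
      using C.N_mult[of \<one> \<one> K] C.act_one[OF that] that by simp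
    then show ?thesis using C.stable_one[OF lHs] by (simp add: P_def)
  qed
  have P_nat: "P (u [^] (s::nat))" if "P u" for u s
    by (induction s) (auto simp: P_one intro!: P_mult that)
  have P_int: "P (u [^] (s::int))" if "P u" for u s
    using P_nat[OF that] P_inv by (auto simp: int_pow_def2)
  have "P (X a)" using stX Na Hl by (auto simp: P_def)
  moreover have "P (X j)" using stj Nj[OF jd] by (simp add: P_def)
  ultimately have Ph: "P ?h" by (intro P_mult P_int)
  \<comment> \<open>\<open>g\<close> transports the nonzero translation of \<open>?h\<close> to the
    line \<open>g l\<close>; since \<open>N ?h\<close> is supported in \<open>l\<close>, the two
    lines share a coset.\<close>
  have "C.total ?h ((\<lambda>K. g <# K) ` l) \<noteq> 0"
    using C.total_commute(2)[OF sth g comm] th k by simp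
  then obtain K where K: "K \<in> (\<lambda>K. g <# K) ` l" "N ?h K \<noteq> 0" using C.total_nonzero_witness by blast
  have "K \<in> ?Hs" using K(1) lHs C.act_closed[OF g] by blast
  then have "K \<in> l" using Ph K by (auto simp: P_def)
  then obtain s t :: int where st: "g <# (X a [^] s <# H) = X a [^] t <# H"
    using K(1) by (auto simp: l_def C.orb_def)
  \<comment> \<open>The shared coset expresses \<open>g\<close> through powers of \<open>X a\<close>
    and an element of \<open>H\<close>, which commutes with \<open>X a\<close>.\<close>
  have "g \<otimes> X a [^] s \<in> X a [^] t <# H"
    using st subgroup.one_closed[OF H] g Hc by (force simp: lcos_m_assoc l_coset_def)
  then obtain \<eta> where \<eta>: "\<eta> \<in> H" "g \<otimes> X a [^] s = X a [^] t \<otimes> \<eta>" by (auto simp: l_coset_def)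
  have \<eta>c: "\<eta> \<in> carrier G" using \<eta> Hc by auto
  have "g = g \<otimes> X a [^] s \<otimes> X a [^] (-s)" using g by (simp add: m_assoc flip: int_pow_mult)
  also have "\<dots> = X a [^] t \<otimes> (\<eta> \<otimes> X a [^] (-s))" using \<eta> \<eta>c by (simp add: m_assoc)
  also have "\<dots> = X a [^] t \<otimes> (X a [^] (-s) \<otimes> \<eta>)"
    using int_pow_commute[of \<eta> "X a" "-s"] XH \<eta> \<eta>c by simp
  also have "\<dots> = X a [^] (t - s) \<otimes> \<eta>" using \<eta>c by (simp flip: m_assoc int_pow_mult)
  finally show ?thesis using \<eta> by (auto simp: star_def H_def)
qed

end

section \<open>Endomorphisms of the cycle group and commuting elements of stars\<close>

context cycle_raag
begin

lemma star_gens: "\<sigma> = 1 \<or> \<sigma> = -1 \<Longrightarrow> {X (i + \<sigma> - 1), X (i + \<sigma> + 1)} = {X i, X (i + 2 * \<sigma>)}"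
  by (auto simp: add.commute)

lemma starE:
  assumes "\<sigma> = 1 \<or> \<sigma> = -1" "g \<in> star (i + \<sigma>)"
  obtains s :: int and f where "f \<in> generate G {X i, X (i + 2 * \<sigma>)}" "f \<in> carrier G"
    "g = X (i + \<sigma>) [^] s \<otimes> f"
  using assms star_gens[OF assms(1)] generate_in_carrier[of "{X i, X (i + 2 * \<sigma>)}"]
  unfolding star_def by fastforce

lemma star_closed: "g \<in> star a \<Longrightarrow> g \<in> carrier G"
  using generate_in_carrier[of "{X (a - 1), X (a + 1)}"] by (auto simp: star_def)

lemma E_star:
  assumes "\<sigma> = 1 \<or> \<sigma> = -1" and f: "f \<in> generate G {X i, X (i + 2 * \<sigma>)}"
  shows "E (i + \<sigma>) (X (i + \<sigma>) [^] (s::int) \<otimes> f) = s"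
    "E (i - \<sigma>) (X (i + \<sigma>) [^] (s::int) \<otimes> f) = 0"
proof -
  have fc: "f \<in> carrier G" using generate_in_carrier[OF _ f] by simp
  have z: "E (i + \<sigma>) f = 0" "E (i - \<sigma>) f = 0"
    by (rule E_generate_zero[OF f]; use assms(1) in \<open>auto simp: E_X not_dvd\<close>)+
  show "E (i + \<sigma>) (X (i + \<sigma>) [^] (s::int) \<otimes> f) = s"
    using fc z by (simp add: E_mult E_int_pow E_X)
  show "E (i - \<sigma>) (X (i + \<sigma>) [^] (s::int) \<otimes> f) = 0"
    using fc z assms(1) by (auto simp: E_mult E_int_pow E_X not_dvd)
qed

lemma E_star_other:
  assumes "\<sigma> = 1 \<or> \<sigma> = -1" "g \<in> star (i + \<sigma>)"
  shows "E (i - \<sigma>) g = 0"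
  using starE[OF assms] E_star[OF assms(1)] by metis

lemma hom_fixes_generate:
  assumes \<theta>: "\<theta> \<in> hom G G" and g: "g \<in> generate G A" "A \<subseteq> carrier G"
    and "\<And>x. x \<in> A \<Longrightarrow> \<theta> x = x"
  shows "\<theta> g = g"
  using g assms(4)
proof (induction rule: generate.induct)
  case one then show ?case using hom_one[OF \<theta>] is_group by simp
next
  case (inv h)
  interpret \<theta>: group_hom G G \<theta> using \<theta> by unfold_locales
  show ?case using inv by auto
next
  case (eng h1 h2)
  then show ?case using \<theta> generate_in_carrier by (auto simp: hom_def)
qed auto

lemma hom_generate_power:
  assumes \<theta>: "\<theta> \<in> hom G G" and g: "g \<in> generate G A" "A \<subseteq> carrier G"
    and x: "x \<in> carrier G" and im: "\<And>y. y \<in> A \<Longrightarrow> \<exists>k::int. \<theta> y = x [^] k"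
  shows "\<exists>k::int. \<theta> g = x [^] k"
  using g im
proof (induction rule: generate.induct)
  case one
  then show ?case using hom_one[OF \<theta>] is_group by (metis int_pow_0)
next
  case (inv h)
  interpret \<theta>: group_hom G G \<theta> using \<theta> by unfold_locales
  show ?case using inv x by (metis \<theta>.hom_inv int_pow_neg subsetD)
next
  case (eng h1 h2)
  interpret \<theta>: group_hom G G \<theta> using \<theta> by unfold_locales
  have "h1 \<in> carrier G" "h2 \<in> carrier G" using eng generate_in_carrier by auto
  then show ?case using eng x by (metis \<theta>.hom_mult int_pow_mult)
qed auto

text \<open>The hypothesis makes \<open>X p\<close> and \<open>X q\<close> distinct and
  non-adjacent. Killing all other generators then respects the relations, since of two adjacent
  generators at least one is killed.\<close>

lemma retraction:
  assumes pq: "\<not> int n dvd p - q" "\<not> int n dvd p - q - 1" "\<not> int n dvd p - q + 1"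
  shows "\<exists>\<theta>\<in>hom G G. \<theta> (X p) = X p \<and> \<theta> (X q) = X q \<and>
    (\<forall>k. \<not> int n dvd k - p \<longrightarrow> \<not> int n dvd k - q \<longrightarrow> \<theta> (X k) = \<one>)"
proof -
  define f where "f k = (if int n dvd k - p then X p else if int n dvd k - q then X q else \<one>)" for k
  have per: "f i = f j" if "int n dvd i - j" for i j
  proof -
    have "int n dvd i - r \<longleftrightarrow> int n dvd j - r" for r
      using dvd_diff[OF _ that, of "i - r"] dvd_add[OF that, of "j - r"] by auto
    then show ?thesis by (simp add: f_def)
  qed
  have one: "f i = \<one> \<or> f (i + 1) = \<one>" for i
  proof -
    have "\<not> (int n dvd i - r \<and> int n dvd i + 1 - s)" if "\<not> int n dvd s - r - 1" for r s
    proof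
      assume "int n dvd i - r \<and> int n dvd i + 1 - s"
      then have "int n dvd (i - r) - (i + 1 - s)" using dvd_diff by blast
      then show False using that by (simp add: algebra_simps)
    qed
    moreover have "\<not> int n dvd q - p - 1"
      using pq(3) dvd_minus_iff[of "int n" "p - q + 1"] by (simp add: algebra_simps)
    moreover have "\<not> int n dvd s - s - 1" for s using not_dvd[of "-1"] by simp
    ultimately have "\<not> (int n dvd i - p \<and> int n dvd i + 1 - p)" "\<not> (int n dvd i - p \<and> int n dvd i + 1 - q)"
      "\<not> (int n dvd i - q \<and> int n dvd i + 1 - p)" "\<not> (int n dvd i - q \<and> int n dvd i + 1 - q)"
      using pq(2) by blast+
    then show ?thesis by (auto simp: f_def)
  qed
  have fc: "f i \<in> carrier G" for i by (simp add: f_def)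
  have "f i \<otimes> f (i + 1) = f (i + 1) \<otimes> f i" for i using one[of i] fc[of i] fc[of "i + 1"] by auto
  then obtain \<theta> where "\<theta> \<in> hom G G" "\<forall>i. \<theta> (X i) = f i" using endo[of f] fc per by blast
  moreover have "\<not> int n dvd q - p" using pq(1) dvd_minus_iff[of "int n" "p - q"] by simp
  ultimately show ?thesis by (intro bexI[of _ \<theta>]) (auto simp: f_def)
qed

text \<open>The adjacent generators \<open>X (i - \<sigma>)\<close> and \<open>X i\<close> are
  identified, \<open>X (i + 2 * \<sigma>)\<close> is kept and the others are killed. The kept index
  differs by 2 and 3 from the folded ones, hence is not adjacent to them if
  \<open>n \<ge> 5\<close>; in a cycle of length 4 it would be adjacent to
  \<open>i - \<sigma>\<close>.\<close>

lemma folding: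
  assumes \<sigma>: "\<sigma> = 1 \<or> \<sigma> = -1"
  shows "\<exists>\<theta>\<in>hom G G. \<theta> (X i) = X i \<and> \<theta> (X (i + 2 * \<sigma>)) = X (i + 2 * \<sigma>) \<and>
    \<theta> (X (i - \<sigma>)) = X i \<and> \<theta> (X (i - 2 * \<sigma>)) = \<one>"
proof -
  define f where "f k = (if int n dvd k - i \<or> int n dvd k - (i - \<sigma>) then X i
    else if int n dvd k - (i + 2 * \<sigma>) then X (i + 2 * \<sigma>) else \<one>)" for k
  have per: "f k = f j" if "int n dvd k - j" for k j
  proof -
    have "int n dvd k - r \<longleftrightarrow> int n dvd j - r" for r
      using dvd_diff[OF _ that, of "k - r"] dvd_add[OF that, of "j - r"] by auto
    then show ?thesis by (simp add: f_def)
  qed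
  have excl: "\<not> (int n dvd k - r \<and> int n dvd k + 1 - s)" if "0 < \<bar>s - r - 1\<bar>" "\<bar>s - r - 1\<bar> < 5" for k r s
  proof
    assume "int n dvd k - r \<and> int n dvd k + 1 - s"
    then have "int n dvd (k - r) - (k + 1 - s)" using dvd_diff by blast
    then show False using not_dvd[OF that] by (simp add: algebra_simps)
  qed
  have com: "f k \<otimes> f (k + 1) = f (k + 1) \<otimes> f k" for k
    using excl[of "i + 2 * \<sigma>" i k] excl[of i "i + 2 * \<sigma>" k]
      excl[of "i + 2 * \<sigma>" "i - \<sigma>" k] excl[of "i - \<sigma>" "i + 2 * \<sigma>" k] \<sigma>
    by (auto simp: f_def)
  have fc: "f k \<in> carrier G" for k by (simp add: f_def)
  obtain \<theta> where \<theta>: "\<theta> \<in> hom G G" "\<forall>i. \<theta> (X i) = f i" using endo[of f] fc per com by blast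
  have "f i = X i" "f (i + 2 * \<sigma>) = X (i + 2 * \<sigma>)" "f (i - \<sigma>) = X i" "f (i - 2 * \<sigma>) = \<one>"
    using \<sigma> not_dvd[of 1] not_dvd[of "-1"] not_dvd[of 2] not_dvd[of "-2"] not_dvd[of 3] not_dvd[of "-3"]
      not_dvd[of 4] not_dvd[of "-4"]
    by (auto simp: f_def)
  then show ?thesis using \<theta> by (intro bexI[of _ \<theta>]) simp_all
qed

text \<open>Apply an endomorphism that fixes \<open>f\<close> and sends \<open>g\<close> to a
  nontrivial power of \<open>X i\<close>. Then \<open>f\<close> centralises this power, so it lies
  in \<open>star i\<close>; lying also in the subgroup generated by \<open>X i\<close> and
  \<open>X (i + 2 * \<sigma>)\<close>, it can only be a power of \<open>X i\<close>.\<close>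

lemma commute_with_star:
  assumes \<sigma>: "\<sigma> = 1 \<or> \<sigma> = -1" and f: "f \<in> generate G {X i, X (i + 2 * \<sigma>)}"
    and g: "g \<in> star (i - \<sigma>)" and Eg: "E (i - \<sigma>) g \<noteq> 0" and comm: "f \<otimes> g = g \<otimes> f"
  shows "\<exists>e::int. f = X i [^] e"
proof -
  have A: "{X i, X (i + 2 * \<sigma>)} \<subseteq> carrier G" "{X i, X (i - 2 * \<sigma>)} \<subseteq> carrier G" by auto
  have fc: "f \<in> carrier G" using generate_in_carrier[OF A(1) f] .
  have gc: "g \<in> carrier G" using star_closed[OF g] .
  have \<sigma>': "- \<sigma> = 1 \<or> - \<sigma> = -1" using \<sigma> by auto
  obtain t :: int and u where u: "u \<in> generate G {X i, X (i - 2 * \<sigma>)}" "u \<in> carrier G"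
      "g = X (i - \<sigma>) [^] t \<otimes> u"
    by (rule starE[OF \<sigma>', of g i]) (use g in auto)
  have ri: "\<not> int n dvd i - (i + 2 * \<sigma>)" "\<not> int n dvd i - (i + 2 * \<sigma>) - 1"
      "\<not> int n dvd i - (i + 2 * \<sigma>) + 1"
    using \<sigma> not_dvd by auto
  obtain \<rho> where \<rho>: "\<rho> \<in> hom G G" "\<rho> (X i) = X i" "\<rho> (X (i + 2 * \<sigma>)) = X (i + 2 * \<sigma>)"
    "\<And>k. \<not> int n dvd k - i \<Longrightarrow> \<not> int n dvd k - (i + 2 * \<sigma>) \<Longrightarrow> \<rho> (X k) = \<one>"
    using retraction[OF ri] by blast
  have \<rho>f: "\<rho> f = f" by (rule hom_fixes_generate[OF \<rho>(1) f A(1)]) (use \<rho> in auto)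
  obtain \<theta> where \<theta>: "\<theta> \<in> hom G G" "\<theta> (X i) = X i" "\<theta> (X (i + 2 * \<sigma>)) = X (i + 2 * \<sigma>)"
    "\<theta> (X (i - \<sigma>)) = X i" "\<theta> (X (i - 2 * \<sigma>)) = \<one>"
    using folding[OF \<sigma>] by blast
  have \<theta>f: "\<theta> f = f" by (rule hom_fixes_generate[OF \<theta>(1) f A(1)]) (use \<theta> in auto)
  text \<open>One of the two endomorphisms sends \<open>g\<close> to a nontrivial power of \<open>X i\<close>, since the
    exponent of the image is \<open>E i u\<close> for \<open>\<rho>\<close> and \<open>t + E i u\<close> for \<open>\<theta>\<close>.\<close>
  have pow: "\<exists>k::int. k = E i u + c \<and> \<psi> g = X i [^] k"
    if \<psi>: "\<psi> \<in> hom G G" "\<psi> (X i) = X i" "\<psi> (X (i - 2 * \<sigma>)) = \<one>" and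
      b: "\<psi> (X (i - \<sigma>) [^] t) = X i [^] (c::int)" for \<psi> c
  proof -
    have i1: "X i [^] (1::int) = X i" by simp
    have "\<exists>k::int. \<psi> u = X i [^] k \<and> k = E i u"
    proof -
      have "\<exists>k::int. \<psi> u = X i [^] k"
        by (rule hom_generate_power[OF \<psi>(1) u(1) A(2)])
           (use \<psi> i1 in \<open>auto intro: exI[of _ 1] exI[of _ 0]\<close>)
      moreover have "E i (\<psi> v) = E i v \<and> v \<in> carrier G" if "v \<in> generate G {X i, X (i - 2 * \<sigma>)}" for v
        using that
      proof (induction rule: generate.induct)
        case one
        show ?case using hom_one[OF \<psi>(1)] is_group by simp
      next
        case (incl h)
        then show ?case using \<psi> \<sigma> not_dvd by (auto simp: E_X E_one)
      next
        case (inv h)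
        interpret \<psi>: group_hom G G \<psi> using \<psi> by unfold_locales
        show ?case using inv \<psi>(2,3) \<sigma> not_dvd by (auto simp: E_X E_one E_inv)
      next
        case (eng h1 h2)
        interpret \<psi>: group_hom G G \<psi> using \<psi> by unfold_locales
        show ?case using eng by (simp add: E_mult)
      qed
      moreover have "E i (X i [^] k) = k" for k :: int by (simp add: E_int_pow E_X)
      ultimately show ?thesis using u(1) by metis
    qed
    moreover have "\<psi> g = X i [^] c \<otimes> \<psi> u" using \<psi>(1) u b by (simp add: hom_mult)
    ultimately show ?thesis by (auto simp: int_pow_mult add.commute)
  qed
  have "\<rho> (X (i - 2 * \<sigma>)) = \<one>" "\<rho> (X (i - \<sigma>)) = \<one>" using \<rho>(4) \<sigma> not_dvd by auto
  moreover from this have "\<rho> (X (i - \<sigma>) [^] t) = X i [^] (0::int)"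
    using hom_int_pow[of \<rho> G G "X (i - \<sigma>)" t] \<rho>(1) is_group by simp
  ultimately have 1: "\<rho> g = X i [^] (E i u)" using pow[of \<rho> 0] \<rho> by auto
  have "\<theta> (X (i - \<sigma>) [^] t) = X i [^] t"
    using hom_int_pow[of \<theta> G G "X (i - \<sigma>)" t] \<theta> is_group by simp
  then have 2: "\<theta> g = X i [^] (E i u + t)" using pow[of \<theta> t] \<theta> by auto
  have "t \<noteq> 0" using E_star(1)[OF \<sigma>', of u i t] u Eg by simp
  then obtain \<psi> and M :: int where \<psi>: "\<psi> \<in> hom G G" "\<psi> f = f" "\<psi> g = X i [^] M" "M \<noteq> 0"
  proof (cases "E i u = 0")
    case True then show ?thesis using that[of \<theta> t] \<theta>(1) \<theta>f 2 \<open>t \<noteq> 0\<close> by simp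
  next
    case False then show ?thesis using that[of \<rho> "E i u"] \<rho>(1) \<rho>f 1 by simp
  qed
  have "f \<otimes> X i [^] M = X i [^] M \<otimes> f"
    using arg_cong[OF comm, of \<psi>] \<psi> fc gc by (simp add: hom_mult)
  then have "f \<in> star i"
    using centralizer_subset_star[of "i + 1" i M f 0] \<psi>(4) fc by simp
  then obtain s :: int and v where v: "f = X i [^] s \<otimes> v" "v \<in> generate G {X (i - 1), X (i + 1)}"
    by (auto simp: star_def)
  have A3: "{X (i - 1), X (i + 1)} \<subseteq> carrier G" by simp
  have vc: "v \<in> carrier G" using generate_in_carrier[OF A3 v(2)] .
  \<comment> \<open>\<open>\<rho>\<close> fixes \<open>f\<close> and the power of
    \<open>X i\<close>, but kills both neighbours of \<open>X i\<close> and hence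
    \<open>v\<close>.\<close>
  have "\<rho> (X (i - 1)) = \<one>" "\<rho> (X (i + 1)) = \<one>"
    using \<rho>(4)[of "i - 1"] \<rho>(4)[of "i + 1"] \<sigma> not_dvd by auto
  then have "\<exists>k::int. \<rho> v = \<one> [^] k"
    by (intro hom_generate_power[OF \<rho>(1) v(2) A3]) auto
  then have "\<rho> v = \<one>" by simp
  moreover have "\<rho> (X i [^] s) = X i [^] s"
    using hom_int_pow[of \<rho> G G "X i" s] \<rho> is_group by simp
  ultimately have "f = X i [^] s" using \<rho>f v vc \<rho>(1) by (simp add: hom_mult)
  then show ?thesis by blast
qed

text \<open>Retract onto the non-adjacent generators \<open>X (i + \<sigma>)\<close> and
  \<open>X (i - \<sigma>)\<close>: what is left of \<open>g\<close> and \<open>g'\<close> are the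
  powers with the two exponents, and these commute only if one of them is trivial.\<close>

lemma star_commute_exponent:
  assumes \<sigma>: "\<sigma> = 1 \<or> \<sigma> = -1" and g: "g \<in> star (i + \<sigma>)" and g': "g' \<in> star (i - \<sigma>)"
    and comm: "g \<otimes> g' = g' \<otimes> g"
  shows "E (i + \<sigma>) g = 0 \<or> E (i - \<sigma>) g' = 0"
proof (rule ccontr)
  assume ne: "\<not> ?thesis"
  have \<sigma>': "- \<sigma> = 1 \<or> - \<sigma> = -1" using \<sigma> by auto
  obtain s :: int and f where f: "f \<in> generate G {X i, X (i + 2 * \<sigma>)}" "f \<in> carrier G"
    "g = X (i + \<sigma>) [^] s \<otimes> f" using starE[OF \<sigma> g] .
  obtain t :: int and u where u: "u \<in> generate G {X i, X (i - 2 * \<sigma>)}" "u \<in> carrier G"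
      "g' = X (i - \<sigma>) [^] t \<otimes> u"
    by (rule starE[OF \<sigma>', of g' i]) (use g' in auto)
  have st: "s \<noteq> 0" "t \<noteq> 0" using ne E_star(1)[OF \<sigma> f(1)] E_star(1)[OF \<sigma>', of u i] u f by simp_all
  have ri: "\<not> int n dvd i + \<sigma> - (i - \<sigma>)" "\<not> int n dvd i + \<sigma> - (i - \<sigma>) - 1"
      "\<not> int n dvd i + \<sigma> - (i - \<sigma>) + 1"
    using \<sigma> not_dvd by auto
  obtain \<rho> where \<rho>: "\<rho> \<in> hom G G" "\<rho> (X (i + \<sigma>)) = X (i + \<sigma>)" "\<rho> (X (i - \<sigma>)) = X (i - \<sigma>)"
    "\<And>k. \<not> int n dvd k - (i + \<sigma>) \<Longrightarrow> \<not> int n dvd k - (i - \<sigma>) \<Longrightarrow> \<rho> (X k) = \<one>"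
    using retraction[OF ri] by blast
  have k: "\<rho> (X i) = \<one>" "\<rho> (X (i + 2 * \<sigma>)) = \<one>" "\<rho> (X (i - 2 * \<sigma>)) = \<one>"
    using \<rho>(4)[of i] \<rho>(4)[of "i + 2 * \<sigma>"] \<rho>(4)[of "i - 2 * \<sigma>"] \<sigma> not_dvd by auto
  have "\<exists>k::int. \<rho> f = \<one> [^] k" "\<exists>k::int. \<rho> u = \<one> [^] k"
    by (rule hom_generate_power[OF \<rho>(1) f(1)] hom_generate_power[OF \<rho>(1) u(1)]; use k in auto)+
  then have "\<rho> f = \<one>" "\<rho> u = \<one>" by simp_all
  moreover have "\<rho> (X (i + \<sigma>) [^] s) = X (i + \<sigma>) [^] s" "\<rho> (X (i - \<sigma>) [^] t) = X (i - \<sigma>) [^] t"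
    using hom_int_pow[of \<rho> G G "X (i + \<sigma>)" s] hom_int_pow[of \<rho> G G "X (i - \<sigma>)" t] \<rho> is_group by simp_all
  ultimately have im: "\<rho> g = X (i + \<sigma>) [^] s" "\<rho> g' = X (i - \<sigma>) [^] t"
    using f u \<rho>(1) by (simp_all add: hom_mult)
  have "X (i + \<sigma>) [^] s \<otimes> X (i - \<sigma>) [^] t = X (i - \<sigma>) [^] t \<otimes> X (i + \<sigma>) [^] s"
    using arg_cong[OF comm, of \<rho>] \<rho>(1) im star_closed[OF g] star_closed[OF g'] by (simp add: hom_mult)
  then have "X (i - \<sigma>) [^] t \<in> star (i + \<sigma>)"
    using centralizer_subset_star[of "i + \<sigma> + 1" "i + \<sigma>" s "X (i - \<sigma>) [^] t" 0] st by simp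
  then show False using E_star_other[OF \<sigma>] st E_int_pow[of "X (i - \<sigma>)" "i - \<sigma>" t] E_X by force
qed

end

section \<open>Cycle groups acting on hyperplane systems\<close>

locale cycle_hyperplanes = cycle_raag G n X E + hyperplane_system G Hs act N lt DL DR
  for G (structure) and n X E and Hs :: "'h set" and act N lt DL DR
begin

text \<open>\<open>D1\<close> and \<open>D2\<close> are the two factors of the stabiliser of
  \<open>K\<close>, in either order. An element of \<open>D2\<close> in a star around
  \<open>i\<close> with exponent zero commutes with \<open>l\<close> or \<open>l'\<close>, so
  \<open>commute_with_star\<close> makes it a power of \<open>X i\<close>, and only the trivial
  power fixes \<open>K\<close>. Applied to \<open>r\<close> and \<open>r'\<close>, this turns
  \<open>l\<close> and \<open>l'\<close> into the two given products; every element of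
  \<open>D2\<close> centralises both, so it lies in both stars and has exponent zero.\<close>

lemma other_side_trivial:
  assumes \<sigma>: "\<sigma> = 1 \<or> \<sigma> = -1" and K: "K \<in> Hs" and nz: "total (X i) (orb (X i) K) \<noteq> 0"
    and D: "\<And>d. d \<in> D1 \<Longrightarrow> d \<in> carrier G" "\<And>d. d \<in> D2 \<Longrightarrow> d \<in> carrier G \<and> act d K = K"
    and com: "\<And>d d'. d \<in> D1 \<Longrightarrow> d' \<in> D2 \<Longrightarrow> d \<otimes> d' = d' \<otimes> d"
    and l: "l \<in> D1" "l' \<in> D1" and r: "r \<in> D2" "r' \<in> D2"
    and h: "l \<otimes> r = X (i + \<sigma>) [^] (k::int) \<otimes> X i [^] (m::int)" "k \<noteq> 0"
      "l' \<otimes> r' = X (i - \<sigma>) [^] (k'::int) \<otimes> X i [^] (m'::int)" "k' \<noteq> 0"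
    and st: "l \<in> star (i + \<sigma>)" "r \<in> star (i + \<sigma>)" "l' \<in> star (i - \<sigma>)" "r' \<in> star (i - \<sigma>)"
    and E: "E (i + \<sigma>) r = 0" "E (i - \<sigma>) r' = 0" "E (i + \<sigma>) l \<noteq> 0" "E (i - \<sigma>) l' \<noteq> 0"
  shows "D2 \<subseteq> {\<one>}"
proof -
  have \<sigma>': "- \<sigma> = 1 \<or> - \<sigma> = -1" using \<sigma> by auto
  have key: "d = \<one>" if d: "d \<in> D2" and "\<tau> = \<sigma> \<or> \<tau> = - \<sigma>" and s: "d \<in> star (i + \<tau>)" "E (i + \<tau>) d = 0"
    and g: "g \<in> D1" "g \<in> star (i - \<tau>)" "E (i - \<tau>) g \<noteq> 0" for d \<tau> g
  proof -
    have \<tau>: "\<tau> = 1 \<or> \<tau> = -1" using that(2) \<sigma> by auto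
    obtain s :: int and f where f: "f \<in> generate G {X i, X (i + 2 * \<tau>)}" "f \<in> carrier G"
      "d = X (i + \<tau>) [^] s \<otimes> f" using starE[OF \<tau> s(1)] .
    have "s = 0" using E_star(1)[OF \<tau> f(1)] f s by simp
    then have "d = f" using f by simp
    then obtain e :: int where e: "d = X i [^] e"
      using commute_with_star[OF \<tau> _ g(2,3), of d] f com[OF g(1) d] by auto
    then have "e = 0" using power_not_fix[OF K X_closed nz] D(2)[OF d] by simp
    then show ?thesis using e by simp
  qed
  have r1: "r = \<one>" using key[OF r(1), of \<sigma> l'] st E l by simp
  have r1': "r' = \<one>" using key[OF r(2), of "- \<sigma>" l] st E l by simp
  have leq: "l = X (i + \<sigma>) [^] k \<otimes> X i [^] m" "l' = X (i - \<sigma>) [^] k' \<otimes> X i [^] m'"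
    using h r1 r1' D(1) l by simp_all
  show ?thesis
  proof
    fix d assume d: "d \<in> D2"
    then have dc: "d \<in> carrier G" using D by blast
    have "d \<in> star (i + \<sigma>)"
      using centralizer_subset_star[of i "i + \<sigma>" k d m] h(2) \<sigma> dc com[OF l(1) d] leq by auto
    moreover have "d \<in> star (i - \<sigma>)"
      using centralizer_subset_star[of i "i - \<sigma>" k' d m'] h(4) \<sigma> dc com[OF l(2) d] leq by auto
    ultimately have "d = \<one>" using key[OF d, of \<sigma> l'] E_star_other[OF \<sigma>', of d i] l st E by simp
    then show "d \<in> {\<one>}" by simp
  qed
qed

text \<open>Factor the fixing elements obtained from \<open>i + \<sigma>\<close> and from
  \<open>i - \<sigma>\<close>. Factors from opposite sides commute, so by
  \<open>star_commute_exponent\<close> the nonzero exponents sit on one common side, and the other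
  side is trivial. The \<open>if\<close> selects the nontrivial side.\<close>

lemma stabiliser_one_sided:
  assumes \<sigma>: "\<sigma> = 1 \<or> \<sigma> = -1" and K: "K \<in> Hs" and nz: "total (X i) (orb (X i) K) \<noteq> 0"
    and k: "k > 0" and fixed: "act (X (i + \<sigma>) [^] (k::int) \<otimes> X i [^] (- m :: int)) K = K"
  shows "X (i + \<sigma>) [^] k \<otimes> X i [^] (- m) \<in> (if DL K \<subseteq> {\<one>} then DR K else DL K)"
proof -
  let ?h = "X (i + \<sigma>) [^] k \<otimes> X i [^] (- m)"
  have \<sigma>': "- \<sigma> = 1 \<or> - \<sigma> = -1" using \<sigma> by auto
  have "X (i - \<sigma>) \<otimes> X i = X i \<otimes> X (i - \<sigma>)" using X_commute_adj[of i "i - \<sigma>"] \<sigma> by auto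
  then obtain k' m' :: int where k': "k' > 0" "act (X (i - \<sigma>) [^] k' \<otimes> X i [^] (- m')) K = K"
    using power_fixes[OF X_closed X_closed _ K nz] by metis
  let ?h' = "X (i - \<sigma>) [^] k' \<otimes> X i [^] (- m')"
  obtain l r where lr: "l \<in> DL K" "r \<in> DR K" "?h = l \<otimes> r"
    using stab_factor[OF K _ fixed] by auto
  obtain l' r' where lr': "l' \<in> DL K" "r' \<in> DR K" "?h' = l' \<otimes> r'"
    using stab_factor[OF K _ k'(2)] by auto
  have c: "l \<in> carrier G" "r \<in> carrier G" "l' \<in> carrier G" "r' \<in> carrier G"
    using lr lr' DL_stab[OF K] DR_stab[OF K] by auto
  note com = DL_DR_commute[OF K]
  have star_factor: "u \<in> star (i + \<tau>) \<and> v \<in> star (i + \<tau>)"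
    if "\<tau> = 1 \<or> \<tau> = -1" "u \<otimes> v = X (i + \<tau>) [^] (p::int) \<otimes> X i [^] (q::int)" "p \<noteq> 0"
      "u \<in> carrier G" "v \<in> carrier G" "u \<otimes> v = v \<otimes> u" for u v \<tau> p q
  proof -
    have "u \<otimes> (u \<otimes> v) = (u \<otimes> v) \<otimes> u" "v \<otimes> (u \<otimes> v) = (u \<otimes> v) \<otimes> v"
      using that(4-6) by (simp_all add: m_assoc) (simp add: that(6) flip: m_assoc)
    then show ?thesis
      using that(1-5) centralizer_subset_star[of i "i + \<tau>" p u q] centralizer_subset_star[of i "i + \<tau>" p v q]
      by auto
  qed
  have st: "l \<in> star (i + \<sigma>)" "r \<in> star (i + \<sigma>)"
    using star_factor[OF \<sigma>, of l r k "- m"] lr k c com by auto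
  have st': "l' \<in> star (i - \<sigma>)" "r' \<in> star (i - \<sigma>)"
    using star_factor[OF \<sigma>', of l' r' k' "- m'"] lr' k' c com by auto
  have "E (i + \<sigma>) ?h = k" "E (i - \<sigma>) ?h' = k'"
    using \<sigma> not_dvd[of 1] not_dvd[of "-1"] by (auto simp: E_mult E_int_pow E_X)
  then have sums: "E (i + \<sigma>) l + E (i + \<sigma>) r = k" "E (i - \<sigma>) l' + E (i - \<sigma>) r' = k'"
    using lr lr' c by (simp_all add: E_mult)
  have z: "E (i + \<sigma>) r = 0 \<or> E (i - \<sigma>) l' = 0" "E (i + \<sigma>) l = 0 \<or> E (i - \<sigma>) r' = 0"
    using star_commute_exponent[OF \<sigma> st(2) st'(1)] star_commute_exponent[OF \<sigma> st(1) st'(2)]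
      com lr lr' by metis+
  have Eone: "E (i + \<sigma>) \<one> = 0" by (rule E_one)
  show ?thesis
  proof (cases "E (i + \<sigma>) r = 0")
    case True
    then have "E (i + \<sigma>) l \<noteq> 0" "E (i - \<sigma>) r' = 0" "E (i - \<sigma>) l' \<noteq> 0" using sums z k k' by auto
    then have "DR K \<subseteq> {\<one>}"
      using other_side_trivial[OF \<sigma> K nz, of "DL K" "DR K" l l' r r' k "- m" k' "- m'"]
        True DL_stab[OF K] DR_stab[OF K] com lr lr' k k' st st' by auto
    then have "?h = l" using lr c by auto
    moreover have "l \<noteq> \<one>" using \<open>E (i + \<sigma>) l \<noteq> 0\<close> Eone by auto
    ultimately show ?thesis using lr by auto
  next
    case False
    then have "E (i - \<sigma>) l' = 0" "E (i - \<sigma>) r' \<noteq> 0" "E (i + \<sigma>) l = 0" using sums z k k' by auto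
    moreover have "r \<otimes> l = X (i + \<sigma>) [^] k \<otimes> X i [^] (- m)" "r' \<otimes> l' = X (i - \<sigma>) [^] k' \<otimes> X i [^] (- m')"
      using lr lr' com by metis+
    ultimately have "DL K \<subseteq> {\<one>}"
      using other_side_trivial[OF \<sigma> K nz, of "DR K" "DL K" r r' l l' k "- m" k' "- m'"]
        False DL_stab[OF K] DR_stab[OF K] com lr lr' k k' st st' by auto
    moreover from this have "?h = r" using lr c by auto
    ultimately show ?thesis using lr by auto
  qed
qed

text \<open>\<open>one_sided\<close> holds vacuously where \<open>X i\<close> does not translate, so
  triviality of \<open>DL\<close> can decide between \<open>T\<close> and \<open>T'\<close> for all
  hyperplanes.\<close>

lemma odd_cycle_contradiction:
  assumes "odd n"
  shows False
proof -
  define T where "T = {K \<in> Hs. \<not> DL K \<subseteq> {\<one>}}"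
  define T' where "T' = {K \<in> Hs. DL K \<subseteq> {\<one>}}"
  \<comment> \<open>The factors are carried along by conjugation, so \<open>T\<close> and
    \<open>T'\<close> are invariant, as \<open>isotropic\<close> requires.\<close>
  have DLeq: "DL (act g K) \<subseteq> {\<one>} \<longleftrightarrow> DL K \<subseteq> {\<one>}" if g: "g \<in> carrier G" and K: "K \<in> Hs" for g K
  proof -
    have one: "DL L \<subseteq> {\<one>}" if "DL (act u L) \<subseteq> {\<one>}" "u \<in> carrier G" "L \<in> Hs" for u L
    proof
      fix l assume l: "l \<in> DL L"
      then have "u \<otimes> l \<otimes> inv u = \<one>" using DL_act[OF that(3,2) l] that(1) by blast
      moreover have "l \<in> carrier G" using DL_stab[OF that(3) l] by simp
      ultimately show "l \<in> {\<one>}"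
        using that(2) by (metis inv_closed inv_inv inv_solve_right l_cancel_one' m_closed singletonI l_one r_one one_closed r_cancel_one)
    qed
    show ?thesis using one[of g K] one[of "inv g" "act g K"] g K act_closed by auto
  qed
  have inv: "act g K \<in> T" if "g \<in> carrier G" "K \<in> T" for g K
    using that DLeq act_closed by (simp add: T_def)
  have inv': "act g K \<in> T'" if "g \<in> carrier G" "K \<in> T'" for g K
    using that DLeq act_closed by (simp add: T'_def)
  have side: "one_sided DL (X i) (X j) K" if "K \<in> T" "j = i + 1 \<or> j = i - 1" for i j K
    using stabiliser_one_sided[of 1 K i] stabiliser_one_sided[of "-1" K i] that
    by (auto simp: one_sided_def T_def)
  have side': "one_sided DR (X i) (X j) K" if "K \<in> T'" "j = i + 1 \<or> j = i - 1" for i j K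
    using stabiliser_one_sided[of 1 K i] stabiliser_one_sided[of "-1" K i] that
    by (auto simp: one_sided_def T'_def)
  have "\<exists>F. \<forall>j. (\<forall>g\<in>carrier G. \<forall>K\<in>Hs. F j (act g K) = F j K) \<and>
      (\<forall>g\<in>carrier G. 2 * E j g = sum' (\<lambda>K. F j K * N g K) Hs)"
    by (intro choice allI additive_repr E_mult)
  then obtain F where F: "\<And>j g K. g \<in> carrier G \<Longrightarrow> K \<in> Hs \<Longrightarrow> F j (act g K) = F j K"
    "\<And>j g. g \<in> carrier G \<Longrightarrow> 2 * E j g = sum' (\<lambda>K. F j K * N g K) Hs" by blast
  \<comment> \<open>Rows belong to the homomorphisms \<open>E j\<close>, columns to the generators
    \<open>X i\<close>.\<close>
  define L where "L j i = sum' (\<lambda>K. F j K * N (X i) K) T" for j i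
  define R where "R j i = sum' (\<lambda>K. F j K * N (X i) K) T'" for j i
  have sum: "L j i + R j i = 2 * of_bool (int n dvd i - j)" for i j
  proof -
    let ?f = "\<lambda>K. F j K * N (X i) K"
    have fin: "finite {K \<in> Hs. ?f K \<noteq> 0}"
      by (rule finite_subset[OF _ N_finite[OF X_closed[of i]]]) auto
    have "sum' ?f Hs = sum ?f {K \<in> Hs. ?f K \<noteq> 0}" by (rule sum'_eq_sum_superset) (use fin in auto)
    also have "{K \<in> Hs. ?f K \<noteq> 0} = {K \<in> T. ?f K \<noteq> 0} \<union> {K \<in> T'. ?f K \<noteq> 0}"
      by (auto simp: T_def T'_def)
    also have "sum ?f \<dots> = sum ?f {K \<in> T. ?f K \<noteq> 0} + sum ?f {K \<in> T'. ?f K \<noteq> 0}"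
      by (rule sum.union_disjoint) (auto intro: finite_subset[OF _ fin] simp: T_def T'_def)
    also have "sum ?f {K \<in> T. ?f K \<noteq> 0} = L j i"
      unfolding L_def by (rule sum'_eq_sum_superset[symmetric]) (auto intro: finite_subset[OF _ fin] simp: T_def)
    also have "sum ?f {K \<in> T'. ?f K \<noteq> 0} = R j i"
      unfolding R_def by (rule sum'_eq_sum_superset[symmetric]) (auto intro: finite_subset[OF _ fin] simp: T'_def)
    finally show ?thesis using F(2)[OF X_closed, of j i] E_X by simp
  qed
  have parL: "L j i * L j' (i + 1) = L j (i + 1) * L j' i" for i j j'
    unfolding L_def
    by (rule isotropic_left) (use inv side[of _ "i + 1" i] side[of _ i "i + 1"] F X_commute in \<open>auto simp: T_def\<close>)
  have parR: "R j i * R j' (i + 1) = R j (i + 1) * R j' i" for i j j'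
    unfolding R_def
    by (rule isotropic_right) (use inv' side'[of _ "i + 1" i] side'[of _ i "i + 1"] F X_commute in \<open>auto simp: T'_def\<close>)
  have "X (i + int n) = X i" for i by (rule X_periodic) simp
  then have "L j (i + int n) = L j i" "R j (i + int n) = R j i" for i j by (simp_all add: L_def R_def)
  then show False using no_parallel_splitting[of n L R] assms n sum parL parR by simp
qed

end

section \<open>Presented groups\<close>

fun word_value :: "('g, 'm) monoid_scheme \<Rightarrow> ('a \<Rightarrow> 'g) \<Rightarrow> 'a group_word \<Rightarrow> 'g" where
  "word_value H y [] = \<one>\<^bsub>H\<^esub>"
| "word_value H y ((x, b) # s) =
     (if b then y x else inv\<^bsub>H\<^esub> (y x)) \<otimes>\<^bsub>H\<^esub> word_value H y s"

definition inverse_word :: "'a group_word \<Rightarrow> 'a group_word" where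
  "inverse_word s = map (\<lambda>(x, b). (x, \<not> b)) (rev s)"

definition word_class :: "'a set \<Rightarrow> 'a group_word set \<Rightarrow> 'a group_word \<Rightarrow> 'a group_word set" where
  "word_class X S s = {t. group_word_eq X S s t}"

lemma group_words_simps [simp]:
  "[] \<in> group_words X" "s @ t \<in> group_words X \<longleftrightarrow> s \<in> group_words X \<and> t \<in> group_words X"
  "(x, b) # s \<in> group_words X \<longleftrightarrow> x \<in> X \<and> s \<in> group_words X"
  "inverse_word s \<in> group_words X \<longleftrightarrow> s \<in> group_words X"
  by (auto simp: group_words_def inverse_word_def lists_eq_set)

lemma group_word_eq_in_words:
  "group_word_eq X S s t \<Longrightarrow> s \<in> group_words X \<and> t \<in> group_words X"
  by (induction rule: group_word_eq.induct) auto

lemma group_word_eq_context: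
  assumes "group_word_eq X S s t" "u \<in> group_words X" "v \<in> group_words X"
  shows "group_word_eq X S (u @ s @ v) (u @ t @ v)"
  using assms
proof (induction rule: group_word_eq.induct)
  case (cancel s t x b)
  then show ?case using group_word_eq.cancel[of "u @ s" X "t @ v" x S b] by simp
next
  case (relator s t r)
  then show ?case using group_word_eq.relator[of "u @ s" X "t @ v" r S] by simp
qed (auto intro: group_word_eq.intros)

lemma group_word_eq_append:
  assumes "group_word_eq X S s s'" "group_word_eq X S t t'"
  shows "group_word_eq X S (s @ t) (s' @ t')"
  using group_word_eq_context[OF assms(1), of "[]" t] group_word_eq_context[OF assms(2), of s' "[]"]
    group_word_eq_in_words[OF assms(1)] group_word_eq_in_words[OF assms(2)]
  by (auto intro: group_word_eq.trans)

lemma group_word_eq_inverse_left: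
  "s \<in> group_words X \<Longrightarrow> group_word_eq X S (inverse_word s @ s) []"
proof (induction s)
  case Nil then show ?case by (simp add: inverse_word_def group_word_eq.refl)
next
  case (Cons l s)
  obtain x b where l: "l = (x, b)" by (cases l)
  have "group_word_eq X S (inverse_word s @ [(x, \<not> b), (x, \<not> \<not> b)] @ s) (inverse_word s @ s)"
    using Cons.prems l by (intro group_word_eq.cancel) auto
  then show ?case using Cons l by (auto simp: inverse_word_def intro: group_word_eq.trans)
qed

lemma word_class_eq_iff:
  assumes "s \<in> group_words X"
  shows "word_class X S s = word_class X S t \<longleftrightarrow> group_word_eq X S s t"
proof
  assume "word_class X S s = word_class X S t"
  then have "s \<in> word_class X S t" using group_word_eq.refl[OF assms] by (auto simp: word_class_def)
  then show "group_word_eq X S s t" by (auto simp: word_class_def intro: group_word_eq.sym)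
next
  assume "group_word_eq X S s t"
  then show "word_class X S s = word_class X S t"
    by (auto simp: word_class_def intro: group_word_eq.sym group_word_eq.trans)
qed

lemma presented_group_carrier: "carrier (presented_group X S) = word_class X S ` group_words X"
  by (auto simp: presented_group_def quotient_def word_class_def)

lemma presented_group_one: "\<one>\<^bsub>presented_group X S\<^esub> = word_class X S []"
  by (simp add: presented_group_def word_class_def)

lemma presented_group_mult:
  assumes "s \<in> group_words X" "t \<in> group_words X"
  shows "word_class X S s \<otimes>\<^bsub>presented_group X S\<^esub> word_class X S t = word_class X S (s @ t)"
proof -
  have "group_word_eq X S (s @ t) r"
    if "group_word_eq X S s s'" "group_word_eq X S t t'" "group_word_eq X S (s' @ t') r" for s' t' r
    using group_word_eq_append[OF that(1,2)] that(3) by (rule group_word_eq.trans)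
  moreover have "\<exists>s'. group_word_eq X S s s' \<and> (\<exists>t'. group_word_eq X S t t' \<and> group_word_eq X S (s' @ t') r)"
    if "group_word_eq X S (s @ t) r" for r
    using that assms by (blast intro: group_word_eq.refl)
  ultimately show ?thesis by (auto simp: presented_group_def word_class_def)
qed

lemma group_presented_group: "group (presented_group X S)"
proof (rule groupI)
  show "\<exists>y\<in>carrier (presented_group X S). y \<otimes>\<^bsub>presented_group X S\<^esub> x = \<one>\<^bsub>presented_group X S\<^esub>"
    if x: "x \<in> carrier (presented_group X S)" for x
  proof -
    obtain s where s: "s \<in> group_words X" "x = word_class X S s"
      using x by (auto simp: presented_group_carrier)
    have "word_class X S (inverse_word s @ s) = word_class X S []"
      using group_word_eq_inverse_left[OF s(1)] s by (simp add: word_class_eq_iff)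
    then show ?thesis using s
      by (intro bexI[of _ "word_class X S (inverse_word s)"])
         (auto simp: presented_group_mult presented_group_one presented_group_carrier)
  qed
qed (auto simp: presented_group_mult presented_group_one presented_group_carrier)

context group
begin

lemma word_value_closed:
  "s \<in> group_words X \<Longrightarrow> (\<And>x. x \<in> X \<Longrightarrow> y x \<in> carrier G) \<Longrightarrow> word_value G y s \<in> carrier G"
  by (induction s) auto

lemma word_value_append:
  assumes "s \<in> group_words X" "t \<in> group_words X" "\<And>x. x \<in> X \<Longrightarrow> y x \<in> carrier G"
  shows "word_value G y (s @ t) = word_value G y s \<otimes> word_value G y t"
  using assms by (induction s) (auto simp: m_assoc word_value_closed)

lemma word_value_eq:
  assumes y: "\<And>x. x \<in> X \<Longrightarrow> y x \<in> carrier G"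
    and rel: "\<And>r. r \<in> S \<Longrightarrow> r \<in> group_words X \<Longrightarrow> word_value G y r = \<one>"
    and eq: "group_word_eq X S s t"
  shows "word_value G y s = word_value G y t"
  using eq
proof (induction rule: group_word_eq.induct)
  case (cancel s t x b)
  have "word_value G y [(x, b), (x, \<not> b)] = \<one>" using y cancel by simp
  then show ?case using cancel y
    by (simp add: word_value_append[where X = X] word_value_closed[where X = X] del: word_value.simps append_Cons append_Nil)
next
  case (relator s t r)
  then show ?case using y rel
    by (simp add: word_value_append[where X = X] word_value_closed[where X = X])
qed auto

text \<open>Von Dyck's theorem: a class is evaluated on a chosen word, and
  \<open>word_value_eq\<close> makes the value independent of the choice.\<close>

lemma presented_group_hom:
  assumes y: "\<And>x. x \<in> X \<Longrightarrow> y x \<in> carrier G"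
    and rel: "\<And>r. r \<in> S \<Longrightarrow> r \<in> group_words X \<Longrightarrow> word_value G y r = \<one>"
  shows "\<exists>\<theta>\<in>hom (presented_group X S) G. \<forall>s\<in>group_words X. \<theta> (word_class X S s) = word_value G y s"
proof -
  define \<theta> where "\<theta> A = word_value G y (SOME s. s \<in> A)" for A
  have \<theta>: "\<theta> (word_class X S s) = word_value G y s" if s: "s \<in> group_words X" for s
  proof -
    have "\<exists>t. t \<in> word_class X S s" using group_word_eq.refl[OF s] by (auto simp: word_class_def)
    then have "group_word_eq X S s (SOME t. t \<in> word_class X S s)"
      using someI_ex[of "\<lambda>t. t \<in> word_class X S s"] by (simp add: word_class_def)
    then show ?thesis unfolding \<theta>_def using word_value_eq[OF y rel] by metis
  qed
  have "\<theta> \<in> hom (presented_group X S) G"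
    using y by (auto simp: hom_def presented_group_carrier presented_group_mult \<theta>
        word_value_append[where X = X] word_value_closed[where X = X])
  then show ?thesis using \<theta> by blast
qed

end

section \<open>Presentations of the cycle groups\<close>

definition cycle_relators :: "nat \<Rightarrow> nat group_word set" where
  "cycle_relators n = {word_commutator i (i + 1) | i. 1 \<le> i \<and> i < n} \<union> {word_commutator n 1}"

text \<open>Indices of generators are read modulo \<open>n\<close>.\<close>

definition cyc :: "nat \<Rightarrow> int \<Rightarrow> nat" where
  "cyc n i = nat ((i - 1) mod int n) + 1"

definition cycle_gen :: "nat \<Rightarrow> int \<Rightarrow> nat group_word set" where
  "cycle_gen n i = word_class {1..n} (cycle_relators n) [(cyc n i, True)]"

lemma cycle_group_eq: "cycle_group n = presented_group {1..n} (cycle_relators n)"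
  by (simp add: cycle_group_def cycle_relators_def)

lemma cyc_range: "n > 0 \<Longrightarrow> cyc n i \<in> {1..n}"
  by (simp add: cyc_def nat_less_iff Suc_le_eq)

lemma cyc_of_nat: "x \<in> {1..n} \<Longrightarrow> cyc n (int x) = x"
  by (auto simp: cyc_def nat_eq_iff of_nat_diff)

lemma cyc_eq_iff: "n > 0 \<Longrightarrow> cyc n i = cyc n j \<longleftrightarrow> int n dvd i - j"
  by (simp add: cyc_def eq_nat_nat_iff mod_eq_dvd_iff)

text \<open>Reading indices modulo \<open>n\<close> turns the closing relator into the case
  \<open>i = n\<close> of the others.\<close>

lemma cycle_relatorE:
  assumes "n > 0" "r \<in> cycle_relators n"
  obtains i where "r = word_commutator (cyc n i) (cyc n (i + 1))"
proof (cases "r = word_commutator n 1")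
  case True
  have "cyc n (int n) = n" using cyc_of_nat[of n n] assms by simp
  moreover have "cyc n (int n + 1) = 1" by (simp add: cyc_def)
  ultimately show ?thesis using True that[of "int n"] by simp
next
  case False
  then obtain i where "r = word_commutator i (i + 1)" "1 \<le> i" "i < n"
    using assms by (auto simp: cycle_relators_def)
  then show ?thesis using that[of "int i"] cyc_of_nat[of i n] cyc_of_nat[of "i + 1" n]
    by (simp add: add.commute)
qed

lemma cycle_relator:
  assumes "n > 0"
  shows "word_commutator (cyc n i) (cyc n (i + 1)) \<in> cycle_relators n"
proof (cases "cyc n i = n")
  case True
  then have "cyc n i = cyc n (int n)" using cyc_of_nat[of n n] assms by simp
  then have "int n dvd i - int n" using assms cyc_eq_iff by blast
  then have "int n dvd (i + 1) - 1" using dvd_add[of "int n" "i - int n" "int n"] by simp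
  then have "cyc n (i + 1) = cyc n 1" using assms cyc_eq_iff by blast
  then show ?thesis using True by (simp add: cycle_relators_def cyc_def)
next
  case False
  then have r: "1 \<le> cyc n i" "cyc n i < n" using cyc_range[OF assms, of i] by auto
  have "cyc n i = cyc n (int (cyc n i))" using cyc_of_nat cyc_range[OF assms] by metis
  then have "int n dvd i - int (cyc n i)" using assms cyc_eq_iff by blast
  then have "int n dvd (i + 1) - int (cyc n i + 1)" by simp
  then have "cyc n (i + 1) = cyc n (int (cyc n i + 1))" using assms cyc_eq_iff by blast
  then have "cyc n (i + 1) = cyc n i + 1" using cyc_of_nat[of "cyc n i + 1" n] r by simp
  then show ?thesis using r by (auto simp: cycle_relators_def)
qed

lemma word_commutator_in_words:
  "word_commutator a b \<in> group_words X \<longleftrightarrow> a \<in> X \<and> b \<in> X"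
  by (auto simp: word_commutator_def)

lemma cycle_gen_in: "n > 0 \<Longrightarrow> [(cyc n i, b)] \<in> group_words {1..n}"
  using cyc_range[of n i] by simp

lemma cycle_gen_closed: "n > 0 \<Longrightarrow> cycle_gen n i \<in> carrier (cycle_group n)"
  using cycle_gen_in by (auto simp: cycle_gen_def cycle_group_eq presented_group_carrier)

lemma (in group) word_value_commutator:
  assumes "y a \<in> carrier G" "y b \<in> carrier G" "y a \<otimes> y b = y b \<otimes> y a"
  shows "word_value G y (word_commutator a b) = \<one>"
proof -
  have "word_value G y (word_commutator a b) = inv (y a) \<otimes> (inv (y b) \<otimes> (y a \<otimes> y b))"
    using assms(1,2) by (simp add: word_commutator_def)
  also have "inv (y b) \<otimes> (y a \<otimes> y b) = y a" unfolding assms(3) using assms(1,2) by (simp flip: m_assoc)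
  finally show ?thesis using assms by simp
qed

lemma (in group) cycle_group_hom:
  assumes n: "n > 0" and f: "\<And>i. f i \<in> carrier G" "\<And>i j. int n dvd i - j \<Longrightarrow> f i = f j"
    "\<And>i. f i \<otimes> f (i + 1) = f (i + 1) \<otimes> f i"
  shows "\<exists>\<theta>\<in>hom (cycle_group n) G. \<forall>i. \<theta> (cycle_gen n i) = f i"
proof -
  define y where "y x = f (int x)" for x
  have y: "y (cyc n i) = f i" for i
  proof -
    have "cyc n (int (cyc n i)) = cyc n i" using cyc_of_nat cyc_range[OF n] by metis
    then show ?thesis unfolding y_def using f(2) cyc_eq_iff[OF n] by metis
  qed
  have "word_value G y r = \<one>" if rel: "r \<in> cycle_relators n" for r
  proof -
    obtain i where r: "r = word_commutator (cyc n i) (cyc n (i + 1))"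
      by (rule cycle_relatorE[OF n rel])
    show ?thesis unfolding r by (rule word_value_commutator) (use f y in auto)
  qed
  then obtain \<theta> where \<theta>: "\<theta> \<in> hom (cycle_group n) G"
    "\<And>s. s \<in> group_words {1..n} \<Longrightarrow> \<theta> (word_class {1..n} (cycle_relators n) s) = word_value G y s"
    using presented_group_hom[of "{1..n}" y "cycle_relators n"] f unfolding y_def cycle_group_eq by blast
  have "\<theta> (cycle_gen n i) = f i" for i
    using \<theta>(2)[OF cycle_gen_in[OF n]] f by (simp add: cycle_gen_def y)
  then show ?thesis using \<theta>(1) by blast
qed

lemma cycle_gen_commute:
  assumes n: "n > 0"
  shows "cycle_gen n i \<otimes>\<^bsub>cycle_group n\<^esub> cycle_gen n (i + 1) = cycle_gen n (i + 1) \<otimes>\<^bsub>cycle_group n\<^esub> cycle_gen n i"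
proof -
  let ?a = "cyc n i" and ?b = "cyc n (i + 1)" and ?X = "{1..n}" and ?S = "cycle_relators n"
  let ?eq = "group_word_eq ?X ?S"
  have ab: "?a \<in> ?X" "?b \<in> ?X" using cyc_range[OF n] by auto
  \<comment> \<open>The word \<open>b a [a, b]\<close> becomes \<open>b a\<close> by the relator and
    \<open>a b\<close> by two cancellations.\<close>
  have "?eq ([(?b, True), (?a, True)] @ word_commutator ?a ?b @ []) ([(?b, True), (?a, True)] @ [])"
    by (rule group_word_eq.relator) (use ab cycle_relator[OF n] in \<open>auto simp: word_commutator_in_words\<close>)
  moreover have "?eq ([(?b, True)] @ [(?a, True), (?a, \<not> True)] @ [(?b, False), (?a, True), (?b, True)])
      ([(?b, True)] @ [(?b, False), (?a, True), (?b, True)])"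
    by (rule group_word_eq.cancel) (use ab in auto)
  moreover have "?eq ([] @ [(?b, True), (?b, \<not> True)] @ [(?a, True), (?b, True)])
      ([] @ [(?a, True), (?b, True)])"
    by (rule group_word_eq.cancel) (use ab in auto)
  ultimately have "?eq [(?a, True), (?b, True)] [(?b, True), (?a, True)]"
    by (simp add: word_commutator_def) (meson group_word_eq.sym group_word_eq.trans)
  then have "word_class ?X ?S ([(?a, True)] @ [(?b, True)]) = word_class ?X ?S ([(?b, True)] @ [(?a, True)])"
    using word_class_eq_iff[of "[(?a, True), (?b, True)]" ?X ?S "[(?b, True), (?a, True)]"] ab by simp
  then show ?thesis using presented_group_mult[OF cycle_gen_in[OF n] cycle_gen_in[OF n]]
    by (simp add: cycle_gen_def cycle_group_eq)
qed

section \<open>Fox derivatives with values in coset modules\<close>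

context
  fixes X :: "'a set" and S :: "'a group_word set" and a :: 'a and H :: "'a group_word set set"
begin

abbreviation "PG \<equiv> presented_group X S"

interpretation P: group PG by (rule group_presented_group)

text \<open>The Fox derivative with respect to the generator \<open>a\<close>, with values in the
  integral permutation module on the cosets of \<open>H\<close>.\<close>

fun fox :: "'a group_word \<Rightarrow> 'a group_word set set \<Rightarrow> int" where
  "fox [] K = 0"
| "fox ((x, b) # s) K =
     (if x \<noteq> a then 0 else if b then of_bool (K = H)
      else - of_bool (K = word_class X S [(x, False)] <#\<^bsub>PG\<^esub> H))
     + fox s (word_class X S [(x, \<not> b)] <#\<^bsub>PG\<^esub> K)"

lemma word_class_closed: "s \<in> group_words X \<Longrightarrow> word_class X S s \<in> carrier PG"
  by (auto simp: presented_group_carrier)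

lemma word_class_inverse:
  assumes "s \<in> group_words X"
  shows "inv\<^bsub>PG\<^esub> (word_class X S s) = word_class X S (inverse_word s)"
proof (rule P.inv_equality)
  have "word_class X S (inverse_word s @ s) = word_class X S []"
    using group_word_eq_inverse_left[OF assms] assms by (simp add: word_class_eq_iff)
  then show "word_class X S (inverse_word s) \<otimes>\<^bsub>PG\<^esub> word_class X S s = \<one>\<^bsub>PG\<^esub>"
    using assms by (simp add: presented_group_mult presented_group_one)
qed (use assms in \<open>auto simp: word_class_closed\<close>)

lemma word_class_letter_inv:
  assumes "x \<in> X"
  shows "inv\<^bsub>PG\<^esub> (word_class X S [(x, b)]) = word_class X S [(x, \<not> b)]"
  using assms by (simp add: word_class_inverse) (simp add: inverse_word_def)

context
  assumes H: "subgroup H PG"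
begin

abbreviation "cosets \<equiv> (\<lambda>g. g <#\<^bsub>PG\<^esub> H) ` carrier PG"

lemma coset_translate:
  assumes "g \<in> carrier PG" "K \<in> cosets"
  shows "g <#\<^bsub>PG\<^esub> K \<in> cosets"
  using assms subgroup.subset[OF H] by (auto simp: P.lcos_m_assoc)

lemma coset_translate_translate:
  assumes "g \<in> carrier PG" "h \<in> carrier PG" "K \<in> cosets"
  shows "(g \<otimes>\<^bsub>PG\<^esub> h) <#\<^bsub>PG\<^esub> K = g <#\<^bsub>PG\<^esub> (h <#\<^bsub>PG\<^esub> K)"
  using assms subgroup.subset[OF H] by (auto simp: P.lcos_m_assoc P.m_assoc)

lemma coset_translate_one: "K \<in> cosets \<Longrightarrow> \<one>\<^bsub>PG\<^esub> <#\<^bsub>PG\<^esub> K = K"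
  using subgroup.subset[OF H] by (auto simp: P.lcos_m_assoc)

lemma H_coset: "H \<in> cosets"
  using P.lcos_mult_one[OF subgroup.subset[OF H]] by (intro image_eqI[of _ _ "\<one>\<^bsub>PG\<^esub>"]) auto

lemma coset_translate_iff:
  assumes "g \<in> carrier PG" "K \<in> cosets" "L \<in> cosets"
  shows "g <#\<^bsub>PG\<^esub> K = L \<longleftrightarrow> K = inv\<^bsub>PG\<^esub> g <#\<^bsub>PG\<^esub> L"
  using assms coset_translate_translate[of g "inv\<^bsub>PG\<^esub> g" L] coset_translate_translate[of "inv\<^bsub>PG\<^esub> g" g K]
  by (auto simp: coset_translate_one)

context
  assumes a: "a \<in> X"
    and rel: "\<And>r K. r \<in> S \<Longrightarrow> r \<in> group_words X \<Longrightarrow> K \<in> cosets \<Longrightarrow> fox r K = 0"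
begin

text \<open>The product rule for derivations; \<open>inverse_word s\<close> appears because a
  function is translated through its argument.\<close>

lemma fox_append:
  assumes "s \<in> group_words X" "t \<in> group_words X" "K \<in> cosets"
  shows "fox (s @ t) K = fox s K + fox t (word_class X S (inverse_word s) <#\<^bsub>PG\<^esub> K)"
  using assms
proof (induction s arbitrary: K)
  case Nil
  then show ?case using coset_translate_one[of K]
    by (simp add: inverse_word_def flip: presented_group_one)
next
  case (Cons l s)
  obtain x b where l: "l = (x, b)" by (cases l)
  have x: "x \<in> X" "s \<in> group_words X" using Cons.prems l by auto
  let ?K = "word_class X S [(x, \<not> b)] <#\<^bsub>PG\<^esub> K"
  have K: "?K \<in> cosets" by (rule coset_translate) (use Cons.prems x in \<open>auto simp: word_class_closed\<close>)
  have "word_class X S (inverse_word s) <#\<^bsub>PG\<^esub> ?K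
      = (word_class X S (inverse_word s) \<otimes>\<^bsub>PG\<^esub> word_class X S [(x, \<not> b)]) <#\<^bsub>PG\<^esub> K"
    by (rule coset_translate_translate[symmetric]) (use Cons.prems x in \<open>auto simp: word_class_closed\<close>)
  also have "word_class X S (inverse_word s) \<otimes>\<^bsub>PG\<^esub> word_class X S [(x, \<not> b)]
      = word_class X S (inverse_word (l # s))"
    using x by (simp add: presented_group_mult) (simp add: l inverse_word_def)
  finally show ?case using Cons.IH[OF x(2) Cons.prems(2) K] by (simp add: l)
qed

text \<open>A cancelling pair has derivative zero by the convention for inverse letters, a relator
  by \<open>rel\<close>. As both have trivial class, the product rule removes them from the middle
  of a word.\<close>

lemma fox_eq:
  assumes "group_word_eq X S s t" "K \<in> cosets"
  shows "fox s K = fox t K"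
  using assms
proof (induction rule: group_word_eq.induct)
  case (cancel s t x b)
  have c: "word_class X S [(x, b')] \<in> carrier PG" for b' using cancel by (auto simp: word_class_closed)
  have z: "fox [(x, b), (x, \<not> b)] L = 0" if L: "L \<in> cosets" for L
  proof (cases b)
    case True
    have "word_class X S [(x, False)] <#\<^bsub>PG\<^esub> L = word_class X S [(x, False)] <#\<^bsub>PG\<^esub> H \<longleftrightarrow> L = H"
      using coset_translate_iff[OF c L coset_translate[OF c H_coset]]
        coset_translate_iff[OF c H_coset coset_translate[OF c H_coset]] by metis
    then show ?thesis using True by (cases "x = a") simp_all
  next
    case False
    then show ?thesis
      using coset_translate_iff[OF c[of True] L H_coset] cancel word_class_letter_inv[of x True]
      by (cases "x = a") simp_all
  qed
  have K': "word_class X S (inverse_word s) <#\<^bsub>PG\<^esub> K \<in> cosets"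
    by (rule coset_translate) (use cancel in \<open>auto simp: word_class_closed\<close>)
  have "group_word_eq X S (inverse_word [(x, b), (x, \<not> b)]) []"
    using group_word_eq.cancel[of "[]" X "[]" x S b] cancel by (simp add: inverse_word_def)
  then have "word_class X S (inverse_word [(x, b), (x, \<not> b)]) = \<one>\<^bsub>PG\<^esub>"
    using cancel by (subst presented_group_one, subst word_class_eq_iff) auto
  then have "fox ([(x, b), (x, \<not> b)] @ t) (word_class X S (inverse_word s) <#\<^bsub>PG\<^esub> K)
      = fox t (word_class X S (inverse_word s) <#\<^bsub>PG\<^esub> K)"
    using cancel K' z[OF K'] coset_translate_one[OF K']
    by (subst fox_append) (auto simp del: fox.simps append_Cons append_Nil)
  then show ?case using cancel by (subst (1 2) fox_append) (auto simp del: append_Cons append_Nil)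
next
  case (relator s t r)
  have K': "word_class X S (inverse_word s) <#\<^bsub>PG\<^esub> K \<in> cosets"
    by (rule coset_translate) (use relator in \<open>auto simp: word_class_closed\<close>)
  have "group_word_eq X S r []" using group_word_eq.relator[of "[]" X "[]" r S] relator by simp
  then have "word_class X S r = \<one>\<^bsub>PG\<^esub>" using relator by (subst presented_group_one, subst word_class_eq_iff) auto
  then have "word_class X S (inverse_word r) = \<one>\<^bsub>PG\<^esub>" using relator by (simp flip: word_class_inverse)
  then have "fox (r @ t) (word_class X S (inverse_word s) <#\<^bsub>PG\<^esub> K)
      = fox t (word_class X S (inverse_word s) <#\<^bsub>PG\<^esub> K)"
    using relator K' rel[OF _ _ K'] coset_translate_one[OF K'] by (subst fox_append) auto
  then show ?case using relator by (subst (1 2) fox_append) auto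
qed auto

lemma fox_finite: "s \<in> group_words X \<Longrightarrow> finite {K \<in> cosets. fox s K \<noteq> 0}"
proof (induction s)
  case (Cons l s)
  obtain x b where l: "l = (x, b)" by (cases l)
  have x: "x \<in> X" "s \<in> group_words X" using Cons.prems l by auto
  let ?g = "word_class X S [(x, \<not> b)]"
  have g: "?g \<in> carrier PG" using x by (auto simp: word_class_closed)
  have "{K \<in> cosets. fox (l # s) K \<noteq> 0} \<subseteq> {H, word_class X S [(x, False)] <#\<^bsub>PG\<^esub> H}
      \<union> (\<lambda>K. inv\<^bsub>PG\<^esub> ?g <#\<^bsub>PG\<^esub> K) ` {K \<in> cosets. fox s K \<noteq> 0}"
  proof
    fix K assume K: "K \<in> {K \<in> cosets. fox (l # s) K \<noteq> 0}"
    have c: "K \<in> cosets" using K by blast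
    have gK: "?g <#\<^bsub>PG\<^esub> K \<in> cosets" by (rule coset_translate[OF g c])
    have "K = inv\<^bsub>PG\<^esub> ?g <#\<^bsub>PG\<^esub> (?g <#\<^bsub>PG\<^esub> K)" using coset_translate_iff[OF g c gK] by simp
    moreover have "K \<in> {H, word_class X S [(x, False)] <#\<^bsub>PG\<^esub> H} \<or> fox s (?g <#\<^bsub>PG\<^esub> K) \<noteq> 0"
      using K by (auto simp: l split: if_splits)
    ultimately show "K \<in> {H, word_class X S [(x, False)] <#\<^bsub>PG\<^esub> H}
      \<union> (\<lambda>K. inv\<^bsub>PG\<^esub> ?g <#\<^bsub>PG\<^esub> K) ` {K \<in> cosets. fox s K \<noteq> 0}"
      using gK by blast
  qed
  then show ?case using Cons.IH[OF x(2)] finite_subset by blast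
qed simp

lemma fox_cocycle:
  "\<exists>N. cocycle_action PG cosets (\<lambda>g K. g <#\<^bsub>PG\<^esub> K) N \<and>
     (\<forall>x\<in>X. \<forall>K. N (word_class X S [(x, True)]) K = of_bool (x = a \<and> K = H \<and> K \<in> cosets))"
proof -
  define N where "N A K = (if K \<in> cosets then fox (SOME s. s \<in> A) K else 0)" for A K
  have N: "N (word_class X S s) K = fox s K" if s: "s \<in> group_words X" and K: "K \<in> cosets" for s K
  proof -
    have "\<exists>t. t \<in> word_class X S s" using group_word_eq.refl[OF s] by (auto simp: word_class_def)
    then have "group_word_eq X S s (SOME t. t \<in> word_class X S s)"
      using someI_ex[of "\<lambda>t. t \<in> word_class X S s"] by (simp add: word_class_def)
    then show ?thesis unfolding N_def using fox_eq K by auto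
  qed
  have "cocycle_action PG cosets (\<lambda>g K. g <#\<^bsub>PG\<^esub> K) N"
  proof unfold_locales
    fix g h K assume g: "g \<in> carrier PG" "h \<in> carrier PG" and K: "K \<in> cosets"
    obtain s t where st: "s \<in> group_words X" "t \<in> group_words X" "g = word_class X S s" "h = word_class X S t"
      using g by (auto simp: presented_group_carrier)
    have inv: "inv\<^bsub>PG\<^esub> g <#\<^bsub>PG\<^esub> K \<in> cosets" by (rule coset_translate) (use g K in auto)
    have "N (g \<otimes>\<^bsub>PG\<^esub> h) K = fox (s @ t) K"
      using st K by (simp add: presented_group_mult N)
    also have "\<dots> = N g K + N h (inv\<^bsub>PG\<^esub> g <#\<^bsub>PG\<^esub> K)"
      using st K inv by (simp add: fox_append N word_class_inverse)
    finally show "N (g \<otimes>\<^bsub>PG\<^esub> h) K = N g K + N h (inv\<^bsub>PG\<^esub> g <#\<^bsub>PG\<^esub> K)" .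
  next
    fix g assume "g \<in> carrier PG"
    then obtain s where s: "s \<in> group_words X" "g = word_class X S s" by (auto simp: presented_group_carrier)
    then have "{K \<in> cosets. N g K \<noteq> 0} = {K \<in> cosets. fox s K \<noteq> 0}" using N by auto
    then show "finite {K \<in> cosets. N g K \<noteq> 0}" using fox_finite s by simp
  qed (auto simp: coset_translate coset_translate_one coset_translate_translate)
  moreover have "N (word_class X S [(x, True)]) K = of_bool (x = a \<and> K = H \<and> K \<in> cosets)" if "x \<in> X" for x K
    using that N[of "[(x, True)]" K] by (cases "K \<in> cosets") (auto simp: N_def)
  ultimately show ?thesis by blast
qed

end

end

end

text \<open>The Fox derivative descends to the group once all relators have derivative zero. A
  relator containing \<open>X a\<close> pairs it with a neighbour; this neighbour lies in
  \<open>H\<close>, so it fixes the coset \<open>H\<close>, and the two occurrences of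
  \<open>X a\<close> cancel.\<close>

lemma cycle_coset_cocycle:
  assumes n: "n \<ge> 5" and Hdef: "H = generate (cycle_group n) {cycle_gen n (a - 1), cycle_gen n (a + 1)}"
  shows "\<exists>N. cocycle_action (cycle_group n) ((\<lambda>g. g <#\<^bsub>cycle_group n\<^esub> H) ` carrier (cycle_group n))
      (\<lambda>g K. g <#\<^bsub>cycle_group n\<^esub> K) N \<and>
    (\<forall>K. N (cycle_gen n a) K = of_bool (K = H)) \<and>
    (\<forall>j K. \<not> int n dvd j - a \<longrightarrow> N (cycle_gen n j) K = 0)"
proof -
  let ?X = "{1..n}" and ?S = "cycle_relators n"
  let ?P = "presented_group ?X ?S"
  let ?c = "word_class ?X ?S"
  let ?cos = "(\<lambda>g. g <#\<^bsub>?P\<^esub> H) ` carrier ?P"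
  have n0: "n > 0" using n by simp
  interpret P: group ?P by (rule group_presented_group)
  have H: "subgroup H ?P" unfolding Hdef cycle_group_eq
    by (rule P.generate_is_subgroup) (use cycle_gen_closed[OF n0] cycle_group_eq in auto)
  have aX: "cyc n a \<in> ?X" using cyc_range[OF n0] .
  note tr = coset_translate[OF H] and iff = coset_translate_iff[OF H]
  have rel: "fox ?X ?S (cyc n a) H r K = 0"
    if r: "r \<in> ?S" and K: "K \<in> ?cos" for r K
  proof -
    obtain i where ri: "r = word_commutator (cyc n i) (cyc n (i + 1))"
      by (rule cycle_relatorE[OF n0 r])
    let ?u = "cyc n i" and ?v = "cyc n (i + 1)"
    let ?U = "?c [(?u, True)]" and ?U' = "?c [(?u, False)]" and ?V = "?c [(?v, True)]" and ?V' = "?c [(?v, False)]"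
    have uv: "?u \<noteq> ?v" using cyc_eq_iff[OF n0, of i "i + 1"] n by simp
    have in': "?u \<in> ?X" "?v \<in> ?X" using cyc_range[OF n0] by auto
    have c: "?U \<in> carrier ?P" "?U' \<in> carrier ?P" "?V \<in> carrier ?P" "?V' \<in> carrier ?P"
      using in' by (auto simp: word_class_closed)
    have inv: "inv\<^bsub>?P\<^esub> ?U = ?U'" "inv\<^bsub>?P\<^esub> ?V = ?V'" "inv\<^bsub>?P\<^esub> ?U' = ?U"
      using word_class_letter_inv[OF in'(1), of ?S True] word_class_letter_inv[OF in'(2), of ?S True]
        word_class_letter_inv[OF in'(1), of ?S False] by simp_all
    have Hc: "H \<in> ?cos" by (rule H_coset[OF H])
    note cs = K Hc tr[OF c(1)] tr[OF c(2)] tr[OF c(3)] tr[OF c(4)]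
    consider "?u = cyc n a" | "?v = cyc n a" | "?u \<noteq> cyc n a" "?v \<noteq> cyc n a" by blast
    then show ?thesis
    proof cases
      case 1
      then have "cyc n (i + 1) = cyc n (a + 1)" using cyc_eq_iff[OF n0] by simp
      then have "?V \<in> H" unfolding Hdef by (auto simp: cycle_gen_def intro: generate.incl)
      then have VH: "?V' <#\<^bsub>?P\<^esub> H = H"
        using P.coset_join3[OF c(4) H] subgroup.m_inv_closed[OF H] inv(2) by metis
      have "?V <#\<^bsub>?P\<^esub> (?U <#\<^bsub>?P\<^esub> K) = H \<longleftrightarrow> K = ?U' <#\<^bsub>?P\<^esub> H"
        using iff[OF c(3), of "?U <#\<^bsub>?P\<^esub> K" H] iff[OF c(1), of K H] VH inv cs by simp
      then show ?thesis using 1 uv by (simp add: ri word_commutator_def)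
    next
      case 2
      then have "int n dvd i + 1 - a" using cyc_eq_iff[OF n0] by blast
      then have "cyc n i = cyc n (a - 1)" using cyc_eq_iff[OF n0] by (simp add: algebra_simps)
      then have "?U \<in> H" unfolding Hdef by (auto simp: cycle_gen_def intro: generate.incl)
      then have UH: "?U <#\<^bsub>?P\<^esub> H = H" using P.coset_join3[OF c(1) H] by simp
      have "?U' <#\<^bsub>?P\<^esub> (?V <#\<^bsub>?P\<^esub> (?U <#\<^bsub>?P\<^esub> K)) = H \<longleftrightarrow> ?U <#\<^bsub>?P\<^esub> K = ?V' <#\<^bsub>?P\<^esub> H"
        using iff[OF c(2), of "?V <#\<^bsub>?P\<^esub> (?U <#\<^bsub>?P\<^esub> K)" H]
          iff[OF c(3), of "?U <#\<^bsub>?P\<^esub> K" H] UH inv cs by simp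
      then show ?thesis using 2 uv by (simp add: ri word_commutator_def)
    next
      case 3 then show ?thesis by (simp add: ri word_commutator_def)
    qed
  qed
  obtain N where N: "cocycle_action ?P ?cos (\<lambda>g K. g <#\<^bsub>?P\<^esub> K) N"
    "\<And>x K. x \<in> ?X \<Longrightarrow> N (?c [(x, True)]) K = of_bool (x = cyc n a \<and> K = H \<and> K \<in> ?cos)"
    using fox_cocycle[OF H aX rel] by auto
  have "H \<in> ?cos" by (rule H_coset[OF H])
  then have "N (cycle_gen n a) K = of_bool (K = H)" for K
    using N(2)[OF cyc_range[OF n0]] by (auto simp: cycle_gen_def)
  moreover have "N (cycle_gen n j) K = 0" if "\<not> int n dvd j - a" for j K
    using N(2)[OF cyc_range[OF n0]] cyc_eq_iff[OF n0, of j a] that by (auto simp: cycle_gen_def)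
  ultimately show ?thesis using N(1) unfolding cycle_group_eq by blast
qed

lemma cycle_raag_cycle_group:
  assumes n: "n \<ge> 5"
  shows "\<exists>E. cycle_raag (cycle_group n) n (cycle_gen n) E"
proof -
  have n0: "n > 0" using n by simp
  \<comment> \<open>The exponent sums come from the universal property with the integers as
    target.\<close>
  have "\<exists>\<theta>. \<theta> \<in> hom (cycle_group n) integer_group \<and> (\<forall>i. \<theta> (cycle_gen n i) = of_bool (int n dvd i - j))" for j
  proof -
    have "int n dvd i - j \<longleftrightarrow> int n dvd k - j" if "int n dvd i - k" for i k
      using dvd_diff[OF _ that, of "i - j"] dvd_add[OF that, of "k - j"] by auto
    then show ?thesis
      using group.cycle_group_hom[OF group_integer_group n0, of "\<lambda>i. of_bool (int n dvd i - j)"] by auto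
  qed
  then obtain E where E: "\<And>j. E j \<in> hom (cycle_group n) integer_group"
    "\<And>i j. E j (cycle_gen n i) = of_bool (int n dvd i - j)" by metis
  interpret G: group "cycle_group n" unfolding cycle_group_eq by (rule group_presented_group)
  have "cycle_raag (cycle_group n) n (cycle_gen n) E"
  proof unfold_locales
    show "cycle_gen n i = cycle_gen n j" if "int n dvd i - j" for i j
      using that cyc_eq_iff[OF n0, of i j] by (simp add: cycle_gen_def)
    show "E j (g \<otimes>\<^bsub>cycle_group n\<^esub> h) = E j g + E j h"
      if "g \<in> carrier (cycle_group n)" "h \<in> carrier (cycle_group n)" for g h j
      using hom_mult[OF E(1) that] by simp
  qed (use n cycle_gen_closed[OF n0] cycle_gen_commute[OF n0] E G.cycle_group_hom[OF n0]
      cycle_coset_cocycle[OF n] in auto)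
  then show ?thesis by blast
qed

section \<open>Paths in the Squier complex\<close>

fun edge_source :: "'a squier_edge \<Rightarrow> 'a list" where "edge_source (p, u, v, q) = p @ u @ q"
fun edge_target :: "'a squier_edge \<Rightarrow> 'a list" where "edge_target (p, u, v, q) = p @ v @ q"

definition path_inv :: "'a squier_edge list \<Rightarrow> 'a squier_edge list" where
  "path_inv a = map squier_inv (rev a)"

text \<open>\<open>rc a s\<close> is the path \<open>a + s\<close> and \<open>lc t a\<close> the path \<open>t + a\<close>.\<close>

definition rc :: "'a squier_edge list \<Rightarrow> 'a list \<Rightarrow> 'a squier_edge list" where
  "rc a s = map (\<lambda>(p, u, v, q). (p, u, v, q @ s)) a"

definition lc :: "'a list \<Rightarrow> 'a squier_edge list \<Rightarrow> 'a squier_edge list" where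
  "lc t a = map (\<lambda>(p, u, v, q). (t @ p, u, v, q)) a"

lemma path_inv_simps [simp]:
  "path_inv [] = []" "path_inv (a @ b) = path_inv b @ path_inv a"
  "path_inv (e # a) = path_inv a @ [squier_inv e]"
  by (auto simp: path_inv_def)

lemma squier_inv_inv [simp]: "squier_inv (squier_inv e) = e" by (cases e) auto

lemma path_inv_inv [simp]: "path_inv (path_inv a) = a"
  by (auto simp: path_inv_def rev_map o_def)

lemma edge_ends_inv [simp]:
  "edge_source (squier_inv e) = edge_target e" "edge_target (squier_inv e) = edge_source e"
  by (cases e; simp)+

lemma rc_simps [simp]:
  "rc [] s = []" "rc (a @ b) s = rc a s @ rc b s" "rc ((p, u, v, q) # a) s = (p, u, v, q @ s) # rc a s"
  "rc (rc a s) t = rc a (s @ t)" "rc a [] = a"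
  by (auto simp: rc_def intro: map_idI)

lemma lc_simps [simp]:
  "lc t [] = []" "lc t (a @ b) = lc t a @ lc t b" "lc t ((p, u, v, q) # a) = (t @ p, u, v, q) # lc t a"
  "lc s (lc t a) = lc (s @ t) a" "lc [] a = a"
  by (auto simp: lc_def intro: map_idI)

lemma rc_path_inv: "rc (path_inv a) s = path_inv (rc a s)"
  by (auto simp: rc_def path_inv_def rev_map)

lemma lc_path_inv: "lc t (path_inv a) = path_inv (lc t a)"
  by (auto simp: lc_def path_inv_def rev_map)

locale squier =
  fixes P :: "'a semigroup_presentation" and w :: "'a list"
  assumes valid: "valid_presentation P" and w: "w \<in> nonempty_words (alphabet P)"
begin

declare in_lists_conv_set [simp del]

abbreviation "Q \<equiv> squier_complex P"
abbreviation "W \<equiv> lists (alphabet P)"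

definition rule :: "'a list \<Rightarrow> 'a list \<Rightarrow> bool" where
  "rule u v \<longleftrightarrow> (u, v) \<in> relations P \<or> (v, u) \<in> relations P"

lemma rule_sym: "rule u v \<Longrightarrow> rule v u" by (auto simp: rule_def)

lemma rule_words: "rule u v \<Longrightarrow> u \<in> W \<and> v \<in> W \<and> u \<noteq> [] \<and> v \<noteq> []"
  using valid by (auto simp: rule_def valid_presentation_def nonempty_words_def)

lemma squier_simps [simp]:
  "vertices Q = W - {[]}" "source Q e = edge_source e" "target Q e = edge_target e"
  "edge_inv Q = squier_inv" "cells Q = squier_cells P"
  by (cases e; simp add: squier_complex_def nonempty_words_def)+

definition is_edge :: "'a squier_edge \<Rightarrow> bool" where
  "is_edge e \<longleftrightarrow> (case e of (p, u, v, q) \<Rightarrow> p \<in> W \<and> q \<in> W \<and> rule u v)"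

lemma edges_Q [simp]: "e \<in> edges Q \<longleftrightarrow> is_edge e"
  by (cases e) (simp add: squier_complex_def is_edge_def rule_def)

lemma is_edge_simp [simp]: "is_edge (p, u, v, q) \<longleftrightarrow> p \<in> W \<and> q \<in> W \<and> rule u v"
  by (simp add: is_edge_def)

lemma is_edge_inv [simp]: "is_edge (squier_inv e) \<longleftrightarrow> is_edge e"
  by (cases e) (auto intro: rule_sym)

lemma edge_words:
  assumes "is_edge e"
  shows "edge_source e \<in> W" "edge_target e \<in> W" "edge_source e \<noteq> []" "edge_target e \<noteq> []"
  using assms by (cases e; auto dest: rule_words)+

text \<open>Unlike \<open>is_path\<close>, this allows paths at the empty word (necessarily trivial).\<close>

fun wpath :: "'a list \<Rightarrow> 'a squier_edge list \<Rightarrow> 'a list \<Rightarrow> bool" where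
  "wpath x [] y \<longleftrightarrow> x \<in> W \<and> x = y"
| "wpath x (e # a) y \<longleftrightarrow> is_edge e \<and> edge_source e = x \<and> wpath (edge_target e) a y"

lemma wpath_words: "wpath x a y \<Longrightarrow> x \<in> W \<and> y \<in> W"
  by (induction a arbitrary: x) (auto dest: edge_words)

lemma wpath_nonempty: "wpath x a y \<Longrightarrow> x \<noteq> [] \<longleftrightarrow> y \<noteq> []"
  by (induction a arbitrary: x) (auto dest: edge_words)

lemma is_path_wpath: "x \<noteq> [] \<Longrightarrow> is_path Q x a y \<longleftrightarrow> wpath x a y"
  by (induction a arbitrary: x) (auto dest: edge_words)

lemma wpath_append: "wpath x (a @ b) z \<longleftrightarrow> (\<exists>y. wpath x a y \<and> wpath y b z)"
proof (induction a arbitrary: x)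
  case Nil
  then show ?case by (auto dest: wpath_words)
qed auto

lemma wpath_appendI: "wpath x a y \<Longrightarrow> wpath y b z \<Longrightarrow> wpath x (a @ b) z"
  using wpath_append by blast

lemma wpath_det: "wpath x a y \<Longrightarrow> wpath x a z \<Longrightarrow> y = z"
  by (induction a arbitrary: x) auto

lemma wpath_inv: "wpath x a y \<Longrightarrow> wpath y (path_inv a) x"
proof (induction a arbitrary: x)
  case (Cons e a)
  then show ?case
    by (auto simp: edge_words intro!: wpath_appendI[of y "path_inv a" "edge_target e"])
qed auto

lemma wpath_rc: "wpath x a y \<Longrightarrow> s \<in> W \<Longrightarrow> wpath (x @ s) (rc a s) (y @ s)"
proof (induction a arbitrary: x)
  case (Cons e a)
  obtain p u v q where e: "e = (p, u, v, q)" by (cases e)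
  then show ?case using Cons.IH[of "p @ v @ q"] Cons.prems by auto
qed auto

lemma wpath_lc: "wpath x a y \<Longrightarrow> t \<in> W \<Longrightarrow> wpath (t @ x) (lc t a) (t @ y)"
proof (induction a arbitrary: x)
  case (Cons e a)
  obtain p u v q where e: "e = (p, u, v, q)" by (cases e)
  then show ?case using Cons.IH[of "p @ v @ q"] Cons.prems by auto
qed auto

text \<open>The end of a path is determined by its start and so is left implicit;
  \<open>x \<noteq> []\<close> restricts to vertices of \<open>Q\<close>, where \<open>wpath\<close>
  and \<open>is_path\<close> agree.\<close>

definition hmt :: "'a list \<Rightarrow> 'a squier_edge list \<Rightarrow> 'a squier_edge list \<Rightarrow> bool" where
  "hmt x a b \<longleftrightarrow> x \<noteq> [] \<and> (\<exists>y. homotopic Q x y a b)"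

lemma homotopic_is_path: "homotopic Q x y a b \<Longrightarrow> is_path Q x a y \<and> is_path Q x b y"
  by (induction rule: homotopic.induct) auto

lemma hmt_ends: "hmt x a b \<Longrightarrow> \<exists>y. wpath x a y \<and> wpath x b y"
  using homotopic_is_path is_path_wpath unfolding hmt_def by blast

lemma hmt_wpath:
  assumes "hmt x a b"
  shows "wpath x a y \<longleftrightarrow> wpath x b y"
proof -
  obtain z where z: "wpath x a z" "wpath x b z" using hmt_ends[OF assms] by blast
  then show ?thesis using wpath_det[OF z(1), of y] wpath_det[OF z(2), of y] by blast
qed

lemma hmt_homotopic:
  assumes "hmt x a b" "wpath x a y"
  shows "homotopic Q x y a b"
proof -
  obtain z where z: "homotopic Q x z a b" "x \<noteq> []" using assms by (auto simp: hmt_def)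
  then have "wpath x a z" using homotopic_is_path is_path_wpath by blast
  then show ?thesis using wpath_det[OF assms(2)] z by simp
qed

lemma hmt_refl: "x \<noteq> [] \<Longrightarrow> wpath x a y \<Longrightarrow> hmt x a a"
  unfolding hmt_def using homotopic.refl[of Q x a y] is_path_wpath[of x a y] by blast

lemma hmt_sym: "hmt x a b \<Longrightarrow> hmt x b a"
  unfolding hmt_def using homotopic.sym[of Q x] by blast

lemma hmt_trans [trans]:
  assumes "hmt x a b" "hmt x b c"
  shows "hmt x a c"
proof -
  obtain y where y: "wpath x a y" "wpath x b y" using hmt_ends[OF assms(1)] by blast
  show ?thesis
    using homotopic.trans[OF hmt_homotopic[OF assms(1) y(1)] hmt_homotopic[OF assms(2) y(2)]] assms(1)
    by (auto simp: hmt_def)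
qed

lemma homotopic_context:
  assumes "homotopic Q x y a b" "x \<noteq> []" "wpath z l x" "wpath y r t"
  shows "homotopic Q z t (l @ a @ r) (l @ b @ r)"
  using assms
proof (induction rule: homotopic.induct)
  case (refl a)
  have z: "z \<noteq> []" using refl wpath_nonempty by blast
  show ?case by (rule homotopic.refl) (use refl z wpath_append is_path_wpath in blast)
next
  case (sym a b) then show ?case by (blast intro: homotopic.sym)
next
  case (trans a b c) then show ?case by (blast intro: homotopic.trans)
next
  case (backtrack p e q)
  have z: "z \<noteq> []" using backtrack wpath_nonempty by blast
  have "wpath x (p @ [e, edge_inv Q e] @ q) y" "wpath x (p @ q) y"
    using backtrack is_path_wpath by auto
  then have "wpath z (l @ (p @ [e, edge_inv Q e] @ q) @ r) t" "wpath z (l @ (p @ q) @ r) t"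
    using backtrack.prems wpath_appendI by blast+
  then have "is_path Q z ((l @ p) @ [e, edge_inv Q e] @ (q @ r)) t" "is_path Q z ((l @ p) @ (q @ r)) t"
    using z by (simp_all add: is_path_wpath)
  then have "homotopic Q z t ((l @ p) @ [e, edge_inv Q e] @ (q @ r)) ((l @ p) @ (q @ r))"
    by (rule homotopic.backtrack)
  then show ?case by simp
next
  case (cell c p q)
  have z: "z \<noteq> []" using cell wpath_nonempty by blast
  have "wpath x (p @ c @ q) y" "wpath x (p @ q) y"
    using cell is_path_wpath by auto
  then have "wpath z (l @ (p @ c @ q) @ r) t" "wpath z (l @ (p @ q) @ r) t"
    using cell.prems wpath_appendI by blast+
  then have "is_path Q z ((l @ p) @ c @ (q @ r)) t" "is_path Q z ((l @ p) @ (q @ r)) t"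
    using z by (simp_all add: is_path_wpath)
  then have "homotopic Q z t ((l @ p) @ c @ (q @ r)) ((l @ p) @ (q @ r))"
    by (rule homotopic.cell[OF cell(1)])
  then show ?case by simp
qed

lemma hmt_context:
  assumes "wpath z l x" "hmt x a b" "wpath x a y" "wpath y r t"
  shows "hmt z (l @ a @ r) (l @ b @ r)"
  using homotopic_context[OF hmt_homotopic[OF assms(2,3)] _ assms(1,4)] assms(1,2) wpath_nonempty
  unfolding hmt_def by blast

lemma hmt_append:
  assumes "hmt x a b" "wpath x a y" "hmt y c d"
  shows "hmt x (a @ c) (b @ d)"
proof -
  obtain z where z: "wpath y c z" "wpath y d z" using hmt_ends[OF assms(3)] by blast
  have x: "x \<in> W" using wpath_words assms by blast
  have b: "wpath x b y" using hmt_wpath assms by blast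
  have "hmt x ([] @ a @ c) ([] @ b @ c)" using hmt_context[of x "[]" x a b y c z] x assms z by simp
  also have "hmt x ([] @ b @ c) (b @ c @ [])" using hmt_refl assms(1) wpath_appendI[OF b z(1)] hmt_def by simp
  also have "hmt x (b @ c @ []) (b @ d @ [])"
    using hmt_context[OF b assms(3) z(1), of "[]" z] z wpath_words by simp
  finally show ?thesis by simp
qed

lemma hmt_left: "wpath z l x \<Longrightarrow> hmt x a b \<Longrightarrow> hmt z (l @ a) (l @ b)"
  using hmt_append[OF hmt_refl] wpath_nonempty hmt_def by meson

lemma hmt_right: "hmt x a b \<Longrightarrow> wpath x a y \<Longrightarrow> wpath y r t \<Longrightarrow> hmt x (a @ r) (b @ r)"
  using hmt_append hmt_refl wpath_nonempty hmt_def by meson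

lemma hmt_inv_right: "x \<noteq> [] \<Longrightarrow> wpath x a y \<Longrightarrow> hmt x (a @ path_inv a) []"
proof (induction a arbitrary: x)
  case Nil then show ?case by (auto intro: hmt_refl)
next
  case (Cons e a)
  then have e: "is_edge e" "edge_source e = x" "wpath (edge_target e) a y" by auto
  have 1: "wpath x [e] (edge_target e)" "wpath (edge_target e) [squier_inv e] x"
    using e edge_words(1,2)[OF e(1)] by simp_all
  have "hmt x ([e] @ (a @ path_inv a) @ [squier_inv e]) ([e] @ [] @ [squier_inv e])"
    by (rule hmt_context[OF 1(1) Cons.IH[OF _ e(3)] wpath_appendI[OF e(3) wpath_inv[OF e(3)]] 1(2)])
       (use e edge_words(4) in simp)
  also have "hmt x ([e] @ [] @ [squier_inv e]) []"
    using homotopic.backtrack[of Q x "[]" e "[]" x] e Cons.prems 1 edge_words[of e]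
    by (auto simp: hmt_def)
  finally show ?case by simp
qed

lemma hmt_inv_left: "x \<noteq> [] \<Longrightarrow> wpath x a y \<Longrightarrow> hmt y (path_inv a @ a) []"
  using hmt_inv_right[of y "path_inv a" x] wpath_inv wpath_nonempty by auto

lemma hmt_move:
  assumes "hmt x (a @ path_inv b) []" "wpath x a y" "wpath x b y"
  shows "hmt x a b"
proof -
  have x: "x \<noteq> []" using assms hmt_def by auto
  then have y: "y \<noteq> []" using assms wpath_nonempty by blast
  have "hmt x (a @ []) (a @ (path_inv b @ b))"
    by (rule hmt_left[OF assms(2) hmt_sym[OF hmt_inv_left[OF x assms(3)]]])
  also have "a @ (path_inv b @ b) = (a @ path_inv b) @ b" by simp
  also have "hmt x \<dots> ([] @ b)"
    by (rule hmt_right[OF assms(1) _ assms(3)]) (use assms wpath_appendI wpath_inv in blast)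
  finally show ?thesis by simp
qed

text \<open>A commuting square is read from the corner reached by \<open>a\<close>, which reverses
  one of its two directions.\<close>

lemma hmt_flip:
  assumes a: "wpath x a y" and b: "wpath y b t" and c: "wpath x c s" and d: "wpath s d t"
    and h: "hmt x (a @ b) (c @ d)"
  shows "hmt y (path_inv a @ c) (b @ path_inv d)"
proof -
  have x: "x \<noteq> []" using h hmt_def by auto
  have s: "s \<noteq> []" using wpath_nonempty[OF c] x by simp
  note inv = wpath_inv[OF a] wpath_inv[OF d]
  have "hmt y (path_inv a @ c @ []) (path_inv a @ c @ (d @ path_inv d))"
    by (intro hmt_left[OF inv(1)] hmt_left[OF c] hmt_sym[OF hmt_inv_right[OF s d]])
  also have "path_inv a @ c @ (d @ path_inv d) = path_inv a @ (c @ d) @ path_inv d" by simp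
  also have "hmt y (path_inv a @ (c @ d) @ path_inv d) (path_inv a @ (a @ b) @ path_inv d)"
    by (rule hmt_context[OF inv(1) hmt_sym[OF h] _ inv(2)]) (use c d wpath_appendI in blast)
  also have "path_inv a @ (a @ b) @ path_inv d = (path_inv a @ a) @ (b @ path_inv d)" by simp
  also have "hmt y \<dots> ([] @ (b @ path_inv d))"
    by (rule hmt_right[OF hmt_inv_left[OF x a]]) (use a b inv wpath_appendI in blast)+
  finally show ?thesis by simp
qed

text \<open>The attached cells treat only rules used in the direction of \<open>relations P\<close>;
  squares with one or both directions reversed follow from these by \<open>hmt_flip\<close>.\<close>

lemma edge_exchange:
  assumes u: "rule u v" "rule u' v'" and pzq: "p \<in> W" "z \<in> W" "q \<in> W"
  shows "hmt (p @ u @ z @ u' @ q) [(p, u, v, z @ u' @ q), (p @ v @ z, u', v', q)]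
    [(p @ u @ z, u', v', q), (p, u, v, z @ v' @ q)]"
proof -
  have pos: "hmt (p @ l @ z @ l' @ q) [(p, l, r, z @ l' @ q), (p @ r @ z, l', r', q)]
      [(p @ l @ z, l', r', q), (p, l, r, z @ r' @ q)]"
    if lr: "(l, r) \<in> relations P" "(l', r') \<in> relations P" for l r l' r'
  proof (rule hmt_move)
    let ?x = "p @ l @ z @ l' @ q"
    have R: "rule l r" "rule l' r'" using lr by (auto simp: rule_def)
    note RW = rule_words[OF R(1)] rule_words[OF R(2)]
    let ?a = "[(p, l, r, z @ l' @ q), (p @ r @ z, l', r', q)]"
      and ?b = "[(p @ l @ z, l', r', q), (p, l, r, z @ r' @ q)]"
    show a: "wpath ?x ?a (p @ r @ z @ r' @ q)" and b: "wpath ?x ?b (p @ r @ z @ r' @ q)"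
      using R RW pzq by auto
    have "?a @ path_inv ?b \<in> squier_cells P"
      unfolding squier_cells_def path_inv_def using lr pzq by blast
    moreover have "wpath ?x (?a @ path_inv ?b) ?x" using wpath_appendI[OF a wpath_inv[OF b]] .
    moreover have "?x \<noteq> []" using RW by simp
    moreover have "?x \<in> W" using RW pzq by simp
    ultimately show "hmt ?x (?a @ path_inv ?b) []"
      using homotopic.cell[of "?a @ path_inv ?b" Q ?x "[]" "[]" ?x]
      unfolding hmt_def squier_simps append_Nil append_Nil2
      by (metis is_path_wpath wpath.simps(1))
  qed
  note RW = rule_words[OF u(1)] rule_words[OF u(2)]
  have flip1: "hmt (p @ r @ z @ l' @ q) [(p, r, l, z @ l' @ q), (p @ l @ z, l', r', q)]
      [(p @ r @ z, l', r', q), (p, r, l, z @ r' @ q)]"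
    if R: "rule l r" "rule l' r'"
      and h: "hmt (p @ l @ z @ l' @ q) [(p, l, r, z @ l' @ q), (p @ r @ z, l', r', q)]
        [(p @ l @ z, l', r', q), (p, l, r, z @ r' @ q)]" for l r l' r'
    using hmt_flip[of "p @ l @ z @ l' @ q" "[(p, l, r, z @ l' @ q)]" "p @ r @ z @ l' @ q"
        "[(p @ r @ z, l', r', q)]" "p @ r @ z @ r' @ q" "[(p @ l @ z, l', r', q)]" "p @ l @ z @ r' @ q"
        "[(p, l, r, z @ r' @ q)]"] h R rule_words[OF R(1)] rule_words[OF R(2)] pzq
    by auto
  have flip2: "hmt (p @ l @ z @ r' @ q) [(p, l, r, z @ r' @ q), (p @ r @ z, r', l', q)]
      [(p @ l @ z, r', l', q), (p, l, r, z @ l' @ q)]"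
    if R: "rule l r" "rule l' r'"
      and h: "hmt (p @ l @ z @ l' @ q) [(p, l, r, z @ l' @ q), (p @ r @ z, l', r', q)]
        [(p @ l @ z, l', r', q), (p, l, r, z @ r' @ q)]" for l r l' r'
    using hmt_sym[OF hmt_flip[of "p @ l @ z @ l' @ q" "[(p @ l @ z, l', r', q)]" "p @ l @ z @ r' @ q"
        "[(p, l, r, z @ r' @ q)]" "p @ r @ z @ r' @ q" "[(p, l, r, z @ l' @ q)]" "p @ r @ z @ l' @ q"
        "[(p @ r @ z, l', r', q)]"]] hmt_sym[OF h] R rule_words[OF R(1)] rule_words[OF R(2)] pzq
    by auto
  consider "(u, v) \<in> relations P" "(u', v') \<in> relations P" | "(v, u) \<in> relations P" "(u', v') \<in> relations P"
    | "(u, v) \<in> relations P" "(v', u') \<in> relations P" | "(v, u) \<in> relations P" "(v', u') \<in> relations P"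
    using u by (auto simp: rule_def)
  then show ?thesis
  proof cases
    case 1 then show ?thesis by (rule pos)
  next
    case 2 then show ?thesis using flip1[OF rule_sym[OF u(1)] u(2)] pos by blast
  next
    case 3 then show ?thesis using flip2[OF u(1) rule_sym[OF u(2)]] pos by blast
  next
    case 4
    then show ?thesis
      using flip2[OF u(1) rule_sym[OF u(2)] flip1[OF rule_sym[OF u(1)] rule_sym[OF u(2)] pos]] by blast
  qed
qed

lemma edge_path_exchange:
  assumes e: "is_edge (p, u, v, q)" and b: "wpath y b y'"
  shows "hmt (p @ u @ q @ y) ((p, u, v, q @ y) # lc (p @ v @ q) b) (lc (p @ u @ q) b @ [(p, u, v, q @ y')])"
  using b
proof (induction b arbitrary: y)
  case Nil
  then show ?case using e rule_words[of u v] by (auto intro!: hmt_refl)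
next
  case (Cons f b)
  obtain p' s t q' where f: "f = (p', s, t, q')" by (cases f)
  have pq: "p \<in> W" "q \<in> W" "rule u v" using e by auto
  have f': "p' \<in> W" "q' \<in> W" "rule s t" "y = p' @ s @ q'" and b: "wpath (p' @ t @ q') b y'"
    using Cons.prems f by auto
  note ws = rule_words[OF pq(3)] rule_words[OF f'(3)]
  have "hmt (p @ u @ (q @ p') @ s @ q') ([(p, u, v, (q @ p') @ s @ q'), (p @ v @ (q @ p'), s, t, q')] @ lc (p @ v @ q) b)
      ([(p @ u @ (q @ p'), s, t, q'), (p, u, v, (q @ p') @ t @ q')] @ lc (p @ v @ q) b)"
    by (rule hmt_right[OF edge_exchange]) (use pq f' ws wpath_lc[OF b, of "p @ v @ q"] in auto)
  also have "\<dots> = [(p @ u @ q @ p', s, t, q')] @ ((p, u, v, q @ p' @ t @ q') # lc (p @ v @ q) b)" by simp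
  also have "hmt (p @ u @ (q @ p') @ s @ q') \<dots>
      ([(p @ u @ q @ p', s, t, q')] @ (lc (p @ u @ q) b @ [(p, u, v, q @ y')]))"
    by (rule hmt_left[OF _ Cons.IH[OF b]]) (use pq f' ws in auto)
  finally show ?case by (simp add: f f')
qed

text \<open>Paths on adjacent subwords are independent: the rectangle spanned by them is tiled by
  the squares of \<open>edge_exchange\<close>.\<close>

lemma exchange:
  assumes a: "wpath x a x'" and b: "wpath y b y'" and ne: "x @ y \<noteq> []"
  shows "hmt (x @ y) (rc a y @ lc x' b) (lc x b @ rc a y')"
  using a ne
proof (induction a arbitrary: x)
  case Nil
  then show ?case using wpath_lc[OF b] by (auto intro!: hmt_refl)
next
  case (Cons e a)
  obtain p u v q where e: "e = (p, u, v, q)" by (cases e)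
  have ed: "is_edge (p, u, v, q)" and x: "x = p @ u @ q" and a: "wpath (p @ v @ q) a x'"
    using Cons.prems e by auto
  have ws: "u \<in> W" "v \<in> W" "v \<noteq> []" "p \<in> W" "q \<in> W" "rule u v" using ed rule_words by auto
  have yW: "y \<in> W" "y' \<in> W" using wpath_words[OF b] by auto
  have "hmt (x @ y) ([(p, u, v, q @ y)] @ (rc a y @ lc x' b)) ([(p, u, v, q @ y)] @ (lc (p @ v @ q) b @ rc a y'))"
    by (rule hmt_left[OF _ Cons.IH[OF a]]) (use ws yW x in auto)
  also have "\<dots> = ((p, u, v, q @ y) # lc (p @ v @ q) b) @ rc a y'" by simp
  also have "hmt (x @ y) \<dots> ((lc (p @ u @ q) b @ [(p, u, v, q @ y')]) @ rc a y')"
  proof (rule hmt_right)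
    show "hmt (x @ y) ((p, u, v, q @ y) # lc (p @ v @ q) b) (lc (p @ u @ q) b @ [(p, u, v, q @ y')])"
      using edge_path_exchange[OF ed b] by (simp add: x)
    show "wpath (x @ y) ((p, u, v, q @ y) # lc (p @ v @ q) b) ((p @ v @ q) @ y')"
      using wpath_lc[OF b, of "p @ v @ q"] ws yW x by auto
    show "wpath ((p @ v @ q) @ y') (rc a y') (x' @ y')" using wpath_rc[OF a yW(2)] .
  qed
  finally show ?case by (simp add: e x)
qed

end

lemma (in squier) w_word [simp]: "w \<in> W" "w \<noteq> []"
  using w by (auto simp: nonempty_words_def)

section \<open>The fundamental group\<close>

context squier
begin

abbreviation "loop a \<equiv> wpath w a w"

definition loop_class :: "'a squier_edge list \<Rightarrow> 'a squier_edge list set" where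
  "loop_class a = {b. hmt w a b}"

abbreviation "DG \<equiv> diagram_group P w"

lemma loop_hmt: "loop a \<Longrightarrow> homotopic Q w w a b \<longleftrightarrow> hmt w a b"
  using hmt_homotopic by (metis hmt_def w_word(2))

lemma loop_class_eq_iff:
  assumes "loop a"
  shows "loop_class a = loop_class b \<longleftrightarrow> hmt w a b"
proof
  assume "loop_class a = loop_class b"
  then have "a \<in> loop_class b" using hmt_refl[OF _ assms] by (auto simp: loop_class_def)
  then show "hmt w a b" by (auto simp: loop_class_def intro: hmt_sym)
next
  assume "hmt w a b"
  then show "loop_class a = loop_class b"
    by (auto simp: loop_class_def intro: hmt_sym hmt_trans)
qed

lemma carrier_DG: "carrier DG = loop_class ` {a. loop a}"
proof -
  have "{b. homotopic Q w w a b} = loop_class a" if "loop a" for a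
    using loop_hmt[OF that] by (simp add: loop_class_def)
  then show ?thesis
    by (auto simp: diagram_group_def fundamental_group_def quotient_def is_path_wpath)
qed

lemma one_DG: "\<one>\<^bsub>DG\<^esub> = loop_class []"
  by (simp add: diagram_group_def fundamental_group_def loop_class_def loop_hmt)

lemma loop_append: "loop a \<Longrightarrow> loop b \<Longrightarrow> loop (a @ b)"
  by (rule wpath_appendI)

lemma mult_DG:
  assumes "loop a" "loop b"
  shows "loop_class a \<otimes>\<^bsub>DG\<^esub> loop_class b = loop_class (a @ b)"
proof -
  have "homotopic Q w w (a' @ b') r \<longleftrightarrow> hmt w (a @ b) r" if "hmt w a a'" "hmt w b b'" for a' b' r
  proof -
    have "loop a'" "loop b'" using assms hmt_wpath that by blast+
    moreover have "hmt w (a @ b) (a' @ b')" using hmt_append that assms by blast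
    ultimately show ?thesis using loop_hmt loop_append hmt_sym hmt_trans by meson
  qed
  then have key: "homotopic Q w w (a' @ b') r \<longleftrightarrow> r \<in> loop_class (a @ b)"
    if "a' \<in> loop_class a" "b' \<in> loop_class b" for a' b' r
    using that by (simp add: loop_class_def)
  have "loop_class a \<otimes>\<^bsub>DG\<^esub> loop_class b =
      {r. \<exists>a'\<in>loop_class a. \<exists>b'\<in>loop_class b. homotopic Q w w (a' @ b') r}"
    by (simp add: diagram_group_def fundamental_group_def)
  also have "\<dots> = {r. \<exists>a'\<in>loop_class a. \<exists>b'\<in>loop_class b. r \<in> loop_class (a @ b)}"
    using key by blast
  finally have "loop_class a \<otimes>\<^bsub>DG\<^esub> loop_class b =
      {r. \<exists>a'\<in>loop_class a. \<exists>b'\<in>loop_class b. r \<in> loop_class (a @ b)}" .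
  moreover have "a \<in> loop_class a" "b \<in> loop_class b"
    using assms hmt_refl by (auto simp: loop_class_def)
  ultimately show ?thesis by blast
qed

lemma loop_class_closed [simp]: "loop a \<Longrightarrow> loop_class a \<in> carrier DG"
  by (auto simp: carrier_DG)

lemma group_DG: "group DG"
proof (rule groupI)
  show "\<exists>y\<in>carrier DG. y \<otimes>\<^bsub>DG\<^esub> x = \<one>\<^bsub>DG\<^esub>" if x: "x \<in> carrier DG" for x
  proof -
    obtain a where a: "loop a" "x = loop_class a" using x by (auto simp: carrier_DG)
    have "loop_class (path_inv a @ a) = loop_class []"
      using hmt_inv_left[OF _ a(1)] loop_append[OF wpath_inv[OF a(1)] a(1)] by (simp add: loop_class_eq_iff)
    then show ?thesis using a wpath_inv[OF a(1)]
      by (intro bexI[of _ "loop_class (path_inv a)"]) (auto simp: mult_DG one_DG)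
  qed
qed (auto simp: carrier_DG mult_DG one_DG loop_append)

sublocale DG: group DG by (rule group_DG)

lemma inv_DG: "loop a \<Longrightarrow> inv\<^bsub>DG\<^esub> (loop_class a) = loop_class (path_inv a)"
proof (rule DG.inv_equality)
  assume a: "loop a"
  then have "loop_class (path_inv a @ a) = loop_class []"
    using hmt_inv_left[OF _ a] loop_append[OF wpath_inv[OF a] a] by (simp add: loop_class_eq_iff)
  then show "loop_class (path_inv a) \<otimes>\<^bsub>DG\<^esub> loop_class a = \<one>\<^bsub>DG\<^esub>"
    using a wpath_inv by (simp add: mult_DG one_DG)
qed (auto dest: wpath_inv)

section \<open>Hyperplanes of the universal cover\<close>

text \<open>The path \<open>\<pi> + u + \<rho>\<close> from \<open>p @ u @ q\<close> to \<open>p' @ u @ q'\<close>, where \<open>p'\<close> is the end of \<open>\<pi>\<close>.\<close>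

definition slide :: "'a list \<Rightarrow> 'a list \<Rightarrow> 'a list \<Rightarrow> 'a squier_edge list \<Rightarrow> 'a squier_edge list \<Rightarrow> 'a squier_edge list" where
  "slide u q p' \<pi> \<rho> = rc \<pi> (u @ q) @ lc (p' @ u) \<rho>"

lemma wpath_slide:
  assumes "u \<in> W" "wpath p \<pi> p'" "wpath q \<rho> q'"
  shows "wpath (p @ u @ q) (slide u q p' \<pi> \<rho>) (p' @ u @ q')"
  unfolding slide_def
  using wpath_rc[OF assms(2), of "u @ q"] wpath_lc[OF assms(3), of "p' @ u"] assms wpath_words
  by (intro wpath_appendI) auto

lemma rc_lc_exchange:
  assumes u: "u \<in> W" "u \<noteq> []" and "wpath p \<pi> p'" "wpath q \<rho> q'"
  shows "hmt (p @ u @ q) (rc \<pi> (u @ q) @ lc (p' @ u) \<rho>) (lc (p @ u) \<rho> @ rc \<pi> (u @ q'))"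
  using exchange[OF wpath_rc[OF assms(3) u(1)] assms(4)] u(2) by simp

text \<open>The nonempty word \<open>u\<close> separates the two motions, so all moves on the left
  can be made before all moves on the right.\<close>

lemma slide_append:
  assumes u: "u \<in> W" "u \<noteq> []" and \<pi>: "wpath p \<pi> p'" "wpath p' \<pi>' p''"
    and \<rho>: "wpath q \<rho> q'" "wpath q' \<rho>' q''"
  shows "hmt (p @ u @ q) (slide u q p' \<pi> \<rho> @ slide u q' p'' \<pi>' \<rho>') (slide u q p'' (\<pi> @ \<pi>') (\<rho> @ \<rho>'))"
proof -
  have ws: "q \<in> W" "q' \<in> W" "p'' \<in> W" "p' \<in> W" using \<pi> \<rho> wpath_words by auto
  have "hmt (p @ u @ q) (rc \<pi> (u @ q) @ (lc (p' @ u) \<rho> @ rc \<pi>' (u @ q')) @ lc (p'' @ u) \<rho>')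
      (rc \<pi> (u @ q) @ (rc \<pi>' (u @ q) @ lc (p'' @ u) \<rho>) @ lc (p'' @ u) \<rho>')"
  proof (rule hmt_context)
    show "wpath (p @ u @ q) (rc \<pi> (u @ q)) (p' @ u @ q)" using wpath_rc[OF \<pi>(1), of "u @ q"] u ws by simp
    show "hmt (p' @ u @ q) (lc (p' @ u) \<rho> @ rc \<pi>' (u @ q')) (rc \<pi>' (u @ q) @ lc (p'' @ u) \<rho>)"
      by (rule hmt_sym[OF rc_lc_exchange[OF u \<pi>(2) \<rho>(1)]])
    show "wpath (p' @ u @ q) (lc (p' @ u) \<rho> @ rc \<pi>' (u @ q')) (p'' @ u @ q')"
      using wpath_rc[OF \<pi>(2), of "u @ q'"] wpath_lc[OF \<rho>(1), of "p' @ u"] u ws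
      by (intro wpath_appendI) auto
    show "wpath (p'' @ u @ q') (lc (p'' @ u) \<rho>') (p'' @ u @ q'')"
      using wpath_lc[OF \<rho>(2), of "p'' @ u"] u ws by simp
  qed
  then show ?thesis by (simp add: slide_def)
qed

lemma slide_inverse:
  assumes u: "u \<in> W" "u \<noteq> []" and \<pi>: "wpath p \<pi> p'" and \<rho>: "wpath q \<rho> q'"
  shows "hmt (p @ u @ q) (slide u q p' \<pi> \<rho> @ slide u q' p (path_inv \<pi>) (path_inv \<rho>)) []"
proof -
  have ws: "q \<in> W" "p \<in> W" using \<pi> \<rho> wpath_words by auto
  note r = wpath_rc[OF \<pi>, of "u @ q"] and l = wpath_lc[OF \<rho>, of "p @ u"]
  have "hmt (p @ u @ q) (slide u q p' \<pi> \<rho> @ slide u q' p (path_inv \<pi>) (path_inv \<rho>))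
      (slide u q p (\<pi> @ path_inv \<pi>) (\<rho> @ path_inv \<rho>))"
    by (rule slide_append[OF u \<pi> wpath_inv[OF \<pi>] \<rho> wpath_inv[OF \<rho>]])
  also have "\<dots> = (rc \<pi> (u @ q) @ path_inv (rc \<pi> (u @ q))) @ (lc (p @ u) \<rho> @ path_inv (lc (p @ u) \<rho>))"
    by (simp add: slide_def rc_path_inv lc_path_inv)
  also have "hmt (p @ u @ q) \<dots> ([] @ [])"
    by (rule hmt_append[OF hmt_inv_right wpath_appendI hmt_inv_right])
       (use r l u ws wpath_inv[OF r] in auto)
  finally show ?thesis by simp
qed

text \<open>A pair \<open>(\<delta>, e)\<close> of a path from \<open>w\<close> and an edge \<open>e\<close> issuing from its end stands for the
  lift of \<open>e\<close> at the vertex \<open>\<delta>\<close> of the universal cover.\<close>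

inductive parallel :: "'a squier_edge list \<times> 'a squier_edge \<Rightarrow> 'a squier_edge list \<times> 'a squier_edge \<Rightarrow> bool" where
  "rule u v \<Longrightarrow> wpath w \<delta> (p @ u @ q) \<Longrightarrow> wpath p \<pi> p' \<Longrightarrow> wpath q \<rho> q' \<Longrightarrow>
    hmt w \<delta>' (\<delta> @ slide u q p' \<pi> \<rho>) \<Longrightarrow> parallel (\<delta>, p, u, v, q) (\<delta>', p', u, v, q')"

definition lifted :: "'a squier_edge list \<times> 'a squier_edge \<Rightarrow> bool" where
  "lifted z \<longleftrightarrow> is_edge (snd z) \<and> wpath w (fst z) (edge_source (snd z))"

lemma lifted_simp [simp]:
  "lifted (\<delta>, p, u, v, q) \<longleftrightarrow> p \<in> W \<and> q \<in> W \<and> rule u v \<and> wpath w \<delta> (p @ u @ q)"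
  by (auto simp: lifted_def)

lemma parallel_lifted:
  assumes "parallel z z'"
  shows "lifted z \<and> lifted z'"
  using assms
proof cases
  case (1 u v \<delta> p q \<pi> p' \<rho> q' \<delta>')
  have "wpath w (\<delta> @ slide u q p' \<pi> \<rho>) (p' @ u @ q')"
    using 1 wpath_slide[of u p \<pi> p' q \<rho> q'] rule_words by (intro wpath_appendI) auto
  then have "wpath w \<delta>' (p' @ u @ q')" using 1 hmt_wpath by blast
  then show ?thesis using 1 wpath_words by auto
qed

lemma slide_nil [simp]: "slide u q p' [] [] = []" by (simp add: slide_def)

lemma parallel_hmt:
  assumes "lifted (\<delta>, e)" "hmt w \<delta> \<delta>'"
  shows "parallel (\<delta>, e) (\<delta>', e)"
proof -
  obtain p u v q where e: "e = (p, u, v, q)" by (cases e)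
  show ?thesis unfolding e
    by (rule parallel.intros[of u v \<delta> p q "[]" p "[]" q]) (use assms e in \<open>auto intro: hmt_sym\<close>)
qed

lemma parallel_refl: "lifted z \<Longrightarrow> parallel z z"
  by (cases z) (auto intro!: parallel_hmt hmt_refl simp: lifted_def)

lemma parallel_sym:
  assumes "parallel z z'"
  shows "parallel z' z"
  using assms
proof cases
  case (1 u v \<delta> p q \<pi> p' \<rho> q' \<delta>')
  have u: "u \<in> W" "u \<noteq> []" using 1 rule_words by auto
  let ?j = "slide u q p' \<pi> \<rho>" and ?k = "slide u q' p (path_inv \<pi>) (path_inv \<rho>)"
  have j: "wpath (p @ u @ q) ?j (p' @ u @ q')" using 1 u wpath_slide by blast
  have k: "wpath (p' @ u @ q') ?k (p @ u @ q)" using 1 u wpath_slide wpath_inv by blast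
  have \<delta>': "wpath w \<delta>' (p' @ u @ q')" using parallel_lifted[OF assms] 1 by simp
  have "hmt w (\<delta> @ (?j @ ?k)) (\<delta> @ [])"
    by (rule hmt_left[OF 1(4) slide_inverse]) (use 1 u in auto)
  then have "hmt w \<delta> ((\<delta> @ ?j) @ ?k)" by (simp add: hmt_sym)
  also have "hmt w ((\<delta> @ ?j) @ ?k) (\<delta>' @ ?k)"
    by (rule hmt_right[OF hmt_sym[OF 1(7)] _ k]) (use 1 j wpath_appendI in blast)
  finally show ?thesis unfolding 1(1,2)
    by (intro parallel.intros[where \<pi> = "path_inv \<pi>" and \<rho> = "path_inv \<rho>"]) (use 1 \<delta>' wpath_inv in auto)
qed

lemma parallel_trans:
  assumes "parallel z z'" "parallel z' z''"
  shows "parallel z z''"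
  using assms(1)
proof cases
  case (1 u v \<delta> p q \<pi> p' \<rho> q' \<delta>')
  obtain p'' q'' \<pi>' \<rho>' \<delta>'' where 2: "z'' = (\<delta>'', p'', u, v, q'')" "wpath p' \<pi>' p''" "wpath q' \<rho>' q''"
    "hmt w \<delta>'' (\<delta>' @ slide u q' p'' \<pi>' \<rho>')"
    using assms(2) unfolding 1(2) by (auto elim: parallel.cases)
  have u: "u \<in> W" "u \<noteq> []" using 1 rule_words by auto
  let ?j = "slide u q p' \<pi> \<rho>" and ?k = "slide u q' p'' \<pi>' \<rho>'"
  have j: "wpath (p @ u @ q) ?j (p' @ u @ q')" using 1 u wpath_slide by blast
  have k: "wpath (p' @ u @ q') ?k (p'' @ u @ q'')" using 2 u wpath_slide by blast
  have \<delta>': "wpath w \<delta>' (p' @ u @ q')" using parallel_lifted[OF assms(1)] 1 by simp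
  note 2(4)
  also have "hmt w (\<delta>' @ ?k) ((\<delta> @ ?j) @ ?k)" by (rule hmt_right[OF 1(7) \<delta>' k])
  also have "(\<delta> @ ?j) @ ?k = \<delta> @ (?j @ ?k)" by simp
  also have "hmt w \<dots> (\<delta> @ slide u q p'' (\<pi> @ \<pi>') (\<rho> @ \<rho>'))"
    by (rule hmt_left[OF 1(4) slide_append[OF u 1(5) 2(2) 1(6) 2(3)]])
  finally show ?thesis unfolding 1(1) 2(1)
    by (intro parallel.intros[where \<pi> = "\<pi> @ \<pi>'" and \<rho> = "\<rho> @ \<rho>'"]) (use 1 2 wpath_appendI in blast)+
qed

definition hyp :: "'a squier_edge list \<times> 'a squier_edge \<Rightarrow> ('a squier_edge list \<times> 'a squier_edge) set" where
  "hyp z = {z'. parallel z z'}"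

lemma hyp_eq_iff: "lifted z \<Longrightarrow> hyp z = hyp z' \<longleftrightarrow> parallel z z'"
  unfolding hyp_def using parallel_refl parallel_sym parallel_trans by blast

lemma hyp_eqI: "parallel z z' \<Longrightarrow> hyp z = hyp z'"
  using hyp_eq_iff parallel_lifted by blast

definition hyps :: "('a squier_edge list \<times> 'a squier_edge) set set" where
  "hyps = hyp ` {z. lifted z}"

lemma hyp_in [simp]: "lifted z \<Longrightarrow> hyp z \<in> hyps" by (auto simp: hyps_def)

lemma hypsE:
  assumes "K \<in> hyps"
  obtains \<delta> p u v q where "K = hyp (\<delta>, p, u, v, q)" "lifted (\<delta>, p, u, v, q)"
proof -
  obtain z where z: "K = hyp z" "lifted z" using assms by (auto simp: hyps_def)
  obtain \<delta> p u v q where "z = (\<delta>, p, u, v, q)" by (cases z)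
  then show ?thesis using that z by blast
qed

lemma hyp_hmt: "lifted (\<delta>, e) \<Longrightarrow> hmt w \<delta> \<delta>' \<Longrightarrow> hyp (\<delta>, e) = hyp (\<delta>', e)"
  using hyp_eqI parallel_hmt by blast

lemma hyp_slide:
  assumes "rule u v" "wpath w \<delta> (p @ u @ q)" "wpath p \<pi> p'" "wpath q \<rho> q'"
  shows "hyp (\<delta> @ slide u q p' \<pi> \<rho>, p', u, v, q') = hyp (\<delta>, p, u, v, q)"
proof -
  have "wpath w (\<delta> @ slide u q p' \<pi> \<rho>) (p' @ u @ q')"
    using assms wpath_slide[of u p \<pi> p' q \<rho> q'] rule_words by (intro wpath_appendI) auto
  from parallel.intros[OF assms hmt_refl[OF w_word(2) this]]
  have "parallel (\<delta>, p, u, v, q) (\<delta> @ slide u q p' \<pi> \<rho>, p', u, v, q')" .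
  then show ?thesis by (rule hyp_eqI[symmetric])
qed

lemma hyp_rc:
  assumes "rule u v" "wpath w \<delta> (p @ u @ q)" "wpath p \<pi> p'"
  shows "hyp (\<delta> @ rc \<pi> (u @ q), p', u, v, q) = hyp (\<delta>, p, u, v, q)"
proof -
  have "q \<in> W" using wpath_words[OF assms(2)] by simp
  then show ?thesis using hyp_slide[OF assms, of "[]" q] by (simp add: slide_def)
qed

lemma hyp_lc:
  assumes "rule u v" "wpath w \<delta> (p @ u @ q)" "wpath q \<rho> q'"
  shows "hyp (\<delta> @ lc (p @ u) \<rho>, p, u, v, q') = hyp (\<delta>, p, u, v, q)"
proof -
  have "p \<in> W" using wpath_words[OF assms(2)] by simp
  then show ?thesis using hyp_slide[OF assms(1,2), of "[]" p \<rho> q'] assms(3) by (simp add: slide_def)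
qed

text \<open>All members of the union are the same class, by \<open>parallel_translate\<close>, so no
  representative has to be chosen.\<close>

definition hact :: "'a squier_edge list set \<Rightarrow> ('a squier_edge list \<times> 'a squier_edge) set
    \<Rightarrow> ('a squier_edge list \<times> 'a squier_edge) set" where
  "hact A K = (\<Union>\<gamma>\<in>A. \<Union>(\<delta>, e)\<in>K. hyp (\<gamma> @ \<delta>, e))"

lemma parallel_translate:
  assumes "parallel (\<delta>, e) (\<delta>', e')" "loop \<gamma>" "hmt w \<gamma> \<gamma>'"
  shows "parallel (\<gamma> @ \<delta>, e) (\<gamma>' @ \<delta>', e')"
  using assms(1)
proof cases
  case (1 u v p q \<pi> p' \<rho> q')
  have \<delta>': "wpath w \<delta>' (p' @ u @ q')" using parallel_lifted[OF assms(1)] 1 by simp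
  have \<gamma>': "loop \<gamma>'" using assms hmt_wpath by blast
  have "hmt w (\<gamma>' @ \<delta>') (\<gamma> @ (\<delta> @ slide u q p' \<pi> \<rho>))"
    by (rule hmt_append[OF hmt_sym[OF assms(3)] \<gamma>' 1(7)])
  then show ?thesis unfolding 1
    by (intro parallel.intros[where \<pi> = \<pi> and \<rho> = \<rho>]) (use 1 assms wpath_appendI in auto)
qed

lemma hact_hyp:
  assumes \<gamma>: "loop \<gamma>" and z: "lifted (\<delta>, e)"
  shows "hact (loop_class \<gamma>) (hyp (\<delta>, e)) = hyp (\<gamma> @ \<delta>, e)"
proof -
  let ?A = "loop_class \<gamma>" and ?K = "hyp (\<delta>, e)"
  have key: "(case z of (\<delta>', e') \<Rightarrow> hyp (\<gamma>' @ \<delta>', e')) = hyp (\<gamma> @ \<delta>, e)" if "\<gamma>' \<in> ?A" "z \<in> ?K" for \<gamma>' z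
  proof -
    obtain \<delta>' e' where z: "z = (\<delta>', e')" by (cases z)
    show ?thesis
      using hyp_eqI[OF parallel_translate[of \<delta> e \<delta>' e' \<gamma> \<gamma>']] that \<gamma> by (simp add: z loop_class_def hyp_def)
  qed
  have "hact ?A ?K = (\<Union>\<gamma>'\<in>?A. \<Union>z\<in>?K. hyp (\<gamma> @ \<delta>, e))"
    unfolding hact_def by (intro SUP_cong HOL.refl) (rule key)
  moreover have "\<gamma> \<in> ?A" "(\<delta>, e) \<in> ?K"
    using \<gamma> z hmt_refl parallel_refl by (auto simp: loop_class_def hyp_def)
  ultimately show ?thesis by auto
qed

lemma lifted_translate: "loop \<gamma> \<Longrightarrow> lifted (\<delta>, e) \<Longrightarrow> lifted (\<gamma> @ \<delta>, e)"
  using wpath_appendI by (simp add: lifted_def)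

text \<open>Both orientations of a hyperplane are elements of \<open>hyps\<close>, with opposite counts.\<close>

fun crossings :: "'a squier_edge list \<Rightarrow> 'a squier_edge list
    \<Rightarrow> ('a squier_edge list \<times> 'a squier_edge) set \<Rightarrow> int" where
  "crossings \<delta> [] K = 0"
| "crossings \<delta> (e # a) K = of_bool (K = hyp (\<delta>, e)) - of_bool (K = hyp (\<delta> @ [e], squier_inv e))
     + crossings (\<delta> @ [e]) a K"

lemma crossings_append: "crossings \<delta> (a @ b) K = crossings \<delta> a K + crossings (\<delta> @ a) b K"
  by (induction a arbitrary: \<delta>) auto

lemma wpath_edge: "is_edge e \<Longrightarrow> wpath (edge_source e) [e] (edge_target e)"
  using edge_words by simp

lemma lifted_inv: "lifted (\<delta>, e) \<Longrightarrow> lifted (\<delta> @ [e], squier_inv e)"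
  using wpath_appendI[OF _ wpath_edge] by (simp add: lifted_def)

lemma crossings_hmt_start:
  assumes "wpath w \<delta> x" "hmt w \<delta> \<delta>'" "wpath x a y"
  shows "crossings \<delta> a K = crossings \<delta>' a K"
  using assms
proof (induction a arbitrary: \<delta> \<delta>' x)
  case (Cons e a)
  have l: "lifted (\<delta>, e)" using Cons.prems by (auto simp: lifted_def)
  have e: "wpath x [e] (edge_target e)" using Cons.prems wpath_edge by auto
  have h: "hmt w (\<delta> @ [e]) (\<delta>' @ [e])" by (rule hmt_right[OF Cons.prems(2,1) e])
  have "crossings (\<delta> @ [e]) a K = crossings (\<delta>' @ [e]) a K"
    by (rule Cons.IH[OF wpath_appendI[OF Cons.prems(1) e] h]) (use Cons.prems in auto)
  then show ?case
    using hyp_hmt[OF l Cons.prems(2)] hyp_hmt[OF lifted_inv[OF l] h] by simp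
qed simp

lemma crossings_backtrack:
  assumes "lifted (\<delta>, e)"
  shows "crossings \<delta> [e, squier_inv e] K = 0"
proof -
  have x: "wpath w \<delta> (edge_source e)" "is_edge e" using assms by (auto simp: lifted_def)
  have "hmt w (\<delta> @ ([e] @ path_inv [e])) (\<delta> @ [])"
    by (rule hmt_left[OF x(1) hmt_inv_right[of _ _ "edge_target e"]]) (use x edge_words in auto)
  then have "hmt w \<delta> (\<delta> @ [e, squier_inv e])" by (simp add: hmt_sym)
  then show ?thesis using hyp_hmt[OF assms] by simp
qed

text \<open>Opposite sides of a square are dual to the same hyperplane and the boundary traverses
  them in opposite directions, so the contributions cancel in pairs.\<close>

lemma crossings_square:
  assumes R: "rule l r" "rule l' r'" and pzq: "p \<in> W" "z \<in> W" "q \<in> W"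
    and \<delta>: "wpath w \<delta> (p @ l @ z @ l' @ q)"
  shows "crossings \<delta> ([(p, l, r, z @ l' @ q), (p @ r @ z, l', r', q)] @
    path_inv [(p @ l @ z, l', r', q), (p, l, r, z @ r' @ q)]) K = 0"
proof -
  let ?e1 = "(p, l, r, z @ l' @ q)" and ?e2 = "(p @ r @ z, l', r', q)"
    and ?f1 = "(p @ l @ z, l', r', q)" and ?f2 = "(p, l, r, z @ r' @ q)"
  let ?x = "p @ l @ z @ l' @ q"
  note ws = rule_words[OF R(1)] rule_words[OF R(2)]
  have p1: "wpath ?x [?e1] (p @ r @ z @ l' @ q)" "wpath (p @ r @ z @ l' @ q) [?e2] (p @ r @ z @ r' @ q)"
    "wpath ?x [?f1] (p @ l @ z @ r' @ q)" "wpath (p @ l @ z @ r' @ q) [?f2] (p @ r @ z @ r' @ q)"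
    using R ws pzq by auto
  have ex: "hmt ?x ([?e1] @ [?e2]) ([?f1] @ [?f2])" using edge_exchange[OF R pzq] by simp
  have sq: "hmt w (\<delta> @ [?e1, ?e2]) (\<delta> @ [?f1, ?f2])" using hmt_left[OF \<delta> ex] by simp
  have "hmt ?x (([?e1] @ [?e2]) @ path_inv [?f2]) (([?f1] @ [?f2]) @ path_inv [?f2])"
    by (rule hmt_right[OF ex _ wpath_inv[OF p1(4)]]) (rule wpath_appendI[OF p1(1,2)])
  also have "([?f1] @ [?f2]) @ path_inv [?f2] = [?f1] @ ([?f2] @ path_inv [?f2])" by simp
  also have "hmt ?x \<dots> ([?f1] @ [])"
    by (rule hmt_left[OF p1(3) hmt_inv_right[OF _ p1(4)]]) (use ws in auto)
  finally have tri: "hmt ?x (([?e1] @ [?e2]) @ path_inv [?f2]) ([?f1] @ [])" .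
  then have sq': "hmt w (\<delta> @ [?e1, ?e2, squier_inv ?f2]) (\<delta> @ [?f1])"
    using hmt_left[OF \<delta>] by simp
  have "hmt ?x (([?e1, ?e2] @ path_inv [?f2]) @ path_inv [?f1]) ([?f1] @ path_inv [?f1])"
    by (rule hmt_right[OF _ _ wpath_inv[OF p1(3)]])
       (use tri R rule_sym ws pzq in auto)
  also have "hmt ?x \<dots> []" by (rule hmt_inv_right[OF _ p1(3)]) (use ws in auto)
  finally have sq'': "hmt w (\<delta> @ [?e1, ?e2, squier_inv ?f2, squier_inv ?f1]) \<delta>"
    using hmt_left[OF \<delta>] by fastforce
  have d: "wpath w (\<delta> @ [?e1]) (p @ r @ z @ l' @ q)" "wpath w (\<delta> @ [?f1]) (p @ l @ z @ r' @ q)"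
    "wpath w (\<delta> @ [?e1, ?e2]) (p @ r @ z @ r' @ q)"
    using \<delta> p1 wpath_appendI by (blast, blast) (use \<delta> wpath_appendI[OF p1(1,2)] wpath_appendI in fastforce)
  have l: "lifted (\<delta> @ [?f1], ?f2)" "lifted (\<delta> @ [?e1, ?e2], squier_inv ?e2)"
    "lifted (\<delta> @ [?f1], squier_inv ?f1)" "lifted (\<delta>, ?f1)"
    using d R pzq ws \<delta> rule_sym by auto
  have zq: "wpath (z @ l' @ q) [(z, l', r', q)] (z @ r' @ q)" "wpath (p @ l @ z) [(p, l, r, z)] (p @ r @ z)"
    using R ws pzq by auto
  \<comment> \<open>Facts 1 and 2 match the sides carrying the first rule, 3 and 4 the other pair,
    each in both orientations.\<close>
  have 1: "hyp (\<delta> @ [?e1, ?e2, squier_inv ?f2], ?f2) = hyp (\<delta>, ?e1)"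
    using hyp_hmt[OF l(1) hmt_sym[OF sq']] hyp_lc[OF R(1) \<delta> zq(1)] by simp
  have 2: "hyp (\<delta> @ [?e1, ?e2], squier_inv ?f2) = hyp (\<delta> @ [?e1], squier_inv ?e1)"
    using hyp_lc[OF rule_sym[OF R(1)] d(1) zq(1)] by simp
  have 3: "hyp (\<delta> @ [?e1, ?e2, squier_inv ?f2, squier_inv ?f1], ?f1) = hyp (\<delta> @ [?e1], ?e2)"
    using hyp_hmt[OF l(4) hmt_sym[OF sq'']] hyp_rc[OF R(2) _ zq(2), of \<delta> q] \<delta> by simp
  have 4: "hyp (\<delta> @ [?e1, ?e2, squier_inv ?f2], squier_inv ?f1) = hyp (\<delta> @ [?e1, ?e2], squier_inv ?e2)"
    using hyp_hmt[OF l(3) hmt_sym[OF sq']] hyp_hmt[OF l(2) sq]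
      hyp_rc[OF rule_sym[OF R(2)] _ zq(2), of "\<delta> @ [?f1]" q] d by simp
  show ?thesis using 1 2 3 4 by simp
qed

text \<open>An elementary homotopy deletes a closed piece. The piece contributes zero, and being
  null-homotopic it leaves the lift of the rest of the path in place.\<close>

lemma crossings_hmt:
  assumes "hmt x a b" "wpath w \<delta> x"
  shows "crossings \<delta> a K = crossings \<delta> b K"
proof -
  obtain y where h: "homotopic Q x y a b" and x: "x \<noteq> []" using assms by (auto simp: hmt_def)
  \<comment> \<open>That the deleted piece \<open>c\<close> is null-homotopic is recovered from the
    homotopy of the whole paths by cancelling \<open>p\<close> in front and \<open>q\<close>
    behind.\<close>
  have skip: "crossings \<delta> (p @ c @ q) K = crossings \<delta> (p @ q) K"
    if pcq: "wpath x (p @ c @ q) y" and pq: "wpath x (p @ q) y"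
      and hpq: "homotopic Q x y (p @ c @ q) (p @ q)" and zero: "\<And>t. wpath x p t \<Longrightarrow> crossings (\<delta> @ p) c K = 0" for p c q
  proof -
    obtain t s where ts: "wpath x p t" "wpath t c s" "wpath s q y" using pcq unfolding wpath_append by blast
    have "wpath t q y" using pq ts wpath_append wpath_det by blast
    then have "t = s" using ts(3)
    proof (cases q)
      case Nil then show ?thesis using \<open>wpath t q y\<close> ts(3) by simp
    next
      case (Cons e q') then show ?thesis using \<open>wpath t q y\<close> ts(3) by simp
    qed
    have x': "wpath w \<delta> x" using assms by simp
    note dp = wpath_appendI[OF x' ts(1)]
    have t: "t \<noteq> []" using wpath_nonempty[OF ts(1)] x by simp
    have s: "s \<noteq> []" using t \<open>t = s\<close> by simp
    note pp = hmt_inv_left[OF x ts(1)] wpath_appendI[OF wpath_inv[OF ts(1)] ts(1)]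
    have "hmt x (p @ c @ q) (p @ q)" using hpq x by (auto simp: hmt_def)
    then have h1: "hmt t (path_inv p @ p @ c @ q @ path_inv q) (path_inv p @ p @ q @ path_inv q)"
      using hmt_context[OF wpath_inv[OF ts(1)] _ pcq wpath_inv[OF ts(3)], of "p @ q"] by simp
    have "hmt t ((path_inv p @ p) @ (c @ (q @ path_inv q))) ([] @ (c @ []))"
      by (rule hmt_append[OF pp hmt_left[OF ts(2) hmt_inv_right[OF s ts(3)]]])
    then have h2: "hmt t (path_inv p @ p @ c @ q @ path_inv q) c" by simp
    have "hmt t ((path_inv p @ p) @ (q @ path_inv q)) ([] @ [])"
      by (rule hmt_append[OF pp hmt_inv_right[OF t \<open>wpath t q y\<close>]])
    then have h3: "hmt t (path_inv p @ p @ q @ path_inv q) []" by simp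
    have "hmt t c []" by (rule hmt_trans[OF hmt_sym[OF h2] hmt_trans[OF h1 h3]])
    then have "hmt w ((\<delta> @ p) @ c) (\<delta> @ p)" using hmt_left[OF dp] by fastforce
    then have "crossings (\<delta> @ p @ c) q K = crossings (\<delta> @ p) q K"
      using crossings_hmt_start[of "(\<delta> @ p) @ c" s "\<delta> @ p" q y K] wpath_appendI[OF dp ts(2)] ts(3) by simp
    then show ?thesis using zero[OF ts(1)] by (simp add: crossings_append)
  qed
  show ?thesis using h
  proof (induction rule: homotopic.induct)
    case (backtrack p e q)
    have "crossings (\<delta> @ p) [e, squier_inv e] K = 0" if "wpath x p t" for t
    proof (rule crossings_backtrack)
      have "is_edge e" "edge_source e = t"
        using backtrack(1) that x wpath_det by (auto simp: is_path_wpath wpath_append)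
      then show "lifted (\<delta> @ p, e)" using wpath_appendI[OF assms(2) that] by (simp add: lifted_def)
    qed
    then show ?case
      using skip[of p "[e, squier_inv e]" q] homotopic.backtrack[OF backtrack] backtrack x is_path_wpath by simp
  next
    case (cell c p q)
    have "crossings (\<delta> @ p) c K = 0" if t: "wpath x p t" for t
    proof -
      obtain p' z q' l1 r1 l2 r2 where c: "p' \<in> W" "z \<in> W" "q' \<in> W"
        "(l1, r1) \<in> relations P" "(l2, r2) \<in> relations P"
        "c = [(p', l1, r1, z @ l2 @ q'), (p' @ r1 @ z, l2, r2, q')] @
          path_inv [(p' @ l1 @ z, l2, r2, q'), (p', l1, r1, z @ r2 @ q')]"
        using cell(1) unfolding squier_simps squier_cells_def path_inv_def by blast
      have "\<exists>s. wpath x p s \<and> wpath s (c @ q) y" using cell(2) x is_path_wpath wpath_append by blast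
      then have "wpath t (c @ q) y" using t wpath_det by blast
      then have "t = p' @ l1 @ z @ l2 @ q'" using c by simp
      then show ?thesis unfolding c(6)
        by (intro crossings_square) (use c wpath_appendI[OF assms(2) t] in \<open>auto simp: rule_def\<close>)
    qed
    then show ?case using skip[of p c q] homotopic.cell[OF cell] cell x is_path_wpath by simp
  qed auto
qed

text \<open>Translation by a loop is injective on hyperplanes, since the inverse loop undoes it up
  to homotopy; so the contributions correspond edge by edge.\<close>

lemma crossings_translate:
  assumes \<gamma>: "loop \<gamma>" and K: "K \<in> hyps" and "wpath w \<delta> x" "wpath x a y"
  shows "crossings (\<gamma> @ \<delta>) a (hact (loop_class \<gamma>) K) = crossings \<delta> a K"
  using assms(3,4)
proof (induction a arbitrary: \<delta> x)
  case (Cons e a)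
  have inj: "hact (loop_class \<gamma>) K = hyp (\<gamma> @ \<delta>, e) \<longleftrightarrow> K = hyp (\<delta>, e)" if l: "lifted (\<delta>, e)" for \<delta> e
  proof -
    obtain \<delta>' p u v q where K': "K = hyp (\<delta>', p, u, v, q)" "lifted (\<delta>', p, u, v, q)" using K by (rule hypsE)
    have "parallel (\<delta>', p, u, v, q) (\<delta>, e)" if "parallel (\<gamma> @ \<delta>', p, u, v, q) (\<gamma> @ \<delta>, e)"
    proof -
      have i: "loop (path_inv \<gamma>)" using wpath_inv[OF \<gamma>] .
      have cancel: "hmt w (path_inv \<gamma> @ \<gamma> @ d') d'" if "wpath w d' y" for d' y
        using hmt_right[OF hmt_inv_left[OF _ \<gamma>] wpath_appendI[OF i \<gamma>] that] by simp
      have "parallel (path_inv \<gamma> @ \<gamma> @ \<delta>', p, u, v, q) (path_inv \<gamma> @ \<gamma> @ \<delta>, e)"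
        by (rule parallel_translate[OF that i hmt_refl[OF _ i]]) simp
      moreover have "parallel (path_inv \<gamma> @ \<gamma> @ \<delta>', p, u, v, q) (\<delta>', p, u, v, q)"
        by (rule parallel_hmt[OF lifted_translate[OF i lifted_translate[OF \<gamma> K'(2)]]])
           (use K' cancel in auto)
      moreover have "parallel (path_inv \<gamma> @ \<gamma> @ \<delta>, e) (\<delta>, e)"
        by (rule parallel_hmt[OF lifted_translate[OF i lifted_translate[OF \<gamma> l]]])
           (use l cancel in \<open>auto simp: lifted_def\<close>)
      ultimately show ?thesis using parallel_trans parallel_sym by blast
    qed
    moreover have "parallel (\<gamma> @ \<delta>', p, u, v, q) (\<gamma> @ \<delta>, e)" if "parallel (\<delta>', p, u, v, q) (\<delta>, e)"
      by (rule parallel_translate[OF that \<gamma> hmt_refl[OF _ \<gamma>]]) simp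
    ultimately show ?thesis
      using K' hact_hyp[OF \<gamma> K'(2)] hyp_eq_iff[OF lifted_translate[OF \<gamma> K'(2)]] hyp_eq_iff[OF K'(2)] by auto
  qed
  have l: "lifted (\<delta>, e)" using Cons.prems by (auto simp: lifted_def)
  have e: "wpath w (\<delta> @ [e]) (edge_target e)"
    using Cons.prems wpath_appendI[OF _ wpath_edge] by simp
  have "wpath (edge_target e) a y" using Cons.prems by simp
  from Cons.IH[OF e this] show ?case using inj[OF l] inj[OF lifted_inv[OF l]] by simp
qed simp

lemma finite_crossings: "wpath w \<delta> x \<Longrightarrow> wpath x a y \<Longrightarrow> finite {K. crossings \<delta> a K \<noteq> 0}"
proof (induction a arbitrary: \<delta> x)
  case (Cons e a)
  have "wpath w (\<delta> @ [e]) (edge_target e)"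
    using Cons.prems wpath_appendI[OF _ wpath_edge] by simp
  then have "finite {K. crossings (\<delta> @ [e]) a K \<noteq> 0}" using Cons by auto
  then have "finite ({hyp (\<delta>, e), hyp (\<delta> @ [e], squier_inv e)} \<union> {K. crossings (\<delta> @ [e]) a K \<noteq> 0})" by simp
  then show ?case by (rule finite_subset[rotated]) auto
qed simp

end

section \<open>Positions in a diagram\<close>

text \<open>Realise a word of length \<open>m\<close> as the interval \<open>[0, m]\<close>. The edge \<open>(p, u, v, q)\<close> stretches
  \<open>[\<bar>p\<bar>, \<bar>p\<bar> + \<bar>u\<bar>]\<close> linearly onto \<open>[\<bar>p\<bar>, \<bar>p\<bar> + \<bar>v\<bar>]\<close>; with \<open>a = \<bar>p\<bar>\<close>, \<open>b = \<bar>u\<bar>\<close>, \<open>c = \<bar>v\<bar>\<close>.\<close>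

definition stretch :: "real \<Rightarrow> real \<Rightarrow> real \<Rightarrow> real \<Rightarrow> real" where
  "stretch a b c t = (if t \<le> a then t else if t \<le> a + b then a + (t - a) * (c / b) else t + c - b)"

lemma stretch_inverse:
  assumes "b > 0" "c > 0"
  shows "stretch a c b (stretch a b c t) = t"
proof -
  consider "t \<le> a" | "a < t" "t \<le> a + b" | "t > a + b" by linarith
  then show ?thesis
  proof cases
    case 2
    define r where "r = (t - a) * (c / b)"
    have "0 < r" using 2 assms by (simp add: r_def)
    have "(t - a) * (c / b) \<le> b * (c / b)"
      using 2 assms by (intro mult_right_mono) auto
    then have "r \<le> c" using assms by (simp add: r_def)
    then have "stretch a c b (a + r) = a + r * (b / c)" using \<open>0 < r\<close> by (simp add: stretch_def)
    also have "\<dots> = t" using assms by (simp add: r_def)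
    finally show ?thesis using 2 by (simp add: stretch_def[of a b c] r_def)
  qed (use assms in \<open>auto simp: stretch_def\<close>)
qed

lemma stretch_mono:
  assumes "b > 0" "c > 0" "s < t"
  shows "stretch a b c s < stretch a b c t"
proof -
  have bound: "0 < (t - a) * (c / b)" "(t - a) * (c / b) \<le> c" if "a < t" "t \<le> a + b" for t
  proof -
    show "0 < (t - a) * (c / b)" using that assms by simp
    have "(t - a) * (c / b) \<le> b * (c / b)" using that assms by (intro mult_right_mono) auto
    then show "(t - a) * (c / b) \<le> c" using assms by simp
  qed
  have "(s - a) * (c / b) < (t - a) * (c / b)" using assms by (intro mult_strict_right_mono) auto
  moreover define r where "r t = (t - a) * (c / b)" for t
  ultimately have r: "r s < r t" by simp
  have S: "stretch a b c t = (if t \<le> a then t else if t \<le> a + b then a + r t else t + c - b)" for t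
    by (simp only: stretch_def r_def)
  have B: "0 < r t" "r t \<le> c" if "a < t" "t \<le> a + b" for t
    using bound[OF that] by (simp_all only: r_def)
  consider "t \<le> a" | "s \<le> a" "a < t" "t \<le> a + b" | "s \<le> a" "a + b < t" | "a < s" "t \<le> a + b"
    | "a < s" "s \<le> a + b" "a + b < t" | "a + b < s" by linarith
  then show ?thesis
    by cases (use assms r B[of s] B[of t] in \<open>simp_all add: S\<close>)
qed

text \<open>Stretching the left interval displaces the right one by \<open>c - b\<close>, hence the
  two offsets. This is the invariance of positions under a cell of the Squier complex.\<close>

lemma stretch_square:
  assumes "b > 0" "c > 0" "b' > 0" "c' > 0" "z \<ge> 0"
  shows "stretch (a + c + z) b' c' (stretch a b c t) = stretch a b c (stretch (a + b + z) b' c' t)"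
proof (cases "t \<le> a + b")
  case True
  have "stretch a b c t \<le> a + c"
  proof (cases "t = a + b")
    case True then show ?thesis using assms by (simp add: stretch_def)
  next
    case False
    then have "stretch a b c t < stretch a b c (a + b)" using True assms by (intro stretch_mono) auto
    also have "\<dots> = a + c" using assms by (simp add: stretch_def)
    finally show ?thesis by simp
  qed
  then show ?thesis using True assms by (simp add: stretch_def[of "a + c + z"] stretch_def[of "a + b + z"])
next
  case False
  have shift: "stretch (a + c + z) b' c' (t + c - b) = stretch (a + b + z) b' c' t + c - b"
    by (auto simp: stretch_def algebra_simps)
  have "stretch (a + b + z) b' c' t > a + b"
  proof -
    have "stretch (a + b + z) b' c' (a + b) < stretch (a + b + z) b' c' t"
      using False assms by (intro stretch_mono) auto
    moreover have "stretch (a + b + z) b' c' (a + b) = a + b" using assms by (simp add: stretch_def)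
    ultimately show ?thesis by simp
  qed
  then show ?thesis using False assms shift by (simp add: stretch_def[of a])
qed

fun edge_pos :: "'a squier_edge \<Rightarrow> real \<Rightarrow> real" where
  "edge_pos (p, u, v, q) = stretch (length p) (length u) (length v)"

fun path_pos :: "'a squier_edge list \<Rightarrow> real \<Rightarrow> real" where
  "path_pos [] t = t"
| "path_pos (e # a) t = path_pos a (edge_pos e t)"

lemma path_pos_append: "path_pos (a @ b) t = path_pos b (path_pos a t)"
  by (induction a arbitrary: t) auto

context squier
begin

lemma edge_pos_inverse: "is_edge e \<Longrightarrow> edge_pos (squier_inv e) (edge_pos e t) = t"
  by (cases e) (auto dest: rule_words intro!: stretch_inverse)

lemma path_pos_mono: "wpath x a y \<Longrightarrow> s < t \<Longrightarrow> path_pos a s < path_pos a t"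
proof (induction a arbitrary: x s t)
  case (Cons e a)
  have "edge_pos e s < edge_pos e t"
    using Cons.prems by (cases e) (auto dest: rule_words intro!: stretch_mono)
  then show ?case using Cons by auto
qed simp

text \<open>Each vertex of the universal cover thus carries a well-defined map from the line of the
  base word, and cuts in different words can be compared on that one line.\<close>

lemma path_pos_hmt:
  assumes "hmt x a b"
  shows "path_pos a t = path_pos b t"
proof -
  obtain y where h: "homotopic Q x y a b" and x: "x \<noteq> []" using assms by (auto simp: hmt_def)
  show ?thesis using h
  proof (induction rule: homotopic.induct)
    case (backtrack p e q)
    have "is_edge e" using backtrack(1) x by (auto simp: is_path_wpath wpath_append)
    then show ?case by (simp add: path_pos_append edge_pos_inverse)
  next
    case (cell c p q)
    obtain p' z q' l1 r1 l2 r2 where c: "(l1, r1) \<in> relations P" "(l2, r2) \<in> relations P"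
        "c = [(p', l1, r1, z @ l2 @ q'), (p' @ r1 @ z, l2, r2, q')] @
          map squier_inv (rev [(p' @ l1 @ z, l2, r2, q'), (p', l1, r1, z @ r2 @ q')])"
      using cell(1) unfolding squier_simps squier_cells_def by blast
    have ne: "l1 \<noteq> []" "r1 \<noteq> []" "l2 \<noteq> []" "r2 \<noteq> []"
      using rule_words[of l1 r1] rule_words[of l2 r2] c(1,2) by (auto simp: rule_def)
    have "path_pos c t = t" for t
      unfolding c(3) using ne stretch_square[of "length l1" "length r1" "length l2" "length r2" "length z" "length p'" t]
      by (simp add: stretch_inverse add.assoc)
    then show ?case by (simp add: path_pos_append)
  qed auto
qed

lemma path_pos_surj:
  assumes "wpath w \<delta> x"
  shows "\<exists>s. path_pos \<delta> s = t"
proof -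
  have x: "x \<noteq> []" using wpath_nonempty[OF assms] by simp
  have "hmt x (path_inv \<delta> @ \<delta>) []" using hmt_inv_left[OF _ assms] by simp
  then have "path_pos \<delta> (path_pos (path_inv \<delta>) t) = t" using path_pos_hmt[of x "path_inv \<delta> @ \<delta>" "[]" t] by (simp add: path_pos_append)
  then show ?thesis by blast
qed

lemma path_pos_rc:
  assumes "wpath x a y"
  shows "path_pos (rc a s) (length x) = length y"
  using assms
proof (induction a arbitrary: x)
  case (Cons e a)
  obtain p u v q where e: "e = (p, u, v, q)" by (cases e)
  have "stretch (length p) (length u) (length v) (length (p @ u @ q)) = length (p @ v @ q)"
    using Cons.prems e rule_words[of u v] by (auto simp: stretch_def)
  then show ?case using Cons.IH[of "p @ v @ q"] Cons.prems e by auto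
qed simp

lemma path_pos_lc: "t \<le> length x \<Longrightarrow> path_pos (lc x a) t = t"
proof (induction a)
  case (Cons e a)
  then show ?case by (cases e) (simp add: stretch_def)
qed simp

text \<open>Moves left of a cut take it to the end of the new prefix, moves right of it leave it
  alone; so the left end of a hyperplane has the same coordinate on the base word for all its
  lifts.\<close>

lemma path_pos_slide:
  assumes "wpath p \<pi> p'"
  shows "path_pos (slide u q p' \<pi> \<rho>) (length p) = length p'"
  unfolding slide_def path_pos_append using path_pos_rc[OF assms] by (simp add: path_pos_lc)

section \<open>The hyperplane system\<close>

definition left_of :: "('a squier_edge list \<times> 'a squier_edge) set \<Rightarrow> ('a squier_edge list \<times> 'a squier_edge) set \<Rightarrow> bool" where
  "left_of K L \<longleftrightarrow> (\<exists>\<delta> p u v z u' v' q. rule u v \<and> rule u' v' \<and> p \<in> W \<and> z \<in> W \<and> q \<in> W \<and>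
     wpath w \<delta> (p @ u @ z @ u' @ q) \<and>
     K = hyp (\<delta>, p, u, v, z @ u' @ q) \<and> L = hyp (\<delta>, p @ u @ z, u', v', q))"

lemma left_ofI:
  assumes "rule u v" "rule u' v'" "p \<in> W" "z \<in> W" "q \<in> W" "wpath w \<delta> (p @ u @ z @ u' @ q)"
  shows "left_of (hyp (\<delta>, p, u, v, z @ u' @ q)) (hyp (\<delta>, p @ u @ z, u', v', q))"
  unfolding left_of_def using assms by blast

lemma left_of_asym: "left_of K L \<Longrightarrow> \<not> left_of L K"
proof
  assume 1: "left_of K L" and 2: "left_of L K"
  obtain \<delta> p u v z u' v' q where a: "rule u v" "rule u' v'" "p \<in> W" "z \<in> W" "q \<in> W"
    "wpath w \<delta> (p @ u @ z @ u' @ q)" "K = hyp (\<delta>, p, u, v, z @ u' @ q)" "L = hyp (\<delta>, p @ u @ z, u', v', q)"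
    using 1 unfolding left_of_def by blast
  obtain \<delta>1 p1 u1 v1 z1 u1' v1' q1 where b: "rule u1 v1" "rule u1' v1'" "p1 \<in> W" "z1 \<in> W" "q1 \<in> W"
    "wpath w \<delta>1 (p1 @ u1 @ z1 @ u1' @ q1)" "L = hyp (\<delta>1, p1, u1, v1, z1 @ u1' @ q1)"
    "K = hyp (\<delta>1, p1 @ u1 @ z1, u1', v1', q1)"
    using 2 unfolding left_of_def by blast
  have ws: "u \<in> W" "u' \<in> W" using a rule_words by auto
  have pK: "parallel (\<delta>, p, u, v, z @ u' @ q) (\<delta>1, p1 @ u1 @ z1, u1', v1', q1)"
    by (subst hyp_eq_iff[symmetric]) (use a b ws in simp_all)
  have pL: "parallel (\<delta>, p @ u @ z, u', v', q) (\<delta>1, p1, u1, v1, z1 @ u1' @ q1)"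
    by (subst hyp_eq_iff[symmetric]) (use a b ws in simp_all)
  obtain \<pi> \<rho> where K: "wpath p \<pi> (p1 @ u1 @ z1)" "hmt w \<delta>1 (\<delta> @ slide u (z @ u' @ q) (p1 @ u1 @ z1) \<pi> \<rho>)"
    using pK by (cases rule: parallel.cases) auto
  obtain \<pi>' \<rho>' where L: "wpath (p @ u @ z) \<pi>' p1" "hmt w \<delta>1 (\<delta> @ slide u' q p1 \<pi>' \<rho>')"
    using pL by (cases rule: parallel.cases) auto
  \<comment> \<open>\<open>s\<close> and \<open>t\<close> are the coordinates on the base word of
    the left ends of \<open>K\<close> and \<open>L\<close>. The first square gives
    \<open>s < t\<close>, the second contradicts it.\<close>
  obtain s where s: "path_pos \<delta> s = length p" using path_pos_surj[OF a(6)] by blast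
  obtain t where t: "path_pos \<delta> t = length (p @ u @ z)" using path_pos_surj[OF a(6)] by blast
  have "u \<noteq> []" using rule_words a by blast
  then have "path_pos \<delta> s < path_pos \<delta> t" by (simp add: s t add_pos_nonneg)
  then have "s < t" using path_pos_mono[OF a(6), of t s] by (metis linorder_neqE_linordered_idom not_less_iff_gr_or_eq)
  then have lt: "path_pos \<delta>1 s < path_pos \<delta>1 t" using path_pos_mono[OF b(6)] by blast
  have "path_pos \<delta>1 s = length (p1 @ u1 @ z1)"
    using path_pos_hmt[OF K(2), of s] path_pos_slide[OF K(1)] s by (simp add: path_pos_append)
  moreover have "path_pos \<delta>1 t = length p1"
    using path_pos_hmt[OF L(2), of t] path_pos_slide[OF L(1)] t by (simp add: path_pos_append)
  ultimately show False using lt by simp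
qed

lemma left_of_act:
  assumes "A \<in> carrier DG" "left_of K L"
  shows "left_of (hact A K) (hact A L)"
proof -
  obtain \<gamma> where g: "loop \<gamma>" "A = loop_class \<gamma>" using assms(1) by (auto simp: carrier_DG)
  obtain \<delta> p u v z u' v' q where a: "rule u v" "rule u' v'" "p \<in> W" "z \<in> W" "q \<in> W"
    "wpath w \<delta> (p @ u @ z @ u' @ q)" "K = hyp (\<delta>, p, u, v, z @ u' @ q)" "L = hyp (\<delta>, p @ u @ z, u', v', q)"
    using assms(2) unfolding left_of_def by blast
  have ws: "u \<in> W" "u' \<in> W" using a rule_words by auto
  have "hact A K = hyp (\<gamma> @ \<delta>, p, u, v, z @ u' @ q)" "hact A L = hyp (\<gamma> @ \<delta>, p @ u @ z, u', v', q)"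
    unfolding g a by (rule hact_hyp[OF g(1)]; use a ws in auto)+
  moreover have "wpath w (\<gamma> @ \<delta>) (p @ u @ z @ u' @ q)" using wpath_appendI[OF g(1) a(6)] .
  ultimately show ?thesis unfolding left_of_def using a(1-5) by blast
qed

lemma crossings_Cons_nonzero:
  assumes "crossings \<delta> (e # a) K \<noteq> 0"
  shows "K = hyp (\<delta>, e) \<or> K = hyp (\<delta> @ [e], squier_inv e) \<or> crossings (\<delta> @ [e]) a K \<noteq> 0"
proof -
  have "A \<or> B \<or> c \<noteq> 0" if "of_bool A - of_bool B + c \<noteq> 0" for A B and c :: int
    using that by (cases A; cases B) auto
  then show ?thesis using assms unfolding crossings.simps .
qed

text \<open>Each edge of the path rewrites a part of the prefix, disjoint from \<open>u\<close>, so
  it spans a square with the current lift of \<open>u \<rightarrow> v\<close>; this lift stays in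
  one hyperplane along the path.\<close>

lemma crossings_rc_left:
  assumes "wpath p \<pi> p'" "rule u v" "q \<in> W" "wpath w \<delta> (p @ u @ q)" "crossings \<delta> (rc \<pi> (u @ q)) K \<noteq> 0"
  shows "left_of K (hyp (\<delta>, p, u, v, q))"
  using assms
proof (induction \<pi> arbitrary: \<delta> p)
  case (Cons e \<pi>)
  obtain a l r b where e: "e = (a, l, r, b)" by (cases e)
  have ab: "a \<in> W" "b \<in> W" "rule l r" "p = a @ l @ b" "wpath (a @ r @ b) \<pi> p'" using Cons.prems e by auto
  let ?e = "(a, l, r, b @ u @ q)"
  have u: "u \<in> W" using Cons.prems rule_words by blast
  have ws: "l \<in> W" "r \<in> W" using ab rule_words by auto
  have step: "wpath p [e] (a @ r @ b)" using ab ws e by auto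
  have \<delta>: "wpath w (\<delta> @ [?e]) ((a @ r @ b) @ u @ q)"
    using wpath_appendI[OF Cons.prems(4) wpath_rc[OF step, of "u @ q"]] u Cons.prems(3) e by simp
  have eq: "hyp (\<delta> @ [?e], a @ r @ b, u, v, q) = hyp (\<delta>, p, u, v, q)"
    using hyp_rc[OF Cons.prems(2,4) step] e by simp
  have "crossings \<delta> (?e # (rc \<pi> (u @ q))) K \<noteq> 0" using Cons.prems(5) e by simp
  from crossings_Cons_nonzero[OF this]
  consider "K = hyp (\<delta>, ?e)" | "K = hyp (\<delta> @ [?e], squier_inv ?e)" | "crossings (\<delta> @ [?e]) (rc \<pi> (u @ q)) K \<noteq> 0"
    by blast
  then show ?case
  proof cases
    case 1
    have "wpath w \<delta> (a @ l @ b @ u @ q)" using Cons.prems(4) ab(4) by simp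
    then show ?thesis unfolding 1 ab(4) by (rule left_ofI[OF ab(3) Cons.prems(2) ab(1,2) Cons.prems(3)])
  next
    case 2
    have "wpath w (\<delta> @ [?e]) (a @ r @ b @ u @ q)" using \<delta> by simp
    then have "left_of K (hyp (\<delta> @ [?e], a @ r @ b, u, v, q))" unfolding 2 squier_inv.simps
      by (rule left_ofI[OF rule_sym[OF ab(3)] Cons.prems(2) ab(1,2) Cons.prems(3)])
    then show ?thesis using eq by simp
  next
    case 3
    then show ?thesis using Cons.IH[OF ab(5) Cons.prems(2,3) \<delta>] eq by simp
  qed
qed simp

lemma crossings_lc_right:
  assumes "wpath q \<rho> q'" "rule u v" "p \<in> W" "wpath w \<delta> (p @ u @ q)" "crossings \<delta> (lc (p @ u) \<rho>) K \<noteq> 0"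
  shows "left_of (hyp (\<delta>, p, u, v, q)) K"
  using assms
proof (induction \<rho> arbitrary: \<delta> q)
  case (Cons e \<rho>)
  obtain a l r b where e: "e = (a, l, r, b)" by (cases e)
  have ab: "a \<in> W" "b \<in> W" "rule l r" "q = a @ l @ b" "wpath (a @ r @ b) \<rho> q'" using Cons.prems e by auto
  let ?e = "(p @ u @ a, l, r, b)"
  have u: "u \<in> W" using Cons.prems rule_words by blast
  have ws: "l \<in> W" "r \<in> W" using ab rule_words by auto
  have step: "wpath q [e] (a @ r @ b)" using ab ws e by auto
  have \<delta>: "wpath w (\<delta> @ [?e]) (p @ u @ (a @ r @ b))"
    using wpath_appendI[OF _ wpath_lc[OF step, of "p @ u"], of w \<delta>] Cons.prems(3,4) u e by simp
  have eq: "hyp (\<delta> @ [?e], p, u, v, a @ r @ b) = hyp (\<delta>, p, u, v, q)"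
    using hyp_lc[OF Cons.prems(2,4) step] e by simp
  have "crossings \<delta> (?e # (lc (p @ u) \<rho>)) K \<noteq> 0" using Cons.prems(5) e by simp
  from crossings_Cons_nonzero[OF this]
  consider "K = hyp (\<delta>, ?e)" | "K = hyp (\<delta> @ [?e], squier_inv ?e)" | "crossings (\<delta> @ [?e]) (lc (p @ u) \<rho>) K \<noteq> 0"
    by blast
  then show ?case
  proof cases
    case 1
    have "wpath w \<delta> (p @ u @ a @ l @ b)" using Cons.prems(4) ab(4) by simp
    then show ?thesis unfolding 1 ab(4) by (rule left_ofI[OF Cons.prems(2) ab(3) Cons.prems(3) ab(1,2)])
  next
    case 2
    have "left_of (hyp (\<delta> @ [?e], p, u, v, a @ r @ b)) K" unfolding 2 squier_inv.simps
      by (rule left_ofI[OF Cons.prems(2) rule_sym[OF ab(3)] Cons.prems(3) ab(1,2) \<delta>])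
    then show ?thesis using eq by simp
  next
    case 3
    then show ?thesis using Cons.IH[OF ab(5) Cons.prems(2,3) \<delta>] eq by simp
  qed
qed simp

text \<open>The image of the loops at the prefix \<open>p\<close>, with \<open>u @ q\<close> added
  on the right, carried to the base point by \<open>\<delta>\<close>.\<close>

fun left_loops :: "'a squier_edge list \<times> 'a squier_edge \<Rightarrow> 'a squier_edge list set set" where
  "left_loops (\<delta>, p, u, v, q) = {loop_class (\<delta> @ rc \<pi> (u @ q) @ path_inv \<delta>) | \<pi>. wpath p \<pi> p}"

fun right_loops :: "'a squier_edge list \<times> 'a squier_edge \<Rightarrow> 'a squier_edge list set set" where
  "right_loops (\<delta>, p, u, v, q) = {loop_class (\<delta> @ lc (p @ u) \<rho> @ path_inv \<delta>) | \<rho>. wpath q \<rho> q}"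

lemma loop_conj: "wpath w \<delta> x \<Longrightarrow> wpath x m x \<Longrightarrow> loop (\<delta> @ m @ path_inv \<delta>)"
  by (intro wpath_appendI wpath_inv)

text \<open>Prolonging the conjugating path by \<open>j\<close> does not change the element if
  \<open>m\<close> is replaced by the loop \<open>m'\<close> that corresponds to it along
  \<open>j\<close>.\<close>

lemma conj_hmt:
  assumes \<delta>: "wpath w \<delta> x" and j: "wpath x j y" and h: "hmt w \<delta>' (\<delta> @ j)"
    and m: "wpath x m x" and m': "wpath y m' y" and jm: "hmt x (j @ m') (m @ j)"
  shows "hmt w (\<delta>' @ m' @ path_inv \<delta>') (\<delta> @ m @ path_inv \<delta>)"
proof -
  have x: "x \<noteq> []" using wpath_nonempty[OF \<delta>] by simp
  have \<delta>j: "wpath w (\<delta> @ j) y" using wpath_appendI[OF \<delta> j] .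
  have \<delta>': "wpath w \<delta>' y" using hmt_wpath[OF h] \<delta>j by simp
  have y: "y \<noteq> []" using wpath_nonempty[OF j] x by simp
  have hi: "hmt y (path_inv \<delta>') (path_inv (\<delta> @ j))"
  proof -
    have i: "wpath y (path_inv \<delta>') w" "wpath y (path_inv (\<delta> @ j)) w" using wpath_inv[OF \<delta>'] wpath_inv[OF \<delta>j] .
    have "hmt y (path_inv \<delta>' @ []) (path_inv \<delta>' @ ((\<delta> @ j) @ path_inv (\<delta> @ j)))"
      by (rule hmt_left[OF i(1) hmt_sym[OF hmt_inv_right[OF _ \<delta>j]]]) simp
    also have "hmt y \<dots> (path_inv \<delta>' @ \<delta>' @ path_inv (\<delta> @ j))"
      by (rule hmt_context[OF i(1) hmt_sym[OF h] \<delta>j i(2)])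
    also have "\<dots> = (path_inv \<delta>' @ \<delta>') @ path_inv (\<delta> @ j)" by simp
    also have "hmt y \<dots> ([] @ path_inv (\<delta> @ j))"
      by (rule hmt_right[OF hmt_inv_left[OF _ \<delta>'] wpath_appendI[OF i(1) \<delta>'] i(2)]) simp
    finally show ?thesis by simp
  qed
  have "hmt w (\<delta>' @ (m' @ path_inv \<delta>')) ((\<delta> @ j) @ (m' @ path_inv (\<delta> @ j)))"
    by (rule hmt_append[OF h \<delta>' hmt_left[OF m' hi]])
  also have "\<dots> = \<delta> @ (j @ m') @ (path_inv j @ path_inv \<delta>)" by simp
  also have "hmt w \<dots> (\<delta> @ (m @ j) @ (path_inv j @ path_inv \<delta>))"
    by (rule hmt_context[OF \<delta> jm wpath_appendI[OF j m'] wpath_appendI[OF wpath_inv[OF j] wpath_inv[OF \<delta>]]])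
  also have "\<dots> = (\<delta> @ m) @ (j @ path_inv j) @ path_inv \<delta>" by simp
  also have "hmt w \<dots> ((\<delta> @ m) @ [] @ path_inv \<delta>)"
    by (rule hmt_context[OF wpath_appendI[OF \<delta> m] hmt_inv_right[OF x j]
        wpath_appendI[OF j wpath_inv[OF j]] wpath_inv[OF \<delta>]])
  finally show ?thesis by simp
qed

lemma left_loops_parallel:
  assumes "parallel z z'"
  shows "left_loops z \<subseteq> left_loops z'"
  using assms
proof cases
  case (1 u v \<delta> p q \<pi>0 p' \<rho>0 q' \<delta>')
  have u: "u \<in> W" "u \<noteq> []" using 1 rule_words by auto
  have ws: "q \<in> W" "q' \<in> W" "p \<in> W" "p' \<in> W" using 1 wpath_words by blast+
  let ?j = "slide u q p' \<pi>0 \<rho>0"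
  have j: "wpath (p @ u @ q) ?j (p' @ u @ q')" using wpath_slide[OF u(1) 1(5,6)] .
  show ?thesis
  proof
    fix A assume "A \<in> left_loops z"
    then obtain \<pi> where A: "wpath p \<pi> p" "A = loop_class (\<delta> @ rc \<pi> (u @ q) @ path_inv \<delta>)" using 1 by auto
    \<comment> \<open>The loop on the new prefix is the old one conjugated by \<open>\<pi>0\<close>;
      the motion \<open>\<rho>0\<close> of the suffix commutes with it.\<close>
    let ?\<pi>' = "path_inv \<pi>0 @ \<pi> @ \<pi>0"
    have \<pi>': "wpath p' ?\<pi>' p'" using wpath_appendI[OF wpath_inv[OF 1(5)] wpath_appendI[OF A(1) 1(5)]] .
    note r0 = wpath_rc[OF 1(5), of "u @ q"] and r = wpath_rc[OF A(1), of "u @ q"]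
    have m: "wpath (p @ u @ q) (rc \<pi> (u @ q)) (p @ u @ q)" using r u ws by simp
    have m': "wpath (p' @ u @ q') (rc ?\<pi>' (u @ q')) (p' @ u @ q')" using wpath_rc[OF \<pi>', of "u @ q'"] u ws by simp
    have "hmt (p @ u @ q) (?j @ slide u q' p' ?\<pi>' []) (slide u q p' (\<pi>0 @ ?\<pi>') (\<rho>0 @ []))"
      by (rule slide_append[OF u 1(5) \<pi>' 1(6)]) (use ws in simp)
    also have "\<dots> = (rc \<pi>0 (u @ q) @ path_inv (rc \<pi>0 (u @ q))) @ (rc \<pi> (u @ q) @ ?j)"
      by (simp add: slide_def rc_path_inv)
    also have "hmt (p @ u @ q) \<dots> ([] @ (rc \<pi> (u @ q) @ ?j))"
    proof (rule hmt_right)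
      show "hmt (p @ u @ q) (rc \<pi>0 (u @ q) @ path_inv (rc \<pi>0 (u @ q))) []"
        using hmt_inv_right[OF _ r0] u ws by simp
      show "wpath (p @ u @ q) (rc \<pi>0 (u @ q) @ path_inv (rc \<pi>0 (u @ q))) (p @ u @ q)"
        using wpath_appendI[OF r0 wpath_inv[OF r0]] u ws by simp
      show "wpath (p @ u @ q) (rc \<pi> (u @ q) @ ?j) (p' @ u @ q')" using wpath_appendI[OF m j] .
    qed
    finally have jm: "hmt (p @ u @ q) (?j @ rc ?\<pi>' (u @ q')) (rc \<pi> (u @ q) @ ?j)" by (simp add: slide_def)
    have "hmt w (\<delta>' @ rc ?\<pi>' (u @ q') @ path_inv \<delta>') (\<delta> @ rc \<pi> (u @ q) @ path_inv \<delta>)"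
      by (rule conj_hmt[OF 1(4) j 1(7) m m' jm])
    then have "A = loop_class (\<delta>' @ rc ?\<pi>' (u @ q') @ path_inv \<delta>')"
      using A loop_class_eq_iff[OF loop_conj[OF 1(4) m]] hmt_sym by blast
    then show "A \<in> left_loops z'" unfolding 1(2) left_loops.simps using \<pi>' by blast
  qed
qed

lemma right_loops_parallel:
  assumes "parallel z z'"
  shows "right_loops z \<subseteq> right_loops z'"
  using assms
proof cases
  case (1 u v \<delta> p q \<pi>0 p' \<rho>0 q' \<delta>')
  have u: "u \<in> W" "u \<noteq> []" using 1 rule_words by auto
  have ws: "q \<in> W" "q' \<in> W" "p \<in> W" "p' \<in> W" using 1 wpath_words by blast+
  let ?j = "slide u q p' \<pi>0 \<rho>0"
  have j: "wpath (p @ u @ q) ?j (p' @ u @ q')" using wpath_slide[OF u(1) 1(5,6)] .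
  show ?thesis
  proof
    fix A assume "A \<in> right_loops z"
    then obtain \<rho> where A: "wpath q \<rho> q" "A = loop_class (\<delta> @ lc (p @ u) \<rho> @ path_inv \<delta>)" using 1 by auto
    let ?\<rho>' = "path_inv \<rho>0 @ \<rho> @ \<rho>0"
    have \<rho>': "wpath q' ?\<rho>' q'" using wpath_appendI[OF wpath_inv[OF 1(6)] wpath_appendI[OF A(1) 1(6)]] .
    have m: "wpath (p @ u @ q) (lc (p @ u) \<rho>) (p @ u @ q)" using wpath_lc[OF A(1), of "p @ u"] u ws by simp
    have m': "wpath (p' @ u @ q') (lc (p' @ u) ?\<rho>') (p' @ u @ q')" using wpath_lc[OF \<rho>', of "p' @ u"] u ws by simp
    have r0: "wpath (p @ u @ q) (rc \<pi>0 (u @ q)) (p' @ u @ q)" using wpath_rc[OF 1(5), of "u @ q"] u ws by simp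
    have l0: "wpath (p' @ u @ q) (lc (p' @ u) \<rho>0) (p' @ u @ q')" using wpath_lc[OF 1(6), of "p' @ u"] u ws by simp
    have l: "wpath (p' @ u @ q) (lc (p' @ u) \<rho>) (p' @ u @ q)" using wpath_lc[OF A(1), of "p' @ u"] u ws by simp
    have "?j @ lc (p' @ u) ?\<rho>' = rc \<pi>0 (u @ q) @ (lc (p' @ u) \<rho>0 @ path_inv (lc (p' @ u) \<rho>0)) @ lc (p' @ u) (\<rho> @ \<rho>0)"
      by (simp add: slide_def lc_path_inv)
    also have "hmt (p @ u @ q) \<dots> (rc \<pi>0 (u @ q) @ [] @ lc (p' @ u) (\<rho> @ \<rho>0))"
      by (rule hmt_context[OF r0 hmt_inv_right[OF _ l0] wpath_appendI[OF l0 wpath_inv[OF l0]]])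
         (use u wpath_appendI[OF l l0] in auto)
    also have "\<dots> = (rc \<pi>0 (u @ q) @ lc (p' @ u) \<rho>) @ lc (p' @ u) \<rho>0" by simp
    also have "hmt (p @ u @ q) \<dots> ((lc (p @ u) \<rho> @ rc \<pi>0 (u @ q)) @ lc (p' @ u) \<rho>0)"
      by (rule hmt_right[OF rc_lc_exchange[OF u 1(5) A(1)] wpath_appendI[OF r0 l] l0])
    finally have jm: "hmt (p @ u @ q) (?j @ lc (p' @ u) ?\<rho>') (lc (p @ u) \<rho> @ ?j)" by (simp add: slide_def)
    have "hmt w (\<delta>' @ lc (p' @ u) ?\<rho>' @ path_inv \<delta>') (\<delta> @ lc (p @ u) \<rho> @ path_inv \<delta>)"
      by (rule conj_hmt[OF 1(4) j 1(7) m m' jm])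
    then have "A = loop_class (\<delta>' @ lc (p' @ u) ?\<rho>' @ path_inv \<delta>')"
      using A loop_class_eq_iff[OF loop_conj[OF 1(4) m]] hmt_sym by blast
    then show "A \<in> right_loops z'" unfolding 1(2) right_loops.simps using \<rho>' by blast
  qed
qed

definition left_stab where "left_stab K = left_loops (SOME z. z \<in> K)"
definition right_stab where "right_stab K = right_loops (SOME z. z \<in> K)"

lemma stab_hyp:
  assumes "lifted z"
  shows "left_stab (hyp z) = left_loops z" "right_stab (hyp z) = right_loops z"
proof -
  have "z \<in> hyp z" using parallel_refl[OF assms] by (simp add: hyp_def)
  then have "(SOME z'. z' \<in> hyp z) \<in> hyp z" by (rule someI)
  then have "parallel z (SOME z'. z' \<in> hyp z)" by (simp add: hyp_def)
  then show "left_stab (hyp z) = left_loops z" "right_stab (hyp z) = right_loops z"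
    using left_loops_parallel right_loops_parallel parallel_sym unfolding left_stab_def right_stab_def by blast+
qed

end

context squier
begin

section \<open>Homomorphisms to the integers\<close>

definition conn :: "'a list \<Rightarrow> 'a list \<Rightarrow> bool" where
  "conn x y \<longleftrightarrow> (\<exists>a. wpath x a y)"

lemma conn_refl: "x \<in> W \<Longrightarrow> conn x x"
  unfolding conn_def by (intro exI[of _ "[]"]) simp

lemma conn_sym: "conn x y \<Longrightarrow> conn y x"
  unfolding conn_def using wpath_inv by blast

lemma conn_trans: "conn x y \<Longrightarrow> conn y z \<Longrightarrow> conn x z"
  unfolding conn_def using wpath_appendI by blast

text \<open>Connected words have the same predicate \<open>conn x\<close>, so the choice depends
  only on the component.\<close>

definition rep :: "'a list \<Rightarrow> 'a list" where
  "rep x = (SOME y. conn x y)"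

lemma conn_rep: "x \<in> W \<Longrightarrow> conn x (rep x)"
  unfolding rep_def using conn_refl by (rule someI)

lemma rep_eq: "conn x y \<Longrightarrow> rep x = rep y"
proof -
  assume "conn x y"
  then have "conn x = conn y" using conn_sym conn_trans by blast
  then show ?thesis by (simp add: rep_def)
qed

lemma rep_wpath: "wpath x a y \<Longrightarrow> rep y = rep x"
  using rep_eq[of x y] unfolding conn_def by metis

lemma rep_word: "x \<in> W \<Longrightarrow> rep x \<in> W"
  using conn_rep wpath_words unfolding conn_def by blast

lemma rep_rep: "x \<in> W \<Longrightarrow> rep (rep x) = rep x"
  using rep_eq[OF conn_rep] by simp

lemma rep_nil: "rep [] = []"
proof -
  have "a = []" if "wpath [] a y" for a y
    using that by (cases a) (auto dest: edge_words)
  then have "conn [] y \<Longrightarrow> y = []" for y unfolding conn_def by fastforce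
  then show ?thesis using conn_rep[of "[]"] by simp
qed

lemma conn_append_right: "conn x y \<Longrightarrow> s \<in> W \<Longrightarrow> conn (x @ s) (y @ s)"
  unfolding conn_def using wpath_rc by blast

lemma rep_rep_append: "x \<in> W \<Longrightarrow> y \<in> W \<Longrightarrow> rep (rep x @ y) = rep (x @ y)"
  using rep_eq[OF conn_append_right[OF conn_rep]] by simp

definition letter_path :: "'a list \<Rightarrow> 'a \<Rightarrow> 'a squier_edge list" where
  "letter_path s x = (SOME a. wpath (s @ [x]) a (rep (s @ [x])))"

lemma wpath_letter_path: "s @ [x] \<in> W \<Longrightarrow> wpath (s @ [x]) (letter_path s x) (rep (s @ [x]))"
  unfolding letter_path_def using conn_rep[of "s @ [x]"] unfolding conn_def by (rule someI_ex)

text \<open>Absorbing the letters of the word from left to right gives a spanning tree of each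
  component, in which the path for \<open>p @ s\<close> starts with the path for \<open>p\<close>, with \<open>s\<close> added on the right.\<close>

fun absorb :: "'a list \<Rightarrow> 'a list \<Rightarrow> 'a squier_edge list" where
  "absorb s [] = []"
| "absorb s (x # y) = rc (letter_path s x) y @ absorb (rep (s @ [x])) y"

lemma wpath_absorb:
  assumes "s \<in> W" "rep s = s" "y \<in> W"
  shows "wpath (s @ y) (absorb s y) (rep (s @ y))"
  using assms
proof (induction y arbitrary: s)
  case (Cons x y)
  have sx: "s @ [x] \<in> W" and y: "y \<in> W" using Cons.prems by auto
  have "wpath ((s @ [x]) @ y) (rc (letter_path s x) y) (rep (s @ [x]) @ y)"
    by (rule wpath_rc[OF wpath_letter_path[OF sx] y])
  moreover have "wpath (rep (s @ [x]) @ y) (absorb (rep (s @ [x])) y) (rep (rep (s @ [x]) @ y))"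
    by (rule Cons.IH[OF rep_word[OF sx] rep_rep[OF sx] y])
  ultimately have "wpath ((s @ [x]) @ y) (rc (letter_path s x) y @ absorb (rep (s @ [x])) y) (rep (rep (s @ [x]) @ y))"
    by (rule wpath_appendI)
  then show ?case using rep_rep_append[OF sx y] by simp
qed simp

lemma absorb_append:
  assumes "s \<in> W" "rep s = s" "y \<in> W"
  shows "absorb s (y @ z) = rc (absorb s y) z @ absorb (rep (s @ y)) z"
  using assms
proof (induction y arbitrary: s)
  case (Cons x y)
  have sx: "s @ [x] \<in> W" and y: "y \<in> W" using Cons.prems by auto
  show ?case using Cons.IH[OF rep_word[OF sx] rep_rep[OF sx] y] rep_rep_append[OF sx y] by simp
qed simp

definition tree :: "'a list \<Rightarrow> 'a squier_edge list" where
  "tree x = absorb [] x"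

lemma wpath_tree: "x \<in> W \<Longrightarrow> wpath x (tree x) (rep x)"
  using wpath_absorb[of "[]" x] rep_nil by (simp add: tree_def)

lemma tree_append: "x \<in> W \<Longrightarrow> tree (x @ y) = rc (tree x) y @ absorb (rep x) y"
  using absorb_append[of "[]" x y] rep_nil by (simp add: tree_def)

context
  fixes \<phi> :: "'a squier_edge list set \<Rightarrow> int"
  assumes \<phi>: "\<And>A B. A \<in> carrier DG \<Longrightarrow> B \<in> carrier DG \<Longrightarrow> \<phi> (A \<otimes>\<^bsub>DG\<^esub> B) = \<phi> A + \<phi> B"
begin

abbreviation "r \<equiv> rep w"

text \<open>\<open>\<phi>\<close> transported from \<open>w\<close> to \<open>r\<close>, the root of
  the spanning tree of its component.\<close>

definition \<psi> :: "'a squier_edge list \<Rightarrow> int" where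
  "\<psi> m = \<phi> (loop_class (tree w @ m @ path_inv (tree w)))"

lemma wtree: "wpath w (tree w) r" by (rule wpath_tree) simp

lemma r_ne: "r \<noteq> []" using wpath_nonempty[OF wtree] by simp

lemma \<psi>_hmt: "hmt r m m' \<Longrightarrow> wpath r m r \<Longrightarrow> \<psi> m = \<psi> m'"
  unfolding \<psi>_def using hmt_context[OF wtree _ _ wpath_inv[OF wtree]] loop_class_eq_iff[OF loop_conj[OF wtree]] by metis

lemma \<psi>_append:
  assumes m: "wpath r m r" "wpath r m' r"
  shows "\<psi> (m @ m') = \<psi> m + \<psi> m'"
proof -
  note i = wpath_inv[OF wtree]
  let ?t = "tree w"
  have l: "loop (?t @ m @ path_inv ?t)" "loop (?t @ m' @ path_inv ?t)" using loop_conj[OF wtree] m by auto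
  have "hmt w ((?t @ m) @ (path_inv ?t @ ?t) @ (m' @ path_inv ?t)) ((?t @ m) @ [] @ (m' @ path_inv ?t))"
    by (rule hmt_context[OF wpath_appendI[OF wtree m(1)] hmt_inv_left[OF _ wtree] wpath_appendI[OF i wtree]
        wpath_appendI[OF m(2) i]]) simp
  then have "loop_class ((?t @ m @ path_inv ?t) @ (?t @ m' @ path_inv ?t)) = loop_class (?t @ (m @ m') @ path_inv ?t)"
    using loop_class_eq_iff[OF loop_append[OF l]] by simp
  then have "\<psi> (m @ m') = \<phi> (loop_class (?t @ m @ path_inv ?t) \<otimes>\<^bsub>DG\<^esub> loop_class (?t @ m' @ path_inv ?t))"
    unfolding \<psi>_def mult_DG[OF l] by simp
  then show ?thesis using \<phi> l by (simp add: \<psi>_def)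
qed

lemma \<psi>_inv: "wpath r m r \<Longrightarrow> \<psi> (path_inv m) = - \<psi> m"
proof -
  assume m: "wpath r m r"
  have rW: "r \<in> W" by (rule rep_word) simp
  have "\<psi> [] = \<psi> [] + \<psi> []" using \<psi>_append[of "[]" "[]"] rW by simp
  moreover have "\<psi> (m @ path_inv m) = \<psi> []"
    by (rule \<psi>_hmt[OF hmt_inv_right[OF r_ne m] wpath_appendI[OF m wpath_inv[OF m]]])
  ultimately show ?thesis using \<psi>_append[OF m wpath_inv[OF m]] by simp
qed

text \<open>The value of the loop that closes \<open>e\<close> up along the tree. On a path the tree
  parts cancel between consecutive edges, so \<open>\<phi>\<close> becomes a sum over edges.\<close>

definition edge_val :: "'a squier_edge \<Rightarrow> int" where
  "edge_val e = \<psi> (path_inv (tree (edge_source e)) @ [e] @ tree (edge_target e))"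

lemma tree_loop:
  assumes "wpath x a y" "rep x = r"
  shows "wpath r (path_inv (tree x) @ a @ tree y) r"
proof -
  have "x \<in> W" "y \<in> W" using wpath_words assms by auto
  moreover have "rep y = r" using rep_wpath[OF assms(1)] assms(2) by simp
  ultimately show ?thesis
    using wpath_appendI[OF wpath_inv[OF wpath_tree] wpath_appendI[OF assms(1) wpath_tree]] assms(2) by metis
qed

lemma edge_val_inv:
  assumes "is_edge e" "rep (edge_source e) = r"
  shows "edge_val (squier_inv e) = - edge_val e"
  using \<psi>_inv[OF tree_loop[OF wpath_edge[OF assms(1)] assms(2)]] by (simp add: edge_val_def)

lemma path_val:
  assumes "wpath x a y" "rep x = r"
  shows "\<psi> (path_inv (tree x) @ a @ tree y) = sum_list (map edge_val a)"
  using assms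
proof (induction a arbitrary: x)
  case Nil
  then have x: "x \<in> W" "x = y" by auto
  have t: "wpath x (tree x) r" using wpath_tree[OF x(1)] Nil by simp
  have ne: "x \<noteq> []" using wpath_nonempty[OF t] r_ne by simp
  have "\<psi> (path_inv (tree x) @ tree x) = \<psi> []"
    by (rule \<psi>_hmt[OF hmt_inv_left[OF ne t] wpath_appendI[OF wpath_inv[OF t] t]])
  moreover have "\<psi> [] = 0" using \<psi>_append[of "[]" "[]"] rep_word[of w] by simp
  ultimately show ?case using x by simp
next
  case (Cons e a)
  let ?z = "edge_target e"
  have e: "is_edge e" "edge_source e = x" and a: "wpath ?z a y" using Cons.prems by auto
  have e1: "wpath x [e] ?z" using wpath_edge[OF e(1)] e(2) by simp
  have z: "rep ?z = r" using rep_wpath[OF e1] Cons.prems(2) by simp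
  have zW: "?z \<in> W" using edge_words[OF e(1)] by simp
  have tz: "wpath ?z (tree ?z) r" using wpath_tree[OF zW] z by simp
  have tx: "wpath x (tree x) r" using wpath_tree wpath_words[OF e1] Cons.prems(2) by metis
  have ty: "wpath y (tree y) r" using wpath_tree[of y] wpath_words[OF a] rep_wpath[OF a] z by simp
  have zne: "?z \<noteq> []" using edge_words[OF e(1)] by simp
  let ?l = "path_inv (tree x) @ [e]"
  have l: "wpath r ?l ?z" using wpath_appendI[OF wpath_inv[OF tx] e1] .
  have "hmt r (?l @ (tree ?z @ path_inv (tree ?z)) @ (a @ tree y)) (?l @ [] @ (a @ tree y))"
    by (rule hmt_context[OF l hmt_inv_right[OF zne tz] wpath_appendI[OF tz wpath_inv[OF tz]] wpath_appendI[OF a ty]])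
  then have h: "hmt r ((path_inv (tree x) @ [e] @ tree ?z) @ (path_inv (tree ?z) @ a @ tree y))
      (path_inv (tree x) @ (e # a) @ tree y)" by simp
  note lp = tree_loop[OF e1 Cons.prems(2)] tree_loop[OF a z]
  have "\<psi> (path_inv (tree x) @ (e # a) @ tree y)
      = \<psi> ((path_inv (tree x) @ [e] @ tree ?z) @ (path_inv (tree ?z) @ a @ tree y))"
    using \<psi>_hmt[OF h wpath_appendI[OF lp]] by simp
  also have "\<dots> = edge_val e + sum_list (map edge_val a)"
  proof -
    have "edge_val e = \<psi> (path_inv (tree x) @ [e] @ tree ?z)" by (simp add: edge_val_def e(2))
    then show ?thesis using \<psi>_append[OF lp] Cons.IH[OF a z] by simp
  qed
  finally show ?case by simp
qed

lemma loop_val: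
  assumes a: "loop a"
  shows "\<phi> (loop_class a) = sum_list (map edge_val a)"
proof -
  let ?t = "tree w"
  note i = wpath_inv[OF wtree]
  have "hmt w ((?t @ path_inv ?t) @ a @ (?t @ path_inv ?t)) ([] @ a @ [])"
    by (rule hmt_append[OF hmt_inv_right[OF _ wtree] wpath_appendI[OF wtree i]
        hmt_left[OF a hmt_inv_right[OF _ wtree]]]) auto
  then have "hmt w a (?t @ (path_inv ?t @ a @ ?t) @ path_inv ?t)" by (simp add: hmt_sym)
  then have "\<phi> (loop_class a) = \<psi> (path_inv ?t @ a @ ?t)"
    unfolding \<psi>_def using loop_class_eq_iff[OF a] by metis
  then show ?thesis using path_val[OF a] by simp
qed

text \<open>\<open>m\<close> and \<open>m'\<close> are freely homotopic along \<open>z\<close>, so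
  the two loops at \<open>r\<close> are conjugate, and conjugates have equal values in the
  integers.\<close>

lemma conj_val:
  assumes t: "wpath x t r" and t': "wpath x' t' r" and m: "wpath x m x" and m': "wpath x' m' x'"
    and z: "wpath x z x'" and h: "hmt x (m @ z) (z @ m')"
  shows "\<psi> (path_inv t @ m @ t) = \<psi> (path_inv t' @ m' @ t')"
proof -
  have x: "x \<noteq> []" "x' \<noteq> []" using wpath_nonempty[OF t] wpath_nonempty[OF t'] r_ne by auto
  note i = wpath_inv[OF t] and i' = wpath_inv[OF t']
  let ?z = "path_inv t @ z @ t'"
  have lz: "wpath r ?z r" by (rule wpath_appendI[OF i wpath_appendI[OF z t']])
  have lm: "wpath r (path_inv t @ m @ t) r" by (rule wpath_appendI[OF i wpath_appendI[OF m t]])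
  have lm': "wpath r (path_inv t' @ m' @ t') r" by (rule wpath_appendI[OF i' wpath_appendI[OF m' t']])
  have "hmt r ((path_inv t @ m) @ (t @ path_inv t) @ (z @ t')) ((path_inv t @ m) @ [] @ (z @ t'))"
    by (rule hmt_context[OF wpath_appendI[OF i m] hmt_inv_right[OF x(1) t] wpath_appendI[OF t i] wpath_appendI[OF z t']])
  then have 1: "hmt r ((path_inv t @ m @ t) @ ?z) (path_inv t @ (m @ z) @ t')" by simp
  have 2: "hmt r (path_inv t @ (m @ z) @ t') (path_inv t @ (z @ m') @ t')"
    by (rule hmt_context[OF i h wpath_appendI[OF m z] t'])
  have "hmt r ((path_inv t @ z) @ (t' @ path_inv t') @ (m' @ t')) ((path_inv t @ z) @ [] @ (m' @ t'))"
    by (rule hmt_context[OF wpath_appendI[OF i z] hmt_inv_right[OF x(2) t'] wpath_appendI[OF t' i'] wpath_appendI[OF m' t']])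
  then have 3: "hmt r (?z @ (path_inv t' @ m' @ t')) (path_inv t @ (z @ m') @ t')" by simp
  have "hmt r ((path_inv t @ m @ t) @ ?z) (?z @ (path_inv t' @ m' @ t'))"
    using 1 2 3 hmt_trans hmt_sym by blast
  then have "\<psi> ((path_inv t @ m @ t) @ ?z) = \<psi> (?z @ (path_inv t' @ m' @ t'))"
    using \<psi>_hmt wpath_appendI[OF lm lz] by blast
  then show ?thesis using \<psi>_append[OF lm lz] \<psi>_append[OF lz lm'] by simp
qed

text \<open>The path of the tree for \<open>p\<close> commutes with the edge, so only its end \<open>rep p\<close> matters.\<close>

lemma edge_val_eq:
  assumes e: "is_edge (p, u, v, q)" and c: "rep (p @ u @ q) = r"
  shows "edge_val (p, u, v, q) = \<psi> (path_inv (absorb (rep (rep p @ u)) q) @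
    rc (path_inv (absorb (rep p) u) @ [(rep p, u, v, [])] @ absorb (rep p) v) q @ absorb (rep (rep p @ u)) q)"
proof -
  let ?s = "rep p" and ?t = "rep (rep p @ u)"
  have ws: "p \<in> W" "q \<in> W" "u \<in> W" "v \<in> W" "u \<noteq> []" "v \<noteq> []" "rule u v" using e rule_words by auto
  have s: "?s \<in> W" "rep ?s = ?s" using ws rep_word rep_rep by auto
  have "conn (?s @ u) (?s @ v)" unfolding conn_def
    by (intro exI[of _ "[(?s, u, v, [])]"]) (use s ws in simp)
  then have tv: "rep (?s @ v) = ?t" using rep_eq by simp
  have tW: "?t \<in> W" "rep ?t = ?t" using s ws rep_word[of "?s @ u"] rep_rep[of "?s @ u"] by auto
  have tr: "rep (?t @ q) = r"
    using rep_rep_append[of "?s @ u" q] rep_rep_append[of p "u @ q"] s ws c by simp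
  have tree_eq: "tree (p @ x @ q) = rc (tree p) (x @ q) @ rc (absorb ?s x) q @ absorb (rep (?s @ x)) q"
    if "x \<in> W" for x
    using tree_append[of p "x @ q"] absorb_append[OF s that] ws by simp
  have P1: "wpath (p @ x @ q) (rc (tree p) (x @ q)) (?s @ x @ q)" if "x \<in> W" for x
    using wpath_rc[OF wpath_tree[OF ws(1)], of "x @ q"] that ws by simp
  have P2: "wpath (?s @ x @ q) (rc (absorb ?s x) q) (rep (?s @ x) @ q)" if "x \<in> W" for x
    using wpath_rc[OF wpath_absorb[OF s that] ws(2)] by simp
  have P3: "wpath (?t @ q) (absorb ?t q) r" using wpath_absorb[OF tW ws(2)] tr by simp
  let ?A = "absorb ?t q" and ?cu = "rc (tree p) (u @ q)" and ?cv = "rc (tree p) (v @ q)"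
  have ed: "wpath (p @ u @ q) [(p, u, v, q)] (p @ v @ q)" "wpath (?s @ u @ q) [(?s, u, v, q)] (?s @ v @ q)"
    using e ws s by auto
  have ne: "p @ u @ q \<noteq> []" using ws by simp
  \<comment> \<open>The edge commutes with the tree path of its prefix, so conjugation by that path
    only replaces \<open>p\<close> by its representative.\<close>
  have slide: "hmt (?s @ u @ q) (path_inv ?cu @ [(p, u, v, q)] @ ?cv) [(?s, u, v, q)]"
  proof -
    have uv: "wpath (u @ q) [([], u, v, q)] (v @ q)" using ws by simp
    have ex: "hmt (p @ u @ q) (?cu @ [(?s, u, v, q)]) ([(p, u, v, q)] @ ?cv)"
      using exchange[OF wpath_tree[OF ws(1)] uv] ws by simp
    have "hmt (?s @ u @ q) (path_inv ?cu @ ([(p, u, v, q)] @ ?cv)) (path_inv ?cu @ (?cu @ [(?s, u, v, q)]))"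
      by (rule hmt_left[OF wpath_inv[OF P1[OF ws(3)]] hmt_sym[OF ex]])
    also have "path_inv ?cu @ (?cu @ [(?s, u, v, q)]) = (path_inv ?cu @ ?cu) @ [(?s, u, v, q)]" by simp
    also have "hmt (?s @ u @ q) \<dots> ([] @ [(?s, u, v, q)])"
      by (rule hmt_right[OF hmt_inv_left[OF ne P1[OF ws(3)]]
          wpath_appendI[OF wpath_inv[OF P1[OF ws(3)]] P1[OF ws(3)]] ed(2)])
    finally show ?thesis by simp
  qed
  let ?l = "path_inv ?A @ path_inv (rc (absorb ?s u) q)" and ?rr = "rc (absorb ?s v) q @ ?A"
  have L: "wpath r ?l (?s @ u @ q)" by (rule wpath_appendI[OF wpath_inv[OF P3] wpath_inv[OF P2[OF ws(3)]]])
  have R: "wpath (?s @ v @ q) ?rr r" by (rule wpath_appendI[OF P2[OF ws(4), unfolded tv] P3])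
  have M: "wpath (?s @ u @ q) (path_inv ?cu @ [(p, u, v, q)] @ ?cv) (?s @ v @ q)"
    by (intro wpath_appendI[OF wpath_inv[OF P1[OF ws(3)]]] wpath_appendI[OF ed(1)] P1[OF ws(4)])
  have h: "hmt r (?l @ (path_inv ?cu @ [(p, u, v, q)] @ ?cv) @ ?rr) (?l @ [(?s, u, v, q)] @ ?rr)"
    by (rule hmt_context[OF L slide M R])
  have "edge_val (p, u, v, q) = \<psi> (?l @ (path_inv ?cu @ [(p, u, v, q)] @ ?cv) @ ?rr)"
    using tree_eq[OF ws(3)] tree_eq[OF ws(4)] tv by (simp add: edge_val_def)
  also have "\<dots> = \<psi> (?l @ [(?s, u, v, q)] @ ?rr)"
    using \<psi>_hmt[OF h] wpath_appendI[OF L wpath_appendI[OF M R]] by simp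
  finally show ?thesis by (simp add: rc_path_inv)
qed

text \<open>By \<open>edge_val_eq\<close> only \<open>rep p\<close> and \<open>q\<close> matter.
  Moving the prefix keeps \<open>rep p\<close>; moving the suffix along \<open>\<rho>\<close> gives
  a freely homotopic loop, because the rewriting takes place left of the suffix, and
  \<open>conj_val\<close> applies.\<close>

lemma edge_val_parallel:
  assumes "parallel z z'"
  shows "edge_val (snd z) = edge_val (snd z')"
  using assms
proof cases
  case (1 u v \<delta> p q \<pi> p' \<rho> q' \<delta>')
  have ws: "p \<in> W" "q \<in> W" "p' \<in> W" "q' \<in> W" "u \<in> W" "v \<in> W" "u \<noteq> []" "v \<noteq> []"
    using 1 rule_words wpath_words by blast+
  have \<delta>': "wpath w \<delta>' (p' @ u @ q')" using parallel_lifted[OF assms] 1 by simp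
  have c: "rep (p @ u @ q) = r" "rep (p' @ u @ q') = r"
    using rep_wpath[OF 1(4)] rep_wpath[OF \<delta>'] by auto
  have pp: "rep p' = rep p" using rep_wpath[OF 1(5)] by simp
  let ?s = "rep p" and ?t = "rep (rep p @ u)"
  let ?m = "path_inv (absorb ?s u) @ [(?s, u, v, [])] @ absorb ?s v"
  have s: "?s \<in> W" "rep ?s = ?s" using ws rep_word rep_rep by auto
  have e1: "wpath (?s @ u) [(?s, u, v, [])] (?s @ v)" using s ws 1(3) by simp
  then have tv: "rep (?s @ v) = ?t" by (rule rep_wpath)
  have tW: "?t \<in> W" "rep ?t = ?t" using s ws rep_word[of "?s @ u"] rep_rep[of "?s @ u"] by auto
  have m: "wpath ?t ?m ?t"
    by (rule wpath_appendI[OF wpath_inv[OF wpath_absorb[OF s ws(5)]] wpath_appendI[OF e1 wpath_absorb[OF s ws(6), unfolded tv]]])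
  have tr: "rep (?t @ q) = r"
    using rep_rep_append[of "?s @ u" q] rep_rep_append[of p "u @ q"] s ws c by simp
  have tr': "rep (?t @ q') = r"
    using rep_rep_append[of "?s @ u" q'] rep_rep_append[of p' "u @ q'"] s ws c pp by simp
  have A: "wpath (?t @ q) (absorb ?t q) r" "wpath (?t @ q') (absorb ?t q') r"
    using wpath_absorb[OF tW ws(2)] wpath_absorb[OF tW ws(4)] tr tr' by auto
  have ne: "?t @ q \<noteq> []" using wpath_nonempty[OF A(1)] r_ne by simp
  have "\<psi> (path_inv (absorb ?t q) @ rc ?m q @ absorb ?t q) = \<psi> (path_inv (absorb ?t q') @ rc ?m q' @ absorb ?t q')"
    by (rule conj_val[OF A wpath_rc[OF m ws(2)] wpath_rc[OF m ws(4)] wpath_lc[OF 1(6) tW(1)] exchange[OF m 1(6) ne]])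
  then show ?thesis
    using edge_val_eq[of p u v q] edge_val_eq[of p' u v q'] c ws 1 pp by simp
qed

lemma hyp_sum_single:
  assumes "K0 \<in> hyps"
  shows "finite {K \<in> hyps. F K * of_bool (K = K0) \<noteq> (0::int)}" "sum' (\<lambda>K. F K * of_bool (K = K0)) hyps = F K0"
proof -
  show "finite {K \<in> hyps. F K * of_bool (K = K0) \<noteq> (0::int)}" by (rule finite_subset[of _ "{K0}"]) auto
  have "sum' (\<lambda>K. F K * of_bool (K = K0)) hyps = sum (\<lambda>K. F K * of_bool (K = K0)) {K0}"
    by (rule sum'_eq_sum_superset) (use assms in auto)
  then show "sum' (\<lambda>K. F K * of_bool (K = K0)) hyps = F K0" by simp
qed

text \<open>Each edge counts positively for its own hyperplane and negatively for the reversed one,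
  whose value is the negative; hence the factor 2.\<close>

lemma crossings_sum:
  assumes F: "\<And>z. lifted z \<Longrightarrow> F (hyp z) = edge_val (snd z)"
    and "wpath w \<delta> x" "wpath x a y"
  shows "sum' (\<lambda>K. F K * crossings \<delta> a K) hyps = 2 * sum_list (map edge_val a)"
  using assms(2,3)
proof (induction a arbitrary: \<delta> x)
  case Nil
  show ?case by (simp add: sum.G_def)
next
  case (Cons e a)
  have l: "lifted (\<delta>, e)" using Cons.prems by (auto simp: lifted_def)
  note l' = lifted_inv[OF l]
  have d: "wpath w (\<delta> @ [e]) (edge_target e)" using l wpath_appendI[OF _ wpath_edge] by (simp add: lifted_def)
  have a: "wpath (edge_target e) a y" using Cons.prems by simp
  have fin: "finite {K \<in> hyps. F K * crossings (\<delta> @ [e]) a K \<noteq> 0}"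
    by (rule finite_subset[OF _ finite_crossings[OF d a]]) auto
  note s1 = hyp_sum_single[OF hyp_in[OF l], of F] and s2 = hyp_sum_single[OF hyp_in[OF l'], of F]
  have r: "rep (edge_source e) = r" "is_edge e"
    using l rep_wpath[of w \<delta> "edge_source e"] by (auto simp: lifted_def)
  have fin12: "finite {K \<in> hyps. F K * of_bool (K = hyp (\<delta>, e)) - F K * of_bool (K = hyp (\<delta> @ [e], squier_inv e)) \<noteq> 0}"
    by (rule finite_subset[OF _ finite_UnI[OF s1(1) s2(1)]]) auto
  have "sum' (\<lambda>K. F K * crossings \<delta> (e # a) K) hyps = sum' (\<lambda>K. (F K * of_bool (K = hyp (\<delta>, e))
      - F K * of_bool (K = hyp (\<delta> @ [e], squier_inv e))) + F K * crossings (\<delta> @ [e]) a K) hyps"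
    by (rule sum.cong') (simp_all only: crossings.simps algebra_simps)
  also have "\<dots> = sum' (\<lambda>K. F K * of_bool (K = hyp (\<delta>, e)) - F K * of_bool (K = hyp (\<delta> @ [e], squier_inv e))) hyps
      + sum' (\<lambda>K. F K * crossings (\<delta> @ [e]) a K) hyps"
    by (rule sum.distrib'[OF fin12 fin])
  also have "\<dots> = F (hyp (\<delta>, e)) - F (hyp (\<delta> @ [e], squier_inv e)) + 2 * sum_list (map edge_val a)"
    using sum'_minus[OF s1(1) s2(1)] s1(2) s2(2) Cons.IH[OF d a] by simp
  also have "\<dots> = 2 * sum_list (map edge_val (e # a))"
    using F[OF l] F[OF l'] edge_val_inv[OF r(2,1)] by simp
  finally show ?case .
qed

text \<open>\<open>F\<close> gives a hyperplane the common value of its edges. It is invariant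
  because translating a lift changes the path to it but not the edge.\<close>

lemma hom_crossings:
  "\<exists>F. (\<forall>\<gamma> K. loop \<gamma> \<longrightarrow> K \<in> hyps \<longrightarrow> F (hact (loop_class \<gamma>) K) = F K) \<and>
    (\<forall>\<gamma>. loop \<gamma> \<longrightarrow> 2 * \<phi> (loop_class \<gamma>) = sum' (\<lambda>K. F K * crossings [] \<gamma> K) hyps)"
proof -
  define F where "F K = edge_val (snd (SOME z. z \<in> K))" for K :: "('a squier_edge list \<times> 'a squier_edge) set"
  have F: "F (hyp z) = edge_val (snd z)" if "lifted z" for z
  proof -
    have "z \<in> hyp z" using parallel_refl[OF that] by (simp add: hyp_def)
    then have "(SOME z'. z' \<in> hyp z) \<in> hyp z" by (rule someI)
    then have "parallel z (SOME z'. z' \<in> hyp z)" by (simp add: hyp_def)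
    then show ?thesis unfolding F_def by (rule edge_val_parallel[symmetric])
  qed
  have "F (hact (loop_class \<gamma>) K) = F K" if g: "loop \<gamma>" and K: "K \<in> hyps" for \<gamma> K
  proof -
    obtain \<delta> p u v q where K': "K = hyp (\<delta>, p, u, v, q)" "lifted (\<delta>, p, u, v, q)" using K by (rule hypsE)
    show ?thesis unfolding K'(1) hact_hyp[OF g K'(2)]
      using F[OF K'(2)] F[OF lifted_translate[OF g K'(2)]] by simp
  qed
  moreover have "2 * \<phi> (loop_class \<gamma>) = sum' (\<lambda>K. F K * crossings [] \<gamma> K) hyps" if "loop \<gamma>" for \<gamma>
    using crossings_sum[of F "[]" w \<gamma> w] F that loop_val by simp
  ultimately show ?thesis by blast
qed

end

section \<open>Diagram groups act on a hyperplane system\<close>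

definition class_crossings :: "'a squier_edge list set \<Rightarrow> ('a squier_edge list \<times> 'a squier_edge) set \<Rightarrow> int" where
  "class_crossings A K = crossings [] (SOME \<gamma>. \<gamma> \<in> A) K"

lemma class_crossings_loop:
  assumes "loop \<gamma>"
  shows "class_crossings (loop_class \<gamma>) K = crossings [] \<gamma> K"
proof -
  have "\<gamma> \<in> loop_class \<gamma>" using hmt_refl[OF _ assms] by (simp add: loop_class_def)
  then have "(SOME \<gamma>'. \<gamma>' \<in> loop_class \<gamma>) \<in> loop_class \<gamma>" by (rule someI)
  then have "hmt w \<gamma> (SOME \<gamma>'. \<gamma>' \<in> loop_class \<gamma>)" by (simp add: loop_class_def)
  then show ?thesis unfolding class_crossings_def by (intro crossings_hmt[symmetric]) auto
qed

lemma hact_closed: "A \<in> carrier DG \<Longrightarrow> K \<in> hyps \<Longrightarrow> hact A K \<in> hyps"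
proof -
  assume A: "A \<in> carrier DG" and K: "K \<in> hyps"
  obtain \<gamma> where g: "loop \<gamma>" "A = loop_class \<gamma>" using A by (auto simp: carrier_DG)
  obtain \<delta> p u v q where K': "K = hyp (\<delta>, p, u, v, q)" "lifted (\<delta>, p, u, v, q)" using K by (rule hypsE)
  show ?thesis unfolding g K'(1) hact_hyp[OF g(1) K'(2)] by (rule hyp_in[OF lifted_translate[OF g(1) K'(2)]])
qed

text \<open>The geometric source of the second summand in the cocycle rule: a path lifted after the
  loop \<open>\<gamma>\<close> crosses the translates of what it crosses without it.\<close>

lemma crossings_shift:
  assumes g: "loop \<gamma>" and K: "K \<in> hyps" and a: "wpath w \<delta> x" "wpath x a y"
  shows "crossings (\<gamma> @ \<delta>) a K = crossings \<delta> a (hact (inv\<^bsub>DG\<^esub> (loop_class \<gamma>)) K)"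
proof -
  obtain \<delta>' p u v q where K': "K = hyp (\<delta>', p, u, v, q)" "lifted (\<delta>', p, u, v, q)" using K by (rule hypsE)
  note i = wpath_inv[OF g]
  have L: "hact (inv\<^bsub>DG\<^esub> (loop_class \<gamma>)) K = hyp (path_inv \<gamma> @ \<delta>', p, u, v, q)"
    unfolding inv_DG[OF g] K'(1) by (rule hact_hyp[OF i K'(2)])
  note l = lifted_translate[OF i K'(2)]
  have "hact (loop_class \<gamma>) (hyp (path_inv \<gamma> @ \<delta>', p, u, v, q)) = hyp (\<gamma> @ path_inv \<gamma> @ \<delta>', p, u, v, q)"
    by (rule hact_hyp[OF g l])
  also have "\<dots> = K" unfolding K'(1)
  proof (rule hyp_hmt[OF lifted_translate[OF g l]])
    show "hmt w (\<gamma> @ path_inv \<gamma> @ \<delta>') \<delta>'"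
      using hmt_right[OF hmt_inv_right[OF _ g] loop_append[OF g i], of \<delta>' "p @ u @ q"] K'(2) by simp
  qed
  finally show ?thesis using crossings_translate[OF g _ a, of "hact (inv\<^bsub>DG\<^esub> (loop_class \<gamma>)) K"] L hyp_in[OF l] by simp
qed

lemma hyperplane_system_DG:
  "hyperplane_system DG hyps hact class_crossings left_of left_stab right_stab"
proof unfold_locales
  fix A K assume "A \<in> carrier DG" "K \<in> hyps"
  then show "hact A K \<in> hyps" by (rule hact_closed)
next
  fix K assume "K \<in> hyps"
  then obtain \<delta> p u v q where K': "K = hyp (\<delta>, p, u, v, q)" "lifted (\<delta>, p, u, v, q)" by (rule hypsE)
  show "hact \<one>\<^bsub>DG\<^esub> K = K" unfolding one_DG K'(1) using hact_hyp[of "[]", OF _ K'(2)] by simp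
next
  fix A B K assume A: "A \<in> carrier DG" and B: "B \<in> carrier DG" and K: "K \<in> hyps"
  obtain a b where ab: "loop a" "A = loop_class a" "loop b" "B = loop_class b" using A B by (auto simp: carrier_DG)
  obtain \<delta> p u v q where K': "K = hyp (\<delta>, p, u, v, q)" "lifted (\<delta>, p, u, v, q)" using K by (rule hypsE)
  show "hact (A \<otimes>\<^bsub>DG\<^esub> B) K = hact A (hact B K)"
    unfolding ab K'(1) mult_DG[OF ab(1,3)] hact_hyp[OF ab(3) K'(2)] hact_hyp[OF ab(1) lifted_translate[OF ab(3) K'(2)]]
      hact_hyp[OF loop_append[OF ab(1,3)] K'(2)] by simp
  have "crossings (a @ []) b K = crossings [] b (hact (inv\<^bsub>DG\<^esub> A) K)"
    unfolding ab(2) by (rule crossings_shift[OF ab(1) K _ ab(3)]) simp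
  then show "class_crossings (A \<otimes>\<^bsub>DG\<^esub> B) K = class_crossings A K + class_crossings B (hact (inv\<^bsub>DG\<^esub> A) K)"
    using ab by (simp add: mult_DG class_crossings_loop loop_append crossings_append)
next
  fix A assume "A \<in> carrier DG"
  then obtain \<gamma> where g: "loop \<gamma>" "A = loop_class \<gamma>" by (auto simp: carrier_DG)
  have "finite {K. crossings [] \<gamma> K \<noteq> 0}" by (rule finite_crossings[OF _ g(1)]) simp
  then show "finite {K \<in> hyps. class_crossings A K \<noteq> 0}"
    by (rule finite_subset[rotated]) (auto simp: g class_crossings_loop)
next
  fix K L assume "left_of K L" then show "\<not> left_of L K" by (rule left_of_asym)
next
  fix A K L assume "A \<in> carrier DG" "left_of K L" then show "left_of (hact A K) (hact A L)" by (rule left_of_act)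
next
  fix K l assume K: "K \<in> hyps" and l: "l \<in> left_stab K"
  obtain \<delta> p u v q where K': "K = hyp (\<delta>, p, u, v, q)" "lifted (\<delta>, p, u, v, q)" using K by (rule hypsE)
  have d: "wpath w \<delta> (p @ u @ q)" "u \<in> W" "q \<in> W" "rule u v" using K' rule_words by auto
  obtain \<pi> where l': "l = loop_class (\<delta> @ rc \<pi> (u @ q) @ path_inv \<delta>)" "wpath p \<pi> p"
    using l stab_hyp[OF K'(2)] K' by auto
  have m: "wpath (p @ u @ q) (rc \<pi> (u @ q)) (p @ u @ q)" using wpath_rc[OF l'(2), of "u @ q"] d by simp
  note lp = loop_conj[OF d(1) m]
  have "hact l K = hyp ((\<delta> @ rc \<pi> (u @ q) @ path_inv \<delta>) @ \<delta>, p, u, v, q)"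
    unfolding l' K'(1) by (rule hact_hyp[OF lp K'(2)])
  also have "\<dots> = hyp (\<delta> @ rc \<pi> (u @ q), p, u, v, q)"
  proof (rule hyp_hmt[OF lifted_translate[OF lp K'(2)]])
    show "hmt w ((\<delta> @ rc \<pi> (u @ q) @ path_inv \<delta>) @ \<delta>) (\<delta> @ rc \<pi> (u @ q))"
      using hmt_left[OF wpath_appendI[OF d(1) m] hmt_inv_left[OF _ d(1)]] by simp
  qed
  also have "\<dots> = K" unfolding K'(1) by (rule hyp_rc[OF d(4,1) l'(2)])
  finally show "l \<in> carrier DG \<and> hact l K = K" using lp l' by simp
next
  fix K r assume K: "K \<in> hyps" and r: "r \<in> right_stab K"
  obtain \<delta> p u v q where K': "K = hyp (\<delta>, p, u, v, q)" "lifted (\<delta>, p, u, v, q)" using K by (rule hypsE)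
  have d: "wpath w \<delta> (p @ u @ q)" "u \<in> W" "q \<in> W" "p \<in> W" "rule u v" using K' rule_words by auto
  obtain \<rho> where r': "r = loop_class (\<delta> @ lc (p @ u) \<rho> @ path_inv \<delta>)" "wpath q \<rho> q"
    using r stab_hyp[OF K'(2)] K' by auto
  have m: "wpath (p @ u @ q) (lc (p @ u) \<rho>) (p @ u @ q)" using wpath_lc[OF r'(2), of "p @ u"] d by simp
  note lp = loop_conj[OF d(1) m]
  have "hact r K = hyp ((\<delta> @ lc (p @ u) \<rho> @ path_inv \<delta>) @ \<delta>, p, u, v, q)"
    unfolding r' K'(1) by (rule hact_hyp[OF lp K'(2)])
  also have "\<dots> = hyp (\<delta> @ lc (p @ u) \<rho>, p, u, v, q)"
  proof (rule hyp_hmt[OF lifted_translate[OF lp K'(2)]])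
    show "hmt w ((\<delta> @ lc (p @ u) \<rho> @ path_inv \<delta>) @ \<delta>) (\<delta> @ lc (p @ u) \<rho>)"
      using hmt_left[OF wpath_appendI[OF d(1) m] hmt_inv_left[OF _ d(1)]] by simp
  qed
  also have "\<dots> = K" unfolding K'(1) by (rule hyp_lc[OF d(5,1) r'(2)])
  finally show "r \<in> carrier DG \<and> hact r K = K" using lp r' by simp
next
  fix K l r assume K: "K \<in> hyps" and l: "l \<in> left_stab K" and r: "r \<in> right_stab K"
  obtain \<delta> p u v q where K': "K = hyp (\<delta>, p, u, v, q)" "lifted (\<delta>, p, u, v, q)" using K by (rule hypsE)
  have d: "wpath w \<delta> (p @ u @ q)" "u \<in> W" "u \<noteq> []" "q \<in> W" "p \<in> W" "rule u v" using K' rule_words by auto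
  obtain \<pi> where l': "l = loop_class (\<delta> @ rc \<pi> (u @ q) @ path_inv \<delta>)" "wpath p \<pi> p"
    using l stab_hyp[OF K'(2)] K' by auto
  obtain \<rho> where r': "r = loop_class (\<delta> @ lc (p @ u) \<rho> @ path_inv \<delta>)" "wpath q \<rho> q"
    using r stab_hyp[OF K'(2)] K' by auto
  have ml: "wpath (p @ u @ q) (rc \<pi> (u @ q)) (p @ u @ q)" using wpath_rc[OF l'(2), of "u @ q"] d by simp
  have mr: "wpath (p @ u @ q) (lc (p @ u) \<rho>) (p @ u @ q)" using wpath_lc[OF r'(2), of "p @ u"] d by simp
  note ll = loop_conj[OF d(1) ml] and lr = loop_conj[OF d(1) mr]
  have cut: "hmt w ((\<delta> @ m @ path_inv \<delta>) @ (\<delta> @ m' @ path_inv \<delta>)) (\<delta> @ (m @ m') @ path_inv \<delta>)"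
    if "wpath (p @ u @ q) m (p @ u @ q)" "wpath (p @ u @ q) m' (p @ u @ q)" for m m'
    using hmt_context[OF wpath_appendI[OF d(1) that(1)] hmt_inv_left[OF _ d(1)] wpath_appendI[OF wpath_inv[OF d(1)] d(1)]
        wpath_appendI[OF that(2) wpath_inv[OF d(1)]]] by simp
  have "hmt w (\<delta> @ (rc \<pi> (u @ q) @ lc (p @ u) \<rho>) @ path_inv \<delta>) (\<delta> @ (lc (p @ u) \<rho> @ rc \<pi> (u @ q)) @ path_inv \<delta>)"
    by (rule hmt_context[OF d(1) rc_lc_exchange[OF d(2,3) l'(2) r'(2)] wpath_appendI[OF ml mr] wpath_inv[OF d(1)]])
  then have "hmt w ((\<delta> @ rc \<pi> (u @ q) @ path_inv \<delta>) @ (\<delta> @ lc (p @ u) \<rho> @ path_inv \<delta>))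
      ((\<delta> @ lc (p @ u) \<rho> @ path_inv \<delta>) @ (\<delta> @ rc \<pi> (u @ q) @ path_inv \<delta>))"
    using cut[OF ml mr] cut[OF mr ml] hmt_trans hmt_sym by blast
  then show "l \<otimes>\<^bsub>DG\<^esub> r = r \<otimes>\<^bsub>DG\<^esub> l"
    unfolding l'(1) r'(1) mult_DG[OF ll lr] mult_DG[OF lr ll] using loop_class_eq_iff[OF loop_append[OF ll lr]] by blast
next
  fix K A assume K: "K \<in> hyps" and A: "A \<in> carrier DG" and fixed: "hact A K = K"
  obtain \<gamma> where g: "loop \<gamma>" "A = loop_class \<gamma>" using A by (auto simp: carrier_DG)
  obtain \<delta> p u v q where K': "K = hyp (\<delta>, p, u, v, q)" "lifted (\<delta>, p, u, v, q)" using K by (rule hypsE)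
  have d: "wpath w \<delta> (p @ u @ q)" "u \<in> W" "u \<noteq> []" "q \<in> W" "p \<in> W" "rule u v" using K' rule_words by auto
  \<comment> \<open>An element fixing the hyperplane carries a lift to a parallel lift over the same
    edge, so the paths \<open>\<pi>\<close> and \<open>\<rho>\<close> of this parallelism are loops;
    they are the left and the right factor.\<close>
  have "hyp (\<delta>, p, u, v, q) = hyp (\<gamma> @ \<delta>, p, u, v, q)"
    using fixed hact_hyp[OF g(1) K'(2)] by (simp add: g K')
  then have "parallel (\<delta>, p, u, v, q) (\<gamma> @ \<delta>, p, u, v, q)" using hyp_eq_iff[OF K'(2)] by simp
  then obtain \<pi> \<rho> where j: "wpath p \<pi> p" "wpath q \<rho> q" "hmt w (\<gamma> @ \<delta>) (\<delta> @ slide u q p \<pi> \<rho>)"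
    by (cases rule: parallel.cases) auto
  have ml: "wpath (p @ u @ q) (rc \<pi> (u @ q)) (p @ u @ q)" using wpath_rc[OF j(1), of "u @ q"] d by simp
  have mr: "wpath (p @ u @ q) (lc (p @ u) \<rho>) (p @ u @ q)" using wpath_lc[OF j(2), of "p @ u"] d by simp
  note ll = loop_conj[OF d(1) ml] and lr = loop_conj[OF d(1) mr]
  have gd: "wpath w (\<gamma> @ \<delta>) (p @ u @ q)" using wpath_appendI[OF g(1) d(1)] .
  have "hmt w (\<gamma> @ (\<delta> @ path_inv \<delta>)) (\<gamma> @ [])" by (rule hmt_left[OF g(1) hmt_inv_right[OF _ d(1)]]) simp
  then have "hmt w \<gamma> ((\<gamma> @ \<delta>) @ path_inv \<delta>)" by (simp add: hmt_sym)
  also have "hmt w \<dots> ((\<delta> @ slide u q p \<pi> \<rho>) @ path_inv \<delta>)" by (rule hmt_right[OF j(3) gd wpath_inv[OF d(1)]])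
  also have "(\<delta> @ slide u q p \<pi> \<rho>) @ path_inv \<delta> = (\<delta> @ rc \<pi> (u @ q)) @ [] @ (lc (p @ u) \<rho> @ path_inv \<delta>)"
    by (simp add: slide_def)
  also have "hmt w \<dots> ((\<delta> @ rc \<pi> (u @ q)) @ (path_inv \<delta> @ \<delta>) @ (lc (p @ u) \<rho> @ path_inv \<delta>))"
    using hmt_sym[OF hmt_context[OF wpath_appendI[OF d(1) ml] hmt_inv_left[OF _ d(1)]
        wpath_appendI[OF wpath_inv[OF d(1)] d(1)] wpath_appendI[OF mr wpath_inv[OF d(1)]]]] by simp
  finally have "A = loop_class (\<delta> @ rc \<pi> (u @ q) @ path_inv \<delta>) \<otimes>\<^bsub>DG\<^esub> loop_class (\<delta> @ lc (p @ u) \<rho> @ path_inv \<delta>)"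
    unfolding g(2) mult_DG[OF ll lr] using loop_class_eq_iff[OF g(1)] by simp
  then show "\<exists>l\<in>left_stab K. \<exists>r\<in>right_stab K. A = l \<otimes>\<^bsub>DG\<^esub> r"
    unfolding K'(1) stab_hyp[OF K'(2)] using j by auto
next
  fix K A l assume K: "K \<in> hyps" and A: "A \<in> carrier DG" and l: "l \<in> left_stab K"
  obtain \<gamma> where g: "loop \<gamma>" "A = loop_class \<gamma>" using A by (auto simp: carrier_DG)
  obtain \<delta> p u v q where K': "K = hyp (\<delta>, p, u, v, q)" "lifted (\<delta>, p, u, v, q)" using K by (rule hypsE)
  have d: "wpath w \<delta> (p @ u @ q)" "u \<in> W" "q \<in> W" using K' rule_words by auto
  obtain \<pi> where l': "l = loop_class (\<delta> @ rc \<pi> (u @ q) @ path_inv \<delta>)" "wpath p \<pi> p"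
    using l stab_hyp[OF K'(2)] K' by auto
  have m: "wpath (p @ u @ q) (rc \<pi> (u @ q)) (p @ u @ q)" using wpath_rc[OF l'(2), of "u @ q"] d by simp
  note lp = loop_conj[OF d(1) m]
  have "A \<otimes>\<^bsub>DG\<^esub> l \<otimes>\<^bsub>DG\<^esub> inv\<^bsub>DG\<^esub> A = loop_class ((\<gamma> @ \<delta>) @ rc \<pi> (u @ q) @ path_inv (\<gamma> @ \<delta>))"
    unfolding g(2) l'(1) inv_DG[OF g(1)] mult_DG[OF g(1) lp] mult_DG[OF loop_append[OF g(1) lp] wpath_inv[OF g(1)]] by simp
  then show "A \<otimes>\<^bsub>DG\<^esub> l \<otimes>\<^bsub>DG\<^esub> inv\<^bsub>DG\<^esub> A \<in> left_stab (hact A K)"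
    unfolding g(2) K'(1) hact_hyp[OF g(1) K'(2)] stab_hyp[OF lifted_translate[OF g(1) K'(2)]] using l'(2) by auto
next
  fix K assume K: "K \<in> hyps"
  obtain \<delta> p u v q where K': "K = hyp (\<delta>, p, u, v, q)" "lifted (\<delta>, p, u, v, q)" using K by (rule hypsE)
  have d: "wpath w \<delta> (p @ u @ q)" "u \<in> W" "q \<in> W" "p \<in> W" "rule u v" using K' rule_words by auto
  have "finite {L. crossings [] \<delta> L \<noteq> 0}" by (rule finite_crossings[OF _ d(1)]) simp
  then have fin: "finite {L \<in> hyps. crossings [] \<delta> L \<noteq> 0}" by (rule finite_subset[rotated]) auto
  \<comment> \<open>The conjugating path \<open>\<delta>\<close> is traversed forwards and,
    translated, backwards, which gives a coboundary; what remains are the crossings of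
    \<open>m\<close> lifted at the end of \<open>\<delta>\<close>.\<close>
  have key: "class_crossings (loop_class (\<delta> @ m @ path_inv \<delta>)) L
      = crossings [] \<delta> L - crossings [] \<delta> (hact (inv\<^bsub>DG\<^esub> (loop_class (\<delta> @ m @ path_inv \<delta>))) L) + crossings \<delta> m L"
    if m: "wpath (p @ u @ q) m (p @ u @ q)" and L: "L \<in> hyps" for m L
  proof -
    let ?g = "\<delta> @ m @ path_inv \<delta>"
    note lp = loop_conj[OF d(1) m]
    have "hmt w (?g @ \<delta>) (\<delta> @ m)"
      using hmt_left[OF wpath_appendI[OF d(1) m] hmt_inv_left[OF _ d(1)]] by simp
    then have "crossings (\<delta> @ m) (path_inv \<delta>) L = crossings (?g @ \<delta>) (path_inv \<delta>) L"
      using crossings_hmt_start[OF wpath_appendI[OF lp d(1)] _ wpath_inv[OF d(1)]] by simp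
    also have "\<dots> = crossings \<delta> (path_inv \<delta>) (hact (inv\<^bsub>DG\<^esub> (loop_class ?g)) L)"
      by (rule crossings_shift[OF lp L d(1) wpath_inv[OF d(1)]])
    also have "\<dots> = - crossings [] \<delta> (hact (inv\<^bsub>DG\<^esub> (loop_class ?g)) L)"
      using crossings_hmt[OF hmt_inv_right[OF _ d(1)], of "[]" "hact (inv\<^bsub>DG\<^esub> (loop_class ?g)) L"]
      by (simp add: crossings_append)
    finally show ?thesis by (simp add: class_crossings_loop[OF lp] crossings_append)
  qed
  show "\<exists>b. finite {L \<in> hyps. b L \<noteq> 0} \<and>
      (\<forall>l\<in>left_stab K. \<forall>L\<in>hyps. class_crossings l L \<noteq> b L - b (hact (inv\<^bsub>DG\<^esub> l) L) \<longrightarrow> left_of L K) \<and>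
      (\<forall>r\<in>right_stab K. \<forall>L\<in>hyps. class_crossings r L \<noteq> b L - b (hact (inv\<^bsub>DG\<^esub> r) L) \<longrightarrow> left_of K L)"
  proof (intro exI[of _ "crossings [] \<delta>"] conjI fin ballI impI)
    fix l L assume l: "l \<in> left_stab K" and L: "L \<in> hyps"
      and ne: "class_crossings l L \<noteq> crossings [] \<delta> L - crossings [] \<delta> (hact (inv\<^bsub>DG\<^esub> l) L)"
    obtain \<pi> where l': "l = loop_class (\<delta> @ rc \<pi> (u @ q) @ path_inv \<delta>)" "wpath p \<pi> p"
      using l stab_hyp[OF K'(2)] K' by auto
    have m: "wpath (p @ u @ q) (rc \<pi> (u @ q)) (p @ u @ q)" using wpath_rc[OF l'(2), of "u @ q"] d by simp
    have "crossings \<delta> (rc \<pi> (u @ q)) L \<noteq> 0" using key[OF m L] ne l' by simp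
    then show "left_of L K" unfolding K'(1) by (rule crossings_rc_left[OF l'(2) d(5,3,1)])
  next
    fix r L assume r: "r \<in> right_stab K" and L: "L \<in> hyps"
      and ne: "class_crossings r L \<noteq> crossings [] \<delta> L - crossings [] \<delta> (hact (inv\<^bsub>DG\<^esub> r) L)"
    obtain \<rho> where r': "r = loop_class (\<delta> @ lc (p @ u) \<rho> @ path_inv \<delta>)" "wpath q \<rho> q"
      using r stab_hyp[OF K'(2)] K' by auto
    have m: "wpath (p @ u @ q) (lc (p @ u) \<rho>) (p @ u @ q)" using wpath_lc[OF r'(2), of "p @ u"] d by simp
    have "crossings \<delta> (lc (p @ u) \<rho>) L \<noteq> 0" using key[OF m L] ne r' by simp
    then show "left_of K L" unfolding K'(1) by (rule crossings_lc_right[OF r'(2) d(5,4,1)])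
  qed
next
  fix \<phi> :: "'a squier_edge list set \<Rightarrow> int"
  assume \<phi>: "\<And>A B. A \<in> carrier DG \<Longrightarrow> B \<in> carrier DG \<Longrightarrow> \<phi> (A \<otimes>\<^bsub>DG\<^esub> B) = \<phi> A + \<phi> B"
  obtain F where F: "\<And>\<gamma> K. loop \<gamma> \<Longrightarrow> K \<in> hyps \<Longrightarrow> F (hact (loop_class \<gamma>) K) = F K"
    "\<And>\<gamma>. loop \<gamma> \<Longrightarrow> 2 * \<phi> (loop_class \<gamma>) = sum' (\<lambda>K. F K * crossings [] \<gamma> K) hyps"
    using hom_crossings[of \<phi>] \<phi> by blast
  show "\<exists>F. (\<forall>A\<in>carrier DG. \<forall>K\<in>hyps. F (hact A K) = F K) \<and>
      (\<forall>A\<in>carrier DG. 2 * \<phi> A = sum' (\<lambda>K. F K * class_crossings A K) hyps)"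
    by (intro exI[of _ F]) (auto simp: carrier_DG F class_crossings_loop)
qed

end

section \<open>Transport along an isomorphism and the conclusion\<close>

lemma hyperplane_system_iso:
  assumes H: "hyperplane_system G' Hs act N lt DL DR" and f: "f \<in> iso G G'" and G: "group G"
  shows "hyperplane_system G Hs (\<lambda>g. act (f g)) (\<lambda>g. N (f g)) lt
    (\<lambda>K. {g \<in> carrier G. f g \<in> DL K}) (\<lambda>K. {g \<in> carrier G. f g \<in> DR K})"
proof -
  interpret H: hyperplane_system G' Hs act N lt DL DR by (rule H)
  interpret G: group G by (rule G)
  interpret f: group_hom G G' f
    using f by unfold_locales (simp add: iso_def)
  have bij: "bij_betw f (carrier G) (carrier G')" using f by (simp add: iso_def)
  then have inj: "inj_on f (carrier G)" and img: "f ` carrier G = carrier G'" by (auto simp: bij_betw_def)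
  have eq: "g = h \<longleftrightarrow> f g = f h" if "g \<in> carrier G" "h \<in> carrier G" for g h
    using inj that by (auto simp: inj_on_def)
  show ?thesis
  proof unfold_locales
    fix K g assume K: "K \<in> Hs" and g: "g \<in> carrier G" and fixed: "act (f g) K = K"
    obtain l r where lr: "l \<in> DL K" "r \<in> DR K" "f g = l \<otimes>\<^bsub>G'\<^esub> r"
      using H.stab_factor[OF K _ fixed] g by auto
    have "l \<in> f ` carrier G" "r \<in> f ` carrier G"
      using H.DL_stab[OF K lr(1)] H.DR_stab[OF K lr(2)] img by auto
    then obtain l' r' where lr': "l' \<in> carrier G" "l = f l'" "r' \<in> carrier G" "r = f r'" by auto
    then have "g = l' \<otimes>\<^bsub>G\<^esub> r'" using eq[of g "l' \<otimes>\<^bsub>G\<^esub> r'"] g lr by simp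
    then show "\<exists>l\<in>{g \<in> carrier G. f g \<in> DL K}. \<exists>r\<in>{g \<in> carrier G. f g \<in> DR K}. g = l \<otimes>\<^bsub>G\<^esub> r"
      using lr lr' by auto
  next
    fix K assume K: "K \<in> Hs"
    obtain b where b: "finite {L \<in> Hs. b L \<noteq> 0}"
      "\<forall>l\<in>DL K. \<forall>L\<in>Hs. N l L \<noteq> b L - b (act (inv\<^bsub>G'\<^esub> l) L) \<longrightarrow> lt L K"
      "\<forall>r\<in>DR K. \<forall>L\<in>Hs. N r L \<noteq> b L - b (act (inv\<^bsub>G'\<^esub> r) L) \<longrightarrow> lt K L"
      using H.cross[OF K] by blast
    show "\<exists>b. finite {L \<in> Hs. b L \<noteq> 0} \<and>
      (\<forall>l\<in>{g \<in> carrier G. f g \<in> DL K}. \<forall>L\<in>Hs. N (f l) L \<noteq> b L - b (act (f (inv\<^bsub>G\<^esub> l)) L) \<longrightarrow> lt L K) \<and>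
      (\<forall>r\<in>{g \<in> carrier G. f g \<in> DR K}. \<forall>L\<in>Hs. N (f r) L \<noteq> b L - b (act (f (inv\<^bsub>G\<^esub> r)) L) \<longrightarrow> lt K L)"
      by (intro exI[of _ b] conjI b(1)) (use b(2,3) in auto)
  next
    fix \<phi> :: "_ \<Rightarrow> int"
    assume \<phi>: "\<And>g h. g \<in> carrier G \<Longrightarrow> h \<in> carrier G \<Longrightarrow> \<phi> (g \<otimes>\<^bsub>G\<^esub> h) = \<phi> g + \<phi> h"
    \<comment> \<open>A homomorphism on \<open>G\<close> is represented by regarding it as one on
      \<open>G'\<close> through the inverse of \<open>f\<close>.\<close>
    define i where "i = inv_into (carrier G) f"
    have i: "i (f g) = g" if "g \<in> carrier G" for g using inj that by (simp add: i_def)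
    have "\<phi> (i (g' \<otimes>\<^bsub>G'\<^esub> h')) = \<phi> (i g') + \<phi> (i h')"
      if g': "g' \<in> carrier G'" and h': "h' \<in> carrier G'" for g' h'
    proof -
      obtain g h where gh: "g \<in> carrier G" "g' = f g" "h \<in> carrier G" "h' = f h"
        using g' h' img by blast
      then have "i (g' \<otimes>\<^bsub>G'\<^esub> h') = g \<otimes>\<^bsub>G\<^esub> h" using i[of "g \<otimes>\<^bsub>G\<^esub> h"] by simp
      then show ?thesis using gh \<phi> i by simp
    qed
    then obtain F where F: "\<forall>g\<in>carrier G'. \<forall>K\<in>Hs. F (act g K) = F K"
      "\<forall>g\<in>carrier G'. 2 * \<phi> (i g) = sum' (\<lambda>K. F K * N g K) Hs"
      using H.additive_repr[of "\<lambda>g. \<phi> (i g)"] by blast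
    have "2 * \<phi> g = sum' (\<lambda>K. F K * N (f g) K) Hs" if "g \<in> carrier G" for g
      using F(2)[rule_format, of "f g"] i[OF that] that by simp
    with F(1) show "\<exists>F. (\<forall>g\<in>carrier G. \<forall>K\<in>Hs. F (act (f g) K) = F K) \<and>
        (\<forall>g\<in>carrier G. 2 * \<phi> g = sum' (\<lambda>K. F K * N (f g) K) Hs)"
      by (intro exI[of _ F]) auto
  qed (use H.act_closed H.act_one H.act_mult H.N_mult H.N_finite H.lt_asym H.lt_act H.DL_stab H.DR_stab
      H.DL_DR_commute H.DL_act eq in \<open>auto\<close>)
qed

theorem theorem30:
  fixes n :: nat
  assumes "odd n" and "n \<ge> 5"
  shows "\<not> is_diagram_group TYPE('a) (cycle_group n)"
proof
  assume "is_diagram_group TYPE('a) (cycle_group n)"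
  then obtain P :: "'a semigroup_presentation" and w where P: "valid_presentation P"
    "w \<in> nonempty_words (alphabet P)" "cycle_group n \<cong> diagram_group P w"
    by (auto simp: is_diagram_group_def)
  then obtain f where f: "f \<in> iso (cycle_group n) (diagram_group P w)" by (auto simp: is_iso_def)
  interpret squier P w using P by unfold_locales
  obtain E where E: "cycle_raag (cycle_group n) n (cycle_gen n) E"
    using cycle_raag_cycle_group assms by blast
  have "group (cycle_group n)" unfolding cycle_group_eq by (rule group_presented_group)
  then have "hyperplane_system (cycle_group n) hyps (\<lambda>g. hact (f g)) (\<lambda>g. class_crossings (f g)) left_of
      (\<lambda>K. {g \<in> carrier (cycle_group n). f g \<in> left_stab K}) (\<lambda>K. {g \<in> carrier (cycle_group n). f g \<in> right_stab K})"
    using hyperplane_system_iso[OF hyperplane_system_DG f] by blast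
  with E interpret cycle_hyperplanes "cycle_group n" n "cycle_gen n" E hyps "\<lambda>g. hact (f g)"
      "\<lambda>g. class_crossings (f g)" left_of "\<lambda>K. {g \<in> carrier (cycle_group n). f g \<in> left_stab K}"
      "\<lambda>K. {g \<in> carrier (cycle_group n). f g \<in> right_stab K}"
    by (rule cycle_hyperplanes.intro)
  show False using odd_cycle_contradiction assms by blast
qed

end
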